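(* Let $\mathbb{K}$ be a locally compact topological field, $E$ a topological $\mathbb{K}$-vector space, $r,k\in\mathbb{N}_0\cup\{\infty\}$, $M$ a finite-dimensional $C^r_{\mathbb{K}}$-manifold, $F$ a finite-dimensional $\mathbb{K}$-vector space, $U\subseteq F$ open, and $K\subseteq M$ compact. Then the composition map $$\Gamma\colon C^{r+k}(U,E)\times C^r_K(M,U)\to C^r(M,E),\qquad\Gamma(\gamma,\eta):=\gamma\circ\eta$$ is of class $C^k_{\mathbb{K}}$. If $k\ge1$, then $$d\Gamma(\gamma,\eta,\gamma_1,\eta_1)=d\gamma\circ(\eta,\eta_1)+\gamma_1\circ\eta$$ for all $\gamma,\gamma_1\in C^{r+k}(U,E)$, $\eta\in C^r_K(M,U)$ and $\eta_1\in C^r_K(M,F)$.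
   Context: All topological spaces, fields and topological vector spaces are Hausdorff; topological fields are non-discrete. Finite-dimensional $\mathbb{K}$-vector spaces carry their canonical ($\cong\mathbb{K}^d$) topology. Differential calculus over a topological field $\mathbb{K}$: For a topological $\mathbb{K}$-vector space $E$ and $U\subseteq E$ open, put $U^{[0]}:=U$, $U^{[1]}:=\{(x,y,t)\in U\times E\times\mathbb{K}: x+ty\in U\}$ and $U^{[j+1]}:=(U^{[j]})^{[1]}$. A map $f\colon U\to F$ into a topological $\mathbb{K}$-vector space is $C^0_{\mathbb{K}}$ if it is continuous ($f^{[0]}:=f$); it is $C^1_{\mathbb{K}}$ if it is continuous and there is a (necessarily unique) continuous map $f^{[1]}\colon U^{[1]}\to F$ with $f^{[1]}(x,y,t)=\frac1t(f(x+ty)-f(x))$ for all $(x,y,t)\in U^{[1]}$ with $t\neq0$; for $k\ge2$ it is $C^k_{\mathbb{K}}$ if it is $C^{k-1}_{\mathbb{K}}$ and $f^{[k-1]}$ is $C^1_{\mathbb{K}}$, and then $f^{[k]}:=(f^{[k-1]})^{[1]}$; it is $C^\infty_{\mathbb{K}}$ if it is $C^k_{\mathbb{K}}$ for all $k$. For a $C^1$-map, $df(x,v):=f^{[1]}(x,v,0)$. Manifolds and $C^r$-maps on them are defined as usual via charts. Function spaces: For $V$ open in a topological $\mathbb{K}$-vector space, $C^r(V,E)$ is the space of $C^r_{\mathbb{K}}$-maps $V\to E$ with the initial topology with respect to the maps $\gamma\mapsto\gamma^{[j]}\in C(V^{[j]},E)$ (compact-open topology), $j\in\mathbb{N}_0$,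 $j\le r$. $C^r(M,E)$ is the space of $C^r_{\mathbb{K}}$-maps $M\to E$ with the initial topology with respect to the maps $\gamma\mapsto\gamma|_W\circ\kappa^{-1}\in C^r(V,E)$, for $\kappa\colon W\to V$ ranging through the charts of $M$. For compact $K\subseteq M$, $C^r_K(M,F):=\{\eta\in C^r(M,F):\operatorname{supp}\eta\subseteq K\}$ carries the induced topology, and $C^r_K(M,U):=\{\eta\in C^r_K(M,F):\eta(M)\subseteq U\}$, an open (possibly empty) subset of $C^r_K(M,F)$. *)

theory Defs
  imports "HOL-Analysis.Analysis" "HOL-Algebra.Algebraic_Closure_Type"
begin

section \<open>Topological fields and topological vector spaces\<close>

text \<open>Class \<^class>\<open>perfect_space\<close> says that no point is isolated, that is,
  the field is non-discrete.\<close>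

class topological_field = field + topological_ab_group_add + topological_semigroup_mult
    + t2_space + perfect_space +
  assumes tendsto_inverse_nhds: "a \<noteq> 0 \<Longrightarrow> (inverse \<longlongrightarrow> inverse a) (nhds a)"

text \<open>Vector spaces are HOL-Algebra modules over the field given by the type \<open>'k\<close>. Module records
  inherit the fields \<open>mult\<close> and \<open>one\<close> from ring records; these play no role for modules and
  are left undefined below.\<close>

record ('k, 'v) tvs = "('k, 'v) module" +
  topol :: "'v topology"

locale topological_vector_space =
  Module.module "ring_of_type_algebra :: 'k ring" E
  for E :: "('k :: topological_field, 'v) tvs" (structure) +
  assumes topspace_topol: "topspace (topol E) = carrier E"
    and Hausdorff: "Hausdorff_space (topol E)"
    and continuous_add:
      "continuous_map (prod_topology (topol E) (topol E)) (topol E) (\<lambda>(x, y). x \<oplus> y)"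
    and continuous_smult:
      "continuous_map (prod_topology euclidean (topol E)) (topol E) (\<lambda>(t, x). t \<odot> x)"

definition finite_dimensional_tvs :: "('k :: topological_field, 'v) tvs \<Rightarrow> bool" where
  "finite_dimensional_tvs F \<longleftrightarrow> topological_vector_space F \<and>
    (\<exists>(d :: nat) b. b \<in> {..<d} \<rightarrow> carrier F \<and>
      homeomorphic_map (product_topology (\<lambda>_. euclidean) {..<d}) (topol F)
        (\<lambda>x. \<Oplus>\<^bsub>F\<^esub>i\<in>{..<d}. x i \<odot>\<^bsub>F\<^esub> b i))"

definition field_tvs :: "('k :: topological_field, 'k) tvs" where
  "field_tvs = \<lparr>carrier = UNIV, monoid.mult = undefined, one = undefined,
    ring.zero = 0, add = (+), smult = (*), topol = euclidean\<rparr>"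

definition prod_tvs :: "('k, 'v) tvs \<Rightarrow> ('k, 'w) tvs \<Rightarrow> ('k, 'v \<times> 'w) tvs" where
  "prod_tvs E F = \<lparr>carrier = carrier E \<times> carrier F, monoid.mult = undefined, one = undefined,
    ring.zero = (\<zero>\<^bsub>E\<^esub>, \<zero>\<^bsub>F\<^esub>),
    add = (\<lambda>(x, y) (x', y'). (x \<oplus>\<^bsub>E\<^esub> x', y \<oplus>\<^bsub>F\<^esub> y')),
    smult = (\<lambda>t (x, y). (t \<odot>\<^bsub>E\<^esub> x, t \<odot>\<^bsub>F\<^esub> y)),
    topol = prod_topology (topol E) (topol F)\<rparr>"

text \<open>Transport of structure along an injective map \<open>\<phi>\<close>.\<close>

definition transport_tvs :: "('v \<Rightarrow> 'w) \<Rightarrow> ('k, 'v) tvs \<Rightarrow> ('k, 'w) tvs" where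
  "transport_tvs \<phi> E = \<lparr>carrier = \<phi> ` carrier E, monoid.mult = undefined, one = undefined,
    ring.zero = \<phi> \<zero>\<^bsub>E\<^esub>,
    add = (\<lambda>p q. \<phi> (inv_into UNIV \<phi> p \<oplus>\<^bsub>E\<^esub> inv_into UNIV \<phi> q)),
    smult = (\<lambda>t p. \<phi> (t \<odot>\<^bsub>E\<^esub> inv_into UNIV \<phi> p)),
    topol = pullback_topology (\<phi> ` carrier E) (inv_into UNIV \<phi>) (topol E)\<rparr>"


section \<open>Maps of class \<open>C\<^sup>k\<close>\<close>

text \<open>The ambient space \<open>E\<^sup>[\<^sup>j\<^sup>]\<close> of \<open>U\<^sup>[\<^sup>j\<^sup>]\<close> is \<open>E\<^sup>[\<^sup>0\<^sup>] = E\<close> and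
  \<open>E\<^sup>[\<^sup>j\<^sup>+\<^sup>1\<^sup>] = E\<^sup>[\<^sup>j\<^sup>] \<times> E\<^sup>[\<^sup>j\<^sup>] \<times> K\<close>. As its type would depend on \<open>j\<close>, the points of all the
  \<open>E\<^sup>[\<^sup>j\<^sup>]\<close> are collected in one datatype, where \<open>Base x\<close> stands for \<open>x \<in> E\<close> and \<open>Step x y t\<close>
  for the triple \<open>(x, y, t)\<close>.\<close>

datatype ('k, 'v) bpoint =
  Base 'v
| Step "('k, 'v) bpoint" "('k, 'v) bpoint" 'k

primrec bspace :: "('k :: topological_field, 'v) tvs \<Rightarrow> nat \<Rightarrow> ('k, ('k, 'v) bpoint) tvs" where
  "bspace E 0 = transport_tvs Base E"
| "bspace E (Suc j) = transport_tvs (\<lambda>(x, y, t). Step x y t)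
    (prod_tvs (bspace E j) (prod_tvs (bspace E j) field_tvs))"

primrec bdom :: "('k :: topological_field, 'v) tvs \<Rightarrow> 'v set \<Rightarrow> nat \<Rightarrow> ('k, 'v) bpoint set" where
  "bdom E U 0 = Base ` U"
| "bdom E U (Suc j) = {Step x y t | x y t.
    x \<in> bdom E U j \<and> y \<in> carrier (bspace E j) \<and>
    x \<oplus>\<^bsub>bspace E j\<^esub> t \<odot>\<^bsub>bspace E j\<^esub> y \<in> bdom E U j}"

definition btop :: "('k :: topological_field, 'v) tvs \<Rightarrow> 'v set \<Rightarrow> nat \<Rightarrow> ('k, 'v) bpoint topology" where
  "btop E U j = subtopology (topol (bspace E j)) (bdom E U j)"

text \<open>\<open>h = g\<^sup>[\<^sup>1\<^sup>]\<close> for a map \<open>g\<close> on \<open>U\<^sup>[\<^sup>j\<^sup>]\<close>. If \<open>U\<close> is open, there is at most one such \<open>h\<close>,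
  by density of the set of all \<open>(x, y, t)\<close> with \<open>t \<noteq> 0\<close>; extensionality
  fixes the values of \<open>h\<close> outside its domain.\<close>

definition is_bracket :: "('k :: topological_field, 'v) tvs \<Rightarrow> 'v set \<Rightarrow> ('k, 'w) tvs \<Rightarrow> nat \<Rightarrow>
    (('k, 'v) bpoint \<Rightarrow> 'w) \<Rightarrow> (('k, 'v) bpoint \<Rightarrow> 'w) \<Rightarrow> bool" where
  "is_bracket E U F j g h \<longleftrightarrow>
    h \<in> extensional (bdom E U (Suc j)) \<and>
    continuous_map (btop E U (Suc j)) (topol F) h \<and>
    (\<forall>x y t. Step x y t \<in> bdom E U (Suc j) \<and> t \<noteq> 0 \<longrightarrow>
      h (Step x y t) =
        inverse t \<odot>\<^bsub>F\<^esub> (g (x \<oplus>\<^bsub>bspace E j\<^esub> t \<odot>\<^bsub>bspace E j\<^esub> y) \<ominus>\<^bsub>F\<^esub> g x))"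

primrec bmap :: "('k :: topological_field, 'v) tvs \<Rightarrow> 'v set \<Rightarrow> ('k, 'w) tvs \<Rightarrow> ('v \<Rightarrow> 'w) \<Rightarrow> nat \<Rightarrow>
    (('k, 'v) bpoint \<Rightarrow> 'w)" where
  "bmap E U F f 0 = (\<lambda>p\<in>bdom E U 0. f (inv_into UNIV Base p))"
| "bmap E U F f (Suc j) = (THE h. is_bracket E U F j (bmap E U F f j) h)"

text \<open>The following notions are meant for open \<open>U\<close>, which is not repeated in the definitions.\<close>

primrec Ck :: "('k :: topological_field, 'v) tvs \<Rightarrow> 'v set \<Rightarrow> ('k, 'w) tvs \<Rightarrow> nat \<Rightarrow>
    ('v \<Rightarrow> 'w) \<Rightarrow> bool" where
  "Ck E U F 0 f \<longleftrightarrow> continuous_map (subtopology (topol E) U) (topol F) f"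
| "Ck E U F (Suc k) f \<longleftrightarrow> Ck E U F k f \<and>
    continuous_map (btop E U k) (topol F) (bmap E U F f k) \<and>
    (\<exists>h. is_bracket E U F k (bmap E U F f k) h)"

definition Cr :: "('k :: topological_field, 'v) tvs \<Rightarrow> 'v set \<Rightarrow> ('k, 'w) tvs \<Rightarrow> enat \<Rightarrow>
    ('v \<Rightarrow> 'w) \<Rightarrow> bool" where
  "Cr E U F r f \<longleftrightarrow> (\<forall>k. enat k \<le> r \<longrightarrow> Ck E U F k f)"

definition differential :: "('k :: topological_field, 'v) tvs \<Rightarrow> 'v set \<Rightarrow> ('k, 'w) tvs \<Rightarrow>
    ('v \<Rightarrow> 'w) \<Rightarrow> 'v \<Rightarrow> 'v \<Rightarrow> 'w" where
  "differential E U F f x v = bmap E U F f 1 (Step (Base x) (Base v) 0)"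


section \<open>Manifolds\<close>

text \<open>A chart \<open>\<kappa> : W \<rightarrow> V\<close> is the pair \<open>(W, \<kappa>)\<close>, with \<open>V = \<kappa> ` W\<close>; the values of \<open>\<kappa>\<close> outside
  \<open>W\<close> are irrelevant.\<close>

record ('k, 'm, 'z) manifold =
  space_of :: "'m topology"
  model :: "('k, 'z) tvs"
  charts :: "('m set \<times> ('m \<Rightarrow> 'z)) set"

definition is_chart :: "'m topology \<Rightarrow> ('k :: topological_field, 'z) tvs \<Rightarrow>
    'm set \<times> ('m \<Rightarrow> 'z) \<Rightarrow> bool" where
  "is_chart T Z = (\<lambda>(W, \<kappa>). openin T W \<and> openin (topol Z) (\<kappa> ` W) \<and>
    homeomorphic_map (subtopology T W) (subtopology (topol Z) (\<kappa> ` W)) \<kappa>)"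

definition Cr_transition :: "('k :: topological_field, 'z) tvs \<Rightarrow> enat \<Rightarrow>
    'm set \<times> ('m \<Rightarrow> 'z) \<Rightarrow> 'm set \<times> ('m \<Rightarrow> 'z) \<Rightarrow> bool" where
  "Cr_transition Z r = (\<lambda>(W, \<kappa>) (W', \<kappa>').
    Cr Z (\<kappa> ` (W \<inter> W')) Z r (\<lambda>z. \<kappa>' (inv_into W \<kappa> z)))"

definition Cr_manifold :: "enat \<Rightarrow> ('k :: topological_field, 'm, 'z) manifold \<Rightarrow> bool" where
  "Cr_manifold r M \<longleftrightarrow>
    topological_vector_space (model M) \<and>
    Hausdorff_space (space_of M) \<and>
    (\<forall>c \<in> charts M. is_chart (space_of M) (model M) c) \<and>
    (\<Union>(W, \<kappa>)\<in>charts M. W) = topspace (space_of M) \<and>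
    (\<forall>c \<in> charts M. \<forall>c' \<in> charts M. Cr_transition (model M) r c c') \<and>
    (\<forall>c. is_chart (space_of M) (model M) c \<and>
      (\<forall>c' \<in> charts M. Cr_transition (model M) r c c' \<and> Cr_transition (model M) r c' c)
      \<longrightarrow> c \<in> charts M)"

definition Cr_on_manifold :: "('k :: topological_field, 'm, 'z) manifold \<Rightarrow> ('k, 'v) tvs \<Rightarrow> enat \<Rightarrow>
    ('m \<Rightarrow> 'v) \<Rightarrow> bool" where
  "Cr_on_manifold M E r f \<longleftrightarrow> continuous_map (space_of M) (topol E) f \<and>
    (\<forall>(W, \<kappa>) \<in> charts M. Cr (model M) (\<kappa> ` W) E r (\<lambda>z. f (inv_into W \<kappa> z)))"


section \<open>Function spaces\<close>

text \<open>Functions on \<open>S\<close> are represented by extensional functions, so that equality of functions is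
  equality on \<open>S\<close>.\<close>

definition compact_open_topology :: "'a topology \<Rightarrow> 'b topology \<Rightarrow> ('a \<Rightarrow> 'b) topology" where
  "compact_open_topology T T' = topology_generated_by
    {{f \<in> extensional (topspace T). continuous_map T T' f \<and> f ` K \<subseteq> Q} | K Q.
      compactin T K \<and> openin T' Q}"

text \<open>The insertion of \<open>S\<close> only matters if \<open>I\<close> is empty.\<close>

definition initial_topology :: "'a set \<Rightarrow> 'i set \<Rightarrow> ('i \<Rightarrow> 'b topology) \<Rightarrow> ('i \<Rightarrow> 'a \<Rightarrow> 'b) \<Rightarrow>
    'a topology" where
  "initial_topology S I T \<phi> = topology_generated_by
    (insert S {{x \<in> S. \<phi> i x \<in> Q} | i Q. i \<in> I \<and> openin (T i) Q})"

definition function_tvs :: "'a set \<Rightarrow> ('k, 'v) tvs \<Rightarrow> ('a \<Rightarrow> 'v) set \<Rightarrow> ('a \<Rightarrow> 'v) topology \<Rightarrow>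
    ('k, 'a \<Rightarrow> 'v) tvs" where
  "function_tvs S E A T = \<lparr>carrier = A, monoid.mult = undefined, one = undefined,
    ring.zero = (\<lambda>x\<in>S. \<zero>\<^bsub>E\<^esub>),
    add = (\<lambda>f g. \<lambda>x\<in>S. f x \<oplus>\<^bsub>E\<^esub> g x),
    smult = (\<lambda>t f. \<lambda>x\<in>S. t \<odot>\<^bsub>E\<^esub> f x),
    topol = T\<rparr>"

text \<open>\<open>Cr_space Z V E r\<close> is \<open>C\<^sup>r(V, E)\<close> for \<open>V\<close> open in \<open>Z\<close>, and \<open>Cr_manifold_space M E r\<close> is
  \<open>C\<^sup>r(M, E)\<close>.\<close>

definition Cr_space :: "('k :: topological_field, 'z) tvs \<Rightarrow> 'z set \<Rightarrow> ('k, 'v) tvs \<Rightarrow> enat \<Rightarrow>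
    ('k, 'z \<Rightarrow> 'v) tvs" where
  "Cr_space Z V E r = (let A = {\<gamma> \<in> extensional V. Cr Z V E r \<gamma>} in
    function_tvs V E A
      (initial_topology A {j. enat j \<le> r}
        (\<lambda>j. compact_open_topology (btop Z V j) (topol E))
        (\<lambda>j \<gamma>. bmap Z V E \<gamma> j)))"

definition Cr_manifold_space :: "('k :: topological_field, 'm, 'z) manifold \<Rightarrow> ('k, 'v) tvs \<Rightarrow> enat \<Rightarrow>
    ('k, 'm \<Rightarrow> 'v) tvs" where
  "Cr_manifold_space M E r =
    (let S = topspace (space_of M); A = {\<gamma> \<in> extensional S. Cr_on_manifold M E r \<gamma>} in
    function_tvs S E A
      (initial_topology A (charts M)
        (\<lambda>(W, \<kappa>). topol (Cr_space (model M) (\<kappa> ` W) E r))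
        (\<lambda>(W, \<kappa>) \<gamma>. compose (\<kappa> ` W) \<gamma> (inv_into W \<kappa>))))"

definition support :: "'m topology \<Rightarrow> ('k, 'v) tvs \<Rightarrow> ('m \<Rightarrow> 'v) \<Rightarrow> 'm set" where
  "support T F \<eta> = T closure_of {x \<in> topspace T. \<eta> x \<noteq> \<zero>\<^bsub>F\<^esub>}"

definition CrK_space :: "('k :: topological_field, 'm, 'z) manifold \<Rightarrow> 'm set \<Rightarrow> ('k, 'v) tvs \<Rightarrow> enat \<Rightarrow>
    ('k, 'm \<Rightarrow> 'v) tvs" where
  "CrK_space M K F r =
    (let C = Cr_manifold_space M F r; A = {\<eta> \<in> carrier C. support (space_of M) F \<eta> \<subseteq> K} in
    function_tvs (topspace (space_of M)) F A (subtopology (topol C) A))"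

definition CrK_into :: "('k :: topological_field, 'm, 'z) manifold \<Rightarrow> 'm set \<Rightarrow> ('k, 'v) tvs \<Rightarrow>
    'v set \<Rightarrow> enat \<Rightarrow> ('m \<Rightarrow> 'v) set" where
  "CrK_into M K F U r = {\<eta> \<in> carrier (CrK_space M K F r). \<eta> ` topspace (space_of M) \<subseteq> U}"

end

(*
  The brackets of \<Gamma> are computed explicitly. Since maps into C^r(M,E) are continuous if and only if
  all their brackets along M are jointly continuous in parameter and point (exponential law, by local
  compactness), everything reduces to pointwise formulas. In the expansion

    (\<gamma> + t \<gamma>')(\<eta> + t \<eta>') - \<gamma>(\<eta>) = t (\<gamma>^[1](\<eta>, \<eta>', t) + \<gamma>'(\<eta>) + t \<gamma>'^[1](\<eta>, \<eta>', t))

  every summand on the right is a scalar times some g^[i] \<circ> \<alpha>, where the scalar, g \<in> C^(r+k)(U,E) and the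
  C^r-map \<alpha> from M to U^[i] depend linearly on the argument of the bracket. The same expansion with
  \<gamma>^[i] in place of \<gamma> shows that sums of such terms, with several scalar factors, are stable under
  brackets, each of which costs one order of g. After k brackets, g^[i] is still of class C^r, so that the
  chain rule along M applies.
*)
theory Submission
  imports Defs
begin


section \<open>Topological vector spaces\<close>

text \<open>The inner maps \<alpha> have to stay linear, since the bracket of g^[i](\<alpha>(p))
  would otherwise involve brackets of \<alpha>. For linear \<alpha>, \<alpha>(p + t p') =
  \<alpha>(p) + t \<alpha>(p'), so the next inner map is (\<alpha>(p), \<alpha>(p'), t). This is
  linear in (p, p', t), as t is itself a coordinate of the ambient space. In contrast, \<eta> + t
  \<eta>' contains the product t \<eta>', so \<gamma>'(\<eta> + t \<eta>') cannot be kept as it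
  stands. Expanding it costs an order of \<gamma>', but forming \<gamma>^[1] costs one at the same
  stage anyway.

  Quotients are avoided: a bracket h of g is handled through g(x + t y) = g(x) + t h(x, y, t). For
  families with a parameter only the existence of such h, jointly continuous with the parameter, is
  recorded at each stage, so that sums and compositions can be treated without uniqueness.
  Uniqueness, due to the field being non-discrete, identifies these h with the brackets
  \<open>bmap\<close> that define the topologies. Local compactness of all U^[j] is inherited from
  the field by finite dimension, and compactness of K makes the domain of \<Gamma> open.\<close>

declare ring_of_type_algebra_def [simp]

lemma continuous_map_plus_field:
  fixes f g :: "'a \<Rightarrow> 'k :: topological_field"
  assumes "continuous_map A euclidean f" "continuous_map A euclidean g"
  shows "continuous_map A euclidean (\<lambda>x. f x + g x)"
  using assms by (auto simp: continuous_map_atin intro: tendsto_add)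

lemma continuous_map_times_field:
  fixes f g :: "'a \<Rightarrow> 'k :: topological_field"
  assumes "continuous_map A euclidean f" "continuous_map A euclidean g"
  shows "continuous_map A euclidean (\<lambda>x. f x * g x)"
  using assms by (auto simp: continuous_map_atin intro: tendsto_mult)

context topological_vector_space
begin

lemma smult_carrier [simp, intro]: "x \<in> carrier E \<Longrightarrow> t \<odot> x \<in> carrier E"
  using smult_closed[of t x] by simp

lemma smult_add_left: "x \<in> carrier E \<Longrightarrow> (s + t) \<odot> x = s \<odot> x \<oplus> t \<odot> x"
  using smult_l_distr[of s t x] by simp

lemma smult_add_right: "x \<in> carrier E \<Longrightarrow> y \<in> carrier E \<Longrightarrow> t \<odot> (x \<oplus> y) = t \<odot> x \<oplus> t \<odot> y"
  using smult_r_distr[of t x y] by simp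

lemma smult_smult: "x \<in> carrier E \<Longrightarrow> s \<odot> (t \<odot> x) = (s * t) \<odot> x"
  using smult_assoc1[of s t x] by simp

lemma smult_1 [simp]: "x \<in> carrier E \<Longrightarrow> 1 \<odot> x = x"
  using smult_one[of x] by simp

lemma smult_0_left [simp]: "x \<in> carrier E \<Longrightarrow> 0 \<odot> x = \<zero>"
  using smult_l_null[of x] by simp

lemma smult_0_right [simp]: "t \<odot> \<zero> = \<zero>"
  using smult_r_null[of t] by simp

lemma difference_quotient_iff:
  assumes "t \<noteq> 0" "h \<in> carrier E" "a \<in> carrier E" "b \<in> carrier E"
  shows "h = inverse t \<odot> (b \<ominus> a) \<longleftrightarrow> b = a \<oplus> t \<odot> h"
proof
  assume h: "h = inverse t \<odot> (b \<ominus> a)"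
  then have "t \<odot> h = b \<ominus> a"
    using assms by (simp add: smult_smult)
  then show "b = a \<oplus> t \<odot> h"
    using assms by (metis M.add.inv_solve_right' M.minus_closed M.minus_eq M.a_comm smult_carrier)
next
  assume b: "b = a \<oplus> t \<odot> h"
  then have "b \<ominus> a = t \<odot> h"
    using assms
    by (metis M.add.inv_solve_right' M.minus_closed M.minus_eq M.a_comm smult_carrier)
  then show "h = inverse t \<odot> (b \<ominus> a)"
    using assms by (simp add: smult_smult)
qed

lemma smult_left_cancel:
  assumes "t \<noteq> 0" "x \<in> carrier E" "y \<in> carrier E" "t \<odot> x = t \<odot> y"
  shows "x = y"
proof -
  have "inverse t \<odot> (t \<odot> x) = inverse t \<odot> (t \<odot> y)" using assms by simp
  then show ?thesis using assms(1-3) by (simp add: smult_smult)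
qed

lemma continuous_map_add:
  assumes "continuous_map A (topol E) f" "continuous_map A (topol E) g"
  shows "continuous_map A (topol E) (\<lambda>x. f x \<oplus> g x)"
  using continuous_map_compose[OF continuous_map_pairedI[OF assms] continuous_add]
  by (simp add: o_def)

lemma continuous_map_smult:
  assumes "continuous_map A euclidean c" "continuous_map A (topol E) f"
  shows "continuous_map A (topol E) (\<lambda>x. c x \<odot> f x)"
  using continuous_map_compose[OF continuous_map_pairedI[OF assms] continuous_smult]
  by (simp add: o_def)

end

text \<open>Additive inverses need no separate hypothesis: (-1) x is inverse to x, by distributivity
  over scalars and 0 x = 0.\<close>

lemma topological_vector_spaceI:
  fixes E :: "('k :: topological_field, 'v) tvs" (structure)
  assumes zero: "\<zero> \<in> carrier E"
    and add: "\<And>x y. x \<in> carrier E \<Longrightarrow> y \<in> carrier E \<Longrightarrow> x \<oplus> y \<in> carrier E"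
    and assoc: "\<And>x y z. x \<in> carrier E \<Longrightarrow> y \<in> carrier E \<Longrightarrow> z \<in> carrier E \<Longrightarrow>
      x \<oplus> y \<oplus> z = x \<oplus> (y \<oplus> z)"
    and comm: "\<And>x y. x \<in> carrier E \<Longrightarrow> y \<in> carrier E \<Longrightarrow> x \<oplus> y = y \<oplus> x"
    and zero_add: "\<And>x. x \<in> carrier E \<Longrightarrow> \<zero> \<oplus> x = x"
    and smult: "\<And>t x. x \<in> carrier E \<Longrightarrow> t \<odot> x \<in> carrier E"
    and zero_smult: "\<And>x. x \<in> carrier E \<Longrightarrow> 0 \<odot> x = \<zero>"
    and add_left: "\<And>s t x. x \<in> carrier E \<Longrightarrow> (s + t) \<odot> x = s \<odot> x \<oplus> t \<odot> x"
    and add_right: "\<And>t x y. x \<in> carrier E \<Longrightarrow> y \<in> carrier E \<Longrightarrow> t \<odot> (x \<oplus> y) = t \<odot> x \<oplus> t \<odot> y"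
    and smult_smult: "\<And>s t x. x \<in> carrier E \<Longrightarrow> s \<odot> (t \<odot> x) = (s * t) \<odot> x"
    and one: "\<And>x. x \<in> carrier E \<Longrightarrow> 1 \<odot> x = x"
    and topspace: "topspace (topol E) = carrier E"
    and Hausdorff: "Hausdorff_space (topol E)"
    and cont_add: "continuous_map (prod_topology (topol E) (topol E)) (topol E) (\<lambda>(x, y). x \<oplus> y)"
    and cont_smult: "continuous_map (prod_topology euclidean (topol E)) (topol E) (\<lambda>(t, x). t \<odot> x)"
  shows "topological_vector_space E"
proof -
  have inv: "(- 1) \<odot> x \<oplus> x = \<zero>" if "x \<in> carrier E" for x
    using that add_left[of x "-1" 1] one zero_smult by simp
  have "abelian_group E"
    by (rule abelian_groupI)
      (auto intro: zero add assoc comm zero_add inv smult intro!: bexI[of _ "(- 1) \<odot> _"])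
  moreover have "cring (ring_of_type_algebra :: 'k ring)"
    by (rule cring_from_type_algebra)
  ultimately have "Module.module (ring_of_type_algebra :: 'k ring) E"
    by (intro moduleI) (simp_all add: assms)
  then show ?thesis
    by (intro topological_vector_space.intro topological_vector_space_axioms.intro assms)
qed

section \<open>Transport along injections, the field as a vector space, products\<close>

lemma transport_tvs_simps:
  assumes "inj \<phi>"
  shows "carrier (transport_tvs \<phi> E) = \<phi> ` carrier E"
    "zero (transport_tvs \<phi> E) = \<phi> \<zero>\<^bsub>E\<^esub>"
    "add (transport_tvs \<phi> E) (\<phi> x) (\<phi> y) = \<phi> (x \<oplus>\<^bsub>E\<^esub> y)"
    "smult (transport_tvs \<phi> E) t (\<phi> x) = \<phi> (t \<odot>\<^bsub>E\<^esub> x)"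
    "topol (transport_tvs \<phi> E) = pullback_topology (\<phi> ` carrier E) (inv_into UNIV \<phi>) (topol E)"
  using assms by (auto simp: transport_tvs_def)

lemma continuous_map_into_transport:
  assumes "inj \<phi>" "continuous_map A (topol E) f" "topspace (topol E) = carrier E"
  shows "continuous_map A (topol (transport_tvs \<phi> E)) (\<lambda>x. \<phi> (f x))"
  unfolding transport_tvs_simps(5)[OF assms(1)]
proof (rule continuous_map_pullback')
  show "continuous_map A (topol E) (inv_into UNIV \<phi> \<circ> (\<lambda>x. \<phi> (f x)))"
    using assms by (simp add: o_def)
  show "topspace A \<subseteq> (\<lambda>x. \<phi> (f x)) -` \<phi> ` carrier E"
    using continuous_map_image_subset_topspace[OF assms(2)] assms(3) by auto
qed

lemma continuous_map_inv_transport: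
  assumes "inj \<phi>"
  shows "continuous_map (topol (transport_tvs \<phi> E)) (topol E) (inv_into UNIV \<phi>)"
  unfolding transport_tvs_simps(5)[OF assms(1)]
  using continuous_map_pullback[of "topol E" "topol E" id] by simp

lemma homeomorphic_map_transport:
  assumes "inj \<phi>" "topspace (topol E) = carrier E"
  shows "homeomorphic_map (topol E) (topol (transport_tvs \<phi> E)) \<phi>"
proof -
  have "homeomorphic_maps (topol E) (topol (transport_tvs \<phi> E)) \<phi> (inv_into UNIV \<phi>)"
    unfolding homeomorphic_maps_def
    using continuous_map_into_transport[OF assms(1) continuous_map_id assms(2)]
      continuous_map_inv_transport[OF assms(1)] assms
    by (auto simp: transport_tvs_simps topspace_pullback_topology)
  then show ?thesis
    using homeomorphic_map_maps by blast
qed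

lemma topological_vector_space_transport:
  assumes "inj \<phi>" "topological_vector_space E"
  shows "topological_vector_space (transport_tvs \<phi> E)"
proof -
  interpret topological_vector_space E by fact
  note s = transport_tvs_simps[OF assms(1), of E]
  let ?T = "topol (transport_tvs \<phi> E)" and ?i = "inv_into UNIV \<phi>"
  have top: "topspace ?T = \<phi> ` carrier E"
    using assms by (auto simp: s topspace_pullback_topology topspace_topol)
  have ci: "continuous_map ?T (topol E) ?i"
    by (rule continuous_map_inv_transport[OF assms(1)])
  have "continuous_map (prod_topology ?T ?T) ?T (\<lambda>p. \<phi> (?i (fst p) \<oplus>\<^bsub>E\<^esub> ?i (snd p)))"
    by (intro continuous_map_into_transport assms continuous_map_add topspace_topol
      continuous_map_compose[OF _ ci, unfolded o_def] continuous_map_fst continuous_map_snd)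
  then have 1: "continuous_map (prod_topology ?T ?T) ?T (\<lambda>(x, y). x \<oplus>\<^bsub>transport_tvs \<phi> E\<^esub> y)"
    by (rule continuous_map_eq) (auto simp: top s(3,4) assms(1))
  have "continuous_map (prod_topology euclidean ?T) ?T (\<lambda>p. \<phi> (fst p \<odot>\<^bsub>E\<^esub> ?i (snd p)))"
    by (intro continuous_map_into_transport assms continuous_map_smult topspace_topol
      continuous_map_compose[OF _ ci, unfolded o_def] continuous_map_fst continuous_map_snd)
  then have 2: "continuous_map (prod_topology euclidean ?T) ?T (\<lambda>(x, y). x \<odot>\<^bsub>transport_tvs \<phi> E\<^esub> y)"
    by (rule continuous_map_eq) (auto simp: top s(3,4) assms(1))
  have 3: "Hausdorff_space ?T"
    using homeomorphic_map_transport[OF assms(1) topspace_topol] Hausdorff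
    homeomorphic_Hausdorff_space homeomorphic_map_imp_homeomorphic_space by blast
  show ?thesis
  proof (rule topological_vector_spaceI)
    show "topspace ?T = carrier (transport_tvs \<phi> E)"
      using top by (simp add: s(1))
    show "x \<oplus>\<^bsub>transport_tvs \<phi> E\<^esub> y = y \<oplus>\<^bsub>transport_tvs \<phi> E\<^esub> x"
      if "x \<in> carrier (transport_tvs \<phi> E)" "y \<in> carrier (transport_tvs \<phi> E)" for x y
      using that M.a_comm by (auto simp: s(1-4))
  qed (use 1 2 3 in \<open>auto simp: s(1-4) M.a_assoc smult_add_left smult_add_right smult_smult\<close>)
qed

lemma Hausdorff_space_euclidean_t2: "Hausdorff_space (euclidean :: 'a :: t2_space topology)"
proof -
  have "\<exists>U V. openin euclidean U \<and> openin euclidean V \<and> x \<in> U \<and> y \<in> V \<and> disjnt U V"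
    if "x \<noteq> y" for x y :: 'a
    using hausdorff[OF that] by (simp add: disjnt_def flip: open_openin)
  then show ?thesis
    by (simp add: Hausdorff_space_def)
qed

lemma field_tvs_simps [simp]:
  "carrier field_tvs = UNIV" "zero field_tvs = 0" "add field_tvs = (+)"
  "smult field_tvs = (*)" "topol field_tvs = euclidean"
  by (auto simp: field_tvs_def)

lemma topological_vector_space_field_tvs:
  "topological_vector_space (field_tvs :: ('k :: topological_field, 'k) tvs)"
proof (rule topological_vector_spaceI)
  show "continuous_map (prod_topology (topol field_tvs) (topol field_tvs))
     (topol (field_tvs :: ('k, 'k) tvs)) (\<lambda>(x, y). x \<oplus>\<^bsub>field_tvs\<^esub> y)"
    using continuous_map_plus_field[OF continuous_map_fst continuous_map_snd]
    by (simp add: case_prod_beta')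
  show "continuous_map (prod_topology euclidean (topol field_tvs))
     (topol (field_tvs :: ('k, 'k) tvs)) (\<lambda>(x, y). x \<odot>\<^bsub>field_tvs\<^esub> y)"
    using continuous_map_times_field[OF continuous_map_fst continuous_map_snd]
    by (simp add: case_prod_beta')
qed (simp_all add: Hausdorff_space_euclidean_t2 distrib_left distrib_right ac_simps)

lemma prod_tvs_simps [simp]:
  "carrier (prod_tvs E F) = carrier E \<times> carrier F"
  "zero (prod_tvs E F) = (\<zero>\<^bsub>E\<^esub>, \<zero>\<^bsub>F\<^esub>)"
  "add (prod_tvs E F) = (\<lambda>(x, y) (x', y'). (x \<oplus>\<^bsub>E\<^esub> x', y \<oplus>\<^bsub>F\<^esub> y'))"
  "smult (prod_tvs E F) = (\<lambda>t (x, y). (t \<odot>\<^bsub>E\<^esub> x, t \<odot>\<^bsub>F\<^esub> y))"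
  "topol (prod_tvs E F) = prod_topology (topol E) (topol F)"
  by (auto simp: prod_tvs_def)

lemma topological_vector_space_prod:
  assumes "topological_vector_space E" "topological_vector_space F"
  shows "topological_vector_space (prod_tvs E F)"
proof -
  interpret E: topological_vector_space E by fact
  interpret F: topological_vector_space F by fact
  let ?T = "topol (prod_tvs E F)"
  have c: "continuous_map (prod_topology ?T ?T) (topol E) (\<lambda>p. fst (fst p))"
    "continuous_map (prod_topology ?T ?T) (topol E) (\<lambda>p. fst (snd p))"
    "continuous_map (prod_topology ?T ?T) (topol F) (\<lambda>p. snd (fst p))"
    "continuous_map (prod_topology ?T ?T) (topol F) (\<lambda>p. snd (snd p))"
    "continuous_map (prod_topology euclidean ?T) (topol E) (\<lambda>p. fst (snd p))"
    "continuous_map (prod_topology euclidean ?T) (topol F) (\<lambda>p. snd (snd p))"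
    by (auto intro!: continuous_intros continuous_map_fst_of[unfolded o_def]
      continuous_map_snd_of[unfolded o_def])
  have 1: "continuous_map (prod_topology ?T ?T) ?T (\<lambda>(x, y). x \<oplus>\<^bsub>prod_tvs E F\<^esub> y)"
    using continuous_map_pairedI[OF E.continuous_map_add[OF c(1,2)] F.continuous_map_add[OF c(3,4)]]
    by (simp add: case_prod_beta')
  have 2: "continuous_map (prod_topology euclidean ?T) ?T (\<lambda>(x, y). x \<odot>\<^bsub>prod_tvs E F\<^esub> y)"
    using continuous_map_pairedI[OF E.continuous_map_smult[OF continuous_map_fst c(5)]
      F.continuous_map_smult[OF continuous_map_fst c(6)]]
    by (simp add: case_prod_beta')
  show ?thesis
  proof (rule topological_vector_spaceI)
    show "Hausdorff_space ?T"
      using E.Hausdorff F.Hausdorff by (simp add: Hausdorff_space_prod_topology)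
    show "topspace ?T = carrier (prod_tvs E F)"
      by (simp add: E.topspace_topol F.topspace_topol)
    show "x \<oplus>\<^bsub>prod_tvs E F\<^esub> y = y \<oplus>\<^bsub>prod_tvs E F\<^esub> x"
      if "x \<in> carrier (prod_tvs E F)" "y \<in> carrier (prod_tvs E F)" for x y
      using that E.M.a_comm F.M.a_comm by auto
  qed (use 1 2 in \<open>auto simp: E.M.a_assoc F.M.a_assoc
      E.smult_add_left E.smult_add_right E.smult_smult
      F.smult_add_left F.smult_add_right F.smult_smult\<close>)
qed

section \<open>The spaces E^[j] and their coordinate maps\<close>

fun bfst where "bfst (Step x y t) = x"
fun bsnd where "bsnd (Step x y t) = y"
fun bpar where "bpar (Step x y t) = t"
text \<open>All four functions are unspecified on the other constructor of \<open>bpoint\<close>;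
  only their values on the spaces \<open>bspace\<close> of the appropriate level matter.\<close>

fun bval where "bval (Base v) = v"

lemma inj_Step: "inj (\<lambda>(x, y, t). Step x y t)"
  by (auto simp: inj_def)

lemma inj_Base: "inj Base"
  by (auto simp: inj_def)

lemma topological_vector_space_bspace:
  assumes "topological_vector_space E"
  shows "topological_vector_space (bspace E j)"
  by (induction j) (simp_all add: topological_vector_space_transport inj_Step inj_Base
    topological_vector_space_prod topological_vector_space_field_tvs assms)

lemma bspace_0:
  "carrier (bspace E 0) = Base ` carrier E"
  "zero (bspace E 0) = Base \<zero>\<^bsub>E\<^esub>"
  "add (bspace E 0) (Base x) (Base y) = Base (x \<oplus>\<^bsub>E\<^esub> y)"
  "smult (bspace E 0) t (Base x) = Base (t \<odot>\<^bsub>E\<^esub> x)"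
  by (simp_all add: transport_tvs_simps[OF inj_Base])

lemma bspace_Suc:
  "Step x y t \<in> carrier (bspace E (Suc j)) \<longleftrightarrow> x \<in> carrier (bspace E j) \<and> y \<in> carrier (bspace E j)"
  "zero (bspace E (Suc j)) = Step \<zero>\<^bsub>bspace E j\<^esub> \<zero>\<^bsub>bspace E j\<^esub> 0"
  "add (bspace E (Suc j)) (Step x y t) (Step x' y' t') =
    Step (x \<oplus>\<^bsub>bspace E j\<^esub> x') (y \<oplus>\<^bsub>bspace E j\<^esub> y') (t + t')"
  "smult (bspace E (Suc j)) s (Step x y t) = Step (s \<odot>\<^bsub>bspace E j\<^esub> x) (s \<odot>\<^bsub>bspace E j\<^esub> y) (s * t)"
proof -
  let ?B = "prod_tvs (bspace E j) (prod_tvs (bspace E j) field_tvs)"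
  note s = transport_tvs_simps[OF inj_Step, of ?B]
  show "Step x y t \<in> carrier (bspace E (Suc j)) \<longleftrightarrow>
      x \<in> carrier (bspace E j) \<and> y \<in> carrier (bspace E j)"
    unfolding bspace.simps s(1) by (force simp: image_def)
  show "zero (bspace E (Suc j)) = Step \<zero>\<^bsub>bspace E j\<^esub> \<zero>\<^bsub>bspace E j\<^esub> 0"
    unfolding bspace.simps s(2) by simp
  show "add (bspace E (Suc j)) (Step x y t) (Step x' y' t') =
      Step (x \<oplus>\<^bsub>bspace E j\<^esub> x') (y \<oplus>\<^bsub>bspace E j\<^esub> y') (t + t')"
    using s(3)[of "(x, y, t)" "(x', y', t')"] unfolding bspace.simps by simp
  show "smult (bspace E (Suc j)) s (Step x y t) =
      Step (s \<odot>\<^bsub>bspace E j\<^esub> x) (s \<odot>\<^bsub>bspace E j\<^esub> y) (s * t)"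
    using s(4)[of s "(x, y, t)"] unfolding bspace.simps by simp
qed

lemma carrier_bspace_SucE:
  assumes "p \<in> carrier (bspace E (Suc j))"
  obtains x y t where "p = Step x y t" "x \<in> carrier (bspace E j)" "y \<in> carrier (bspace E j)"
  using assms by (auto simp: transport_tvs_simps[OF inj_Step])

declare bspace.simps [simp del]

context
  fixes E :: "('k :: topological_field, 'v) tvs"
  assumes tvs: "topological_vector_space E"
begin

lemma topspace_bspace: "topspace (topol (bspace E j)) = carrier (bspace E j)"
  by (simp add: topological_vector_space.topspace_topol topological_vector_space_bspace tvs)

lemma continuous_map_Step:
  assumes "continuous_map A (topol (bspace E j)) f" "continuous_map A (topol (bspace E j)) g"
    "continuous_map A euclidean c"
  shows "continuous_map A (topol (bspace E (Suc j))) (\<lambda>x. Step (f x) (g x) (c x))"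
proof -
  have "continuous_map A (topol (prod_tvs (bspace E j) (prod_tvs (bspace E j) field_tvs)))
      (\<lambda>x. (f x, g x, c x))"
    by (auto intro!: continuous_map_pairedI assms)
  from continuous_map_into_transport[OF inj_Step this] show ?thesis
    by (simp add: topspace_bspace bspace.simps)
qed

lemma continuous_map_bspace_projections:
  "continuous_map (topol (bspace E (Suc j))) (topol (bspace E j)) bfst"
  "continuous_map (topol (bspace E (Suc j))) (topol (bspace E j)) bsnd"
  "continuous_map (topol (bspace E (Suc j))) euclidean bpar"
proof -
  let ?B = "prod_tvs (bspace E j) (prod_tvs (bspace E j) field_tvs)" and ?i = "inv_into UNIV (\<lambda>(x, y, t). Step x y t)"
  let ?T = "topol (bspace E (Suc j))"
  have c: "continuous_map ?T (topol ?B) ?i"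
    using continuous_map_inv_transport[OF inj_Step, of ?B] by (simp add: bspace.simps)
  have i: "?i (Step x y t) = (x, y, t)" for x :: "('k, 'v) bpoint" and y t
    using inv_into_f_f[OF inj_Step, of "(x,y,t)"] by simp
  have 1: "continuous_map ?T (topol (bspace E j)) (\<lambda>p. fst (?i p))"
    using c by (simp add: continuous_map_pairwise o_def)
  have 2: "continuous_map ?T (topol (bspace E j)) (\<lambda>p. fst (snd (?i p)))"
    using c by (simp add: continuous_map_pairwise o_def)
  have 3: "continuous_map ?T euclidean (\<lambda>p. snd (snd (?i p)))"
    using c by (simp add: continuous_map_pairwise o_def)
  show "continuous_map ?T (topol (bspace E j)) bfst"
    by (rule continuous_map_eq[OF 1]) (auto simp: topspace_bspace i elim!: carrier_bspace_SucE)
  show "continuous_map ?T (topol (bspace E j)) bsnd"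
    by (rule continuous_map_eq[OF 2]) (auto simp: topspace_bspace i elim!: carrier_bspace_SucE)
  show "continuous_map ?T euclidean bpar"
    by (rule continuous_map_eq[OF 3]) (auto simp: topspace_bspace i elim!: carrier_bspace_SucE)
qed

lemma continuous_map_Base: "continuous_map (topol E) (topol (bspace E 0)) Base"
  using continuous_map_into_transport[OF inj_Base continuous_map_id, of E]
  by (simp add: topological_vector_space.topspace_topol[OF tvs] bspace.simps)

lemma continuous_map_bval: "continuous_map (topol (bspace E 0)) (topol E) bval"
proof -
  have "continuous_map (topol (bspace E 0)) (topol E) (inv_into UNIV Base)"
    using continuous_map_inv_transport[OF inj_Base, of E] by (simp add: bspace.simps)
  then show ?thesis
    by (rule continuous_map_eq) (auto simp: topspace_bspace bspace_0 inv_f_f[OF inj_Base])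
qed

end


section \<open>Difference factors and brackets\<close>

lemma Step_in_bdom:
  "Step x y t \<in> bdom E U (Suc j) \<longleftrightarrow> x \<in> bdom E U j \<and> y \<in> carrier (bspace E j) \<and>
    x \<oplus>\<^bsub>bspace E j\<^esub> t \<odot>\<^bsub>bspace E j\<^esub> y \<in> bdom E U j"
  by auto

lemma bdom_SucE:
  assumes "p \<in> bdom E U (Suc j)"
  obtains x y t where "p = Step x y t" "x \<in> bdom E U j" "y \<in> carrier (bspace E j)"
    "x \<oplus>\<^bsub>bspace E j\<^esub> t \<odot>\<^bsub>bspace E j\<^esub> y \<in> bdom E U j"
  using assms by auto

declare bdom.simps(2) [simp del]

text \<open>A single equation replaces additivity and homogeneity. In this shape it says that f
  satisfies the equation of a bracket with (x, y, t) mapped to f y, which is how linear maps enter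
  all later computations.\<close>

definition tvs_linear :: "('k :: topological_field, 'v) tvs \<Rightarrow> ('k, 'w) tvs \<Rightarrow> ('v \<Rightarrow> 'w) \<Rightarrow> bool" where
  "tvs_linear E F f \<longleftrightarrow> f \<in> carrier E \<rightarrow> carrier F \<and>
    (\<forall>x\<in>carrier E. \<forall>y\<in>carrier E. \<forall>t. f (x \<oplus>\<^bsub>E\<^esub> t \<odot>\<^bsub>E\<^esub> y) = f x \<oplus>\<^bsub>F\<^esub> t \<odot>\<^bsub>F\<^esub> f y)"

text \<open>Unlike the difference quotient, this condition avoids inverses and subtraction, and may be used for
  \<open>t = 0\<close> as well.\<close>

definition difference_factor :: "('k :: topological_field, 'v) tvs \<Rightarrow> 'v set \<Rightarrow> ('k, 'w) tvs \<Rightarrow> nat \<Rightarrow>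
    (('k, 'v) bpoint \<Rightarrow> 'w) \<Rightarrow> (('k, 'v) bpoint \<Rightarrow> 'w) \<Rightarrow> bool" where
  "difference_factor E U F j g h \<longleftrightarrow> (\<forall>x y t. Step x y t \<in> bdom E U (Suc j) \<longrightarrow>
    g (x \<oplus>\<^bsub>bspace E j\<^esub> t \<odot>\<^bsub>bspace E j\<^esub> y) = g x \<oplus>\<^bsub>F\<^esub> t \<odot>\<^bsub>F\<^esub> h (Step x y t))"

section \<open>Uniqueness of brackets and the division-free description of C^k maps\<close>

locale open_domain = topological_vector_space E
  for E :: "('k :: topological_field, 'v) tvs" (structure) +
  fixes U :: "'v set"
  assumes open_U: "openin (topol E) U"
begin

lemma tvs_bspace: "topological_vector_space (bspace E j)"
  by (rule topological_vector_space_bspace) (rule topological_vector_space_axioms)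

lemma tvs_E: "topological_vector_space E"
  by (rule topological_vector_space_axioms)

text \<open>Inside the ambient space, U^[j+1] is cut out by the two conditions that x and x + t y
  lie in U^[j], and both points depend continuously on (x, y, t).\<close>

lemma openin_bdom: "openin (topol (bspace E j)) (bdom E U j)"
proof (induction j)
  case 0
  have "homeomorphic_map (topol E) (topol (bspace E 0)) Base"
    using homeomorphic_map_transport[OF inj_Base topspace_topol] by (simp add: bspace.simps)
  then show ?case
    using open_U by (simp add: homeomorphic_map_openness_eq)
next
  case (Suc j)
  interpret B: topological_vector_space "bspace E j" by (rule tvs_bspace)
  let ?T = "topol (bspace E (Suc j))"
  note c = continuous_map_bspace_projections[OF tvs_E, of j]
  have "continuous_map ?T (topol (bspace E j)) (\<lambda>p. bfst p \<oplus>\<^bsub>bspace E j\<^esub> bpar p \<odot>\<^bsub>bspace E j\<^esub> bsnd p)"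
    by (intro B.continuous_map_add B.continuous_map_smult c)
  from openin_Int[OF openin_continuous_map_preimage[OF c(1) Suc] openin_continuous_map_preimage[OF this Suc]]
  show ?case
    by (rule back_subst[of "openin ?T"])
      (auto simp: topspace_bspace[OF tvs_E] Step_in_bdom bspace_Suc
        elim!: carrier_bspace_SucE bdom_SucE intro: openin_subset[OF Suc, THEN subsetD, simplified topspace_bspace[OF tvs_E]])
qed

lemma bdom_subset: "bdom E U j \<subseteq> carrier (bspace E j)"
  using openin_subset[OF openin_bdom] by (simp add: topspace_bspace[OF tvs_E])

lemma topspace_btop: "topspace (btop E U j) = bdom E U j"
  using bdom_subset by (auto simp: btop_def topspace_bspace[OF tvs_E])

lemma continuous_map_into_btop:
  "continuous_map A (btop E U j) f \<longleftrightarrow>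
    continuous_map A (topol (bspace E j)) f \<and> f ` topspace A \<subseteq> bdom E U j"
  by (auto simp: btop_def continuous_map_in_subtopology)

lemma Step_0_in_bdom:
  assumes "x \<in> bdom E U j" "y \<in> carrier (bspace E j)"
  shows "Step x y 0 \<in> bdom E U (Suc j)" "x \<oplus>\<^bsub>bspace E j\<^esub> 0 \<odot>\<^bsub>bspace E j\<^esub> y = x"
proof -
  interpret B: topological_vector_space "bspace E j" by (rule tvs_bspace)
  show "x \<oplus>\<^bsub>bspace E j\<^esub> 0 \<odot>\<^bsub>bspace E j\<^esub> y = x"
    using assms(2) bdom_subset[THEN subsetD, OF assms(1)] by simp
  then show "Step x y 0 \<in> bdom E U (Suc j)"
    using assms by (simp add: Step_in_bdom)
qed

text \<open>Points with \<open>t = 0\<close> are limits of points with \<open>t \<noteq> 0\<close>, as the field is not discrete.\<close>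

lemma difference_factor_unique:
  assumes F: "topological_vector_space F"
    and h: "continuous_map (btop E U (Suc j)) (topol F) h" "difference_factor E U F j g h"
    and h': "continuous_map (btop E U (Suc j)) (topol F) h'" "difference_factor E U F j g h'"
    and g: "g \<in> bdom E U j \<rightarrow> carrier F"
    and p: "p \<in> bdom E U (Suc j)"
  shows "h p = h' p"
proof -
  interpret B: topological_vector_space "bspace E j" by (rule tvs_bspace)
  interpret F: topological_vector_space F by fact
  obtain x y t where xyt: "p = Step x y t" "x \<in> bdom E U j" "y \<in> carrier (bspace E j)"
    using p by (rule bdom_SucE)
  have x: "x \<in> carrier (bspace E j)" using xyt bdom_subset by auto
  have cl: "h q \<in> carrier F" "h' q \<in> carrier F" if "q \<in> bdom E U (Suc j)" for q
    using that continuous_map_image_subset_topspace[OF h(1)]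
      continuous_map_image_subset_topspace[OF h'(1)]
    by (auto simp: topspace_btop F.topspace_topol)
  have eq: "h (Step x y s) = h' (Step x y s)" if "Step x y s \<in> bdom E U (Suc j)" "s \<noteq> 0" for s
  proof (rule F.smult_left_cancel[OF that(2)])
    have "g x \<oplus>\<^bsub>F\<^esub> s \<odot>\<^bsub>F\<^esub> h (Step x y s) = g x \<oplus>\<^bsub>F\<^esub> s \<odot>\<^bsub>F\<^esub> h' (Step x y s)"
      using h(2) h'(2) that(1) unfolding difference_factor_def by metis
    then show "s \<odot>\<^bsub>F\<^esub> h (Step x y s) = s \<odot>\<^bsub>F\<^esub> h' (Step x y s)"
      using cl[OF that(1)] g xyt(2) by (simp add: Pi_iff)
  qed (use cl that in auto)
  show ?thesis
  proof (cases "t = 0")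
    case False
    then show ?thesis using eq p xyt by simp
  next
    case True
    have c: "continuous_map euclidean (topol (bspace E j)) (\<lambda>s. x \<oplus>\<^bsub>bspace E j\<^esub> s \<odot>\<^bsub>bspace E j\<^esub> y)"
      using x xyt by (intro B.continuous_map_add B.continuous_map_smult)
        (auto simp: B.topspace_topol continuous_map_const)
    define S where "S = {s \<in> topspace euclidean. x \<oplus>\<^bsub>bspace E j\<^esub> s \<odot>\<^bsub>bspace E j\<^esub> y \<in> bdom E U j}"
    have S: "open S"
      using openin_continuous_map_preimage[OF c openin_bdom] by (simp add: S_def)
    have 0: "0 \<in> S"
      using Step_0_in_bdom[OF xyt(2,3)] xyt by (simp add: S_def)
    have St: "Step x y s \<in> bdom E U (Suc j) \<longleftrightarrow> s \<in> S" for s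
      using xyt by (simp add: S_def Step_in_bdom)
    have cS: "continuous_map (top_of_set S) (btop E U (Suc j)) (\<lambda>s. Step x y s)"
      unfolding continuous_map_into_btop
      using x xyt St by (auto intro!: continuous_map_Step[OF tvs_E] simp: B.topspace_topol continuous_map_const)
    \<comment> \<open>On the line through x in direction y, the parameters at which h and h' differ
      form an open set because F is Hausdorff. It is contained in {0}, and {0} is not open.\<close>
    have "openin (top_of_set S) {s \<in> topspace (top_of_set S). h (Step x y s) \<noteq> h' (Step x y s)}"
    proof -
      have "closedin (top_of_set S) {s \<in> topspace (top_of_set S). h (Step x y s) = h' (Step x y s)}"
        using continuous_map_compose[OF cS h(1)] continuous_map_compose[OF cS h'(1)]
        by (intro closedin_continuous_maps_eq[OF F.Hausdorff]) (simp_all add: o_def)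
      from openin_diff[OF openin_topspace this] show ?thesis
        by (rule back_subst[of "openin (top_of_set S)"]) auto
    qed
    then have "open {s \<in> S. h (Step x y s) \<noteq> h' (Step x y s)}"
      using S openin_open_trans by simp
    moreover have "{s \<in> S. h (Step x y s) \<noteq> h' (Step x y s)} \<subseteq> {0}"
      using eq St by blast
    ultimately have "{s \<in> S. h (Step x y s) \<noteq> h' (Step x y s)} = {}"
      using not_open_singleton[of "0 :: 'k"] by (metis subset_singletonD)
    then show ?thesis
      using True xyt 0 by blast
  qed
qed

text \<open>For t \<noteq> 0 the two conditions are algebraically equivalent, and at t = 0 the
  equation of \<open>difference_factor\<close> only says g x = g x. Continuity of h serves to place
  its values in the carrier, without which 0 times a value need not be zero.\<close>

lemma is_bracket_iff:
  assumes F: "topological_vector_space F" and g: "g \<in> bdom E U j \<rightarrow> carrier F"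
  shows "is_bracket E U F j g h \<longleftrightarrow> h \<in> extensional (bdom E U (Suc j)) \<and>
    continuous_map (btop E U (Suc j)) (topol F) h \<and> difference_factor E U F j g h"
proof -
  interpret F: topological_vector_space F by fact
  have "(t \<noteq> 0 \<longrightarrow> h (Step x y t) =
        inverse t \<odot>\<^bsub>F\<^esub> (g (x \<oplus>\<^bsub>bspace E j\<^esub> t \<odot>\<^bsub>bspace E j\<^esub> y) \<ominus>\<^bsub>F\<^esub> g x)) \<longleftrightarrow>
      g (x \<oplus>\<^bsub>bspace E j\<^esub> t \<odot>\<^bsub>bspace E j\<^esub> y) = g x \<oplus>\<^bsub>F\<^esub> t \<odot>\<^bsub>F\<^esub> h (Step x y t)"
    if h: "continuous_map (btop E U (Suc j)) (topol F) h" and S: "Step x y t \<in> bdom E U (Suc j)" for x y t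
  proof -
    have cl: "h (Step x y t) \<in> carrier F"
      using continuous_map_image_subset_topspace[OF h] S
      by (auto simp: topspace_btop F.topspace_topol)
    have x: "x \<in> bdom E U j" "y \<in> carrier (bspace E j)" and gx: "g x \<in> carrier F"
      "g (x \<oplus>\<^bsub>bspace E j\<^esub> t \<odot>\<^bsub>bspace E j\<^esub> y) \<in> carrier F"
      using S g by (auto simp: Step_in_bdom)
    show ?thesis
      using F.difference_quotient_iff[OF _ cl gx, of t] Step_0_in_bdom(2)[OF x] cl gx by (cases "t = 0") auto
  qed
  then show ?thesis
    unfolding is_bracket_def difference_factor_def by blast
qed

text \<open>Justifies the \<open>THE\<close> in \<open>bmap\<close>: values on the domain are unique
  by \<open>difference_factor_unique\<close>, and extensionality fixes all the others.\<close>

lemma bmap_Suc_eqI: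
  assumes F: "topological_vector_space F" and g: "bmap E U F f j \<in> bdom E U j \<rightarrow> carrier F"
    and h: "is_bracket E U F j (bmap E U F f j) h"
  shows "bmap E U F f (Suc j) = h"
  unfolding bmap.simps
proof (rule the_equality[where P = "is_bracket E U F j (bmap E U F f j)"])
  fix h' assume h': "is_bracket E U F j (bmap E U F f j) h'"
  show "h' = h"
  proof (rule extensionalityI[of _ "bdom E U (Suc j)"])
    show "h' p = h p" if "p \<in> bdom E U (Suc j)" for p
      using difference_factor_unique[OF F _ _ _ _ g that] h h' unfolding is_bracket_iff[OF F g] by blast
  qed (use h h' in \<open>auto simp: is_bracket_def\<close>)
qed (rule h)

lemma Ck_SucD:
  assumes F: "topological_vector_space F" and "Ck E U F (Suc k) f"
  shows "is_bracket E U F k (bmap E U F f k) (bmap E U F f (Suc k))"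
    "bmap E U F f k \<in> bdom E U k \<rightarrow> carrier F"
proof -
  interpret F: topological_vector_space F by fact
  obtain h where h: "is_bracket E U F k (bmap E U F f k) h"
    and c: "continuous_map (btop E U k) (topol F) (bmap E U F f k)"
    using assms(2) by auto
  show g: "bmap E U F f k \<in> bdom E U k \<rightarrow> carrier F"
    using continuous_map_image_subset_topspace[OF c]
    by (auto simp: topspace_btop F.topspace_topol)
  show "is_bracket E U F k (bmap E U F f k) (bmap E U F f (Suc k))"
    using h bmap_Suc_eqI[OF F g h] by simp
qed

lemma Ck_mono: "Ck E U F k f \<Longrightarrow> j \<le> k \<Longrightarrow> Ck E U F j f"
  by (induction k) (auto simp: le_Suc_eq)

lemma continuous_map_bmap_0_iff:
  "continuous_map (btop E U 0) (topol F) (bmap E U F f 0) \<longleftrightarrow>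
    continuous_map (subtopology (topol E) U) (topol F) f"
proof
  assume *: "continuous_map (btop E U 0) (topol F) (bmap E U F f 0)"
  have "continuous_map (subtopology (topol E) U) (btop E U 0) Base"
    unfolding continuous_map_into_btop
    by (auto intro: continuous_map_from_subtopology continuous_map_Base[OF tvs_E])
  from continuous_map_compose[OF this *]
  show "continuous_map (subtopology (topol E) U) (topol F) f"
    by (rule continuous_map_eq) (auto simp: inv_f_f[OF inj_Base])
next
  assume *: "continuous_map (subtopology (topol E) U) (topol F) f"
  have "continuous_map (btop E U 0) (subtopology (topol E) U) bval"
    by (auto simp: continuous_map_in_subtopology btop_def
        intro: continuous_map_from_subtopology continuous_map_bval[OF tvs_E])
  from continuous_map_compose[OF this *]
  show "continuous_map (btop E U 0) (topol F) (bmap E U F f 0)"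
    by (rule continuous_map_eq) (auto simp: topspace_btop inv_f_f[OF inj_Base])
qed

lemma continuous_map_bmap:
  assumes F: "topological_vector_space F" and "Ck E U F k f"
  shows "continuous_map (btop E U k) (topol F) (bmap E U F f k)"
proof (cases k)
  case 0
  then show ?thesis using assms continuous_map_bmap_0_iff[of F f] by simp
next
  case (Suc n)
  then show ?thesis using Ck_SucD(1)[OF F] assms by (auto simp: is_bracket_def)
qed

lemma bmap_extensional:
  assumes F: "topological_vector_space F" and "Ck E U F k f"
  shows "bmap E U F f k \<in> extensional (bdom E U k)"
proof (cases k)
  case 0
  then show ?thesis by simp
next
  case (Suc n)
  then show ?thesis using Ck_SucD(1)[OF F] assms by (auto simp: is_bracket_def)
qed

lemma bmap_in_carrier:
  assumes F: "topological_vector_space F" and "Ck E U F k f" "p \<in> bdom E U k"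
  shows "bmap E U F f k p \<in> carrier F"
  using continuous_map_image_subset_topspace[OF continuous_map_bmap[OF assms(1,2)]] assms(3)
  by (auto simp: topspace_btop topological_vector_space.topspace_topol[OF F])

lemma Ck_Suc_iff:
  assumes F: "topological_vector_space F"
  shows "Ck E U F (Suc k) f \<longleftrightarrow> Ck E U F k f \<and>
    (\<exists>h. h \<in> extensional (bdom E U (Suc k)) \<and> continuous_map (btop E U (Suc k)) (topol F) h \<and>
      difference_factor E U F k (bmap E U F f k) h)"
proof -
  have "bmap E U F f k \<in> bdom E U k \<rightarrow> carrier F" if "Ck E U F k f"
    using bmap_in_carrier[OF F that] by auto
  then show ?thesis
    using is_bracket_iff[OF F] continuous_map_bmap[OF F] unfolding Ck.simps by blast
qed

lemma bmap_Suc_eq: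
  assumes F: "topological_vector_space F" and "Ck E U F k f"
    and "h \<in> extensional (bdom E U (Suc k))" "continuous_map (btop E U (Suc k)) (topol F) h"
    "difference_factor E U F k (bmap E U F f k) h"
  shows "bmap E U F f (Suc k) = h"
proof -
  have "bmap E U F f k \<in> bdom E U k \<rightarrow> carrier F"
    using bmap_in_carrier[OF F assms(2)] by auto
  then show ?thesis
    using bmap_Suc_eqI[OF F] is_bracket_iff[OF F] assms by blast
qed

lemma difference_factor_bmap:
  assumes F: "topological_vector_space F" and "Ck E U F (Suc k) f"
  shows "difference_factor E U F k (bmap E U F f k) (bmap E U F f (Suc k))"
  using Ck_SucD[OF assms] is_bracket_iff[OF F] by blast

end

lemma bmap_cong:
  assumes "\<And>x. x \<in> U \<Longrightarrow> f x = g x"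
  shows "bmap E U F f j = bmap E U F g j"
proof (induction j)
  case 0
  have "bmap E U F f 0 p = bmap E U F g 0 p" for p
    using assms by (auto simp: restrict_def inv_f_f[OF inj_Base])
  then show ?case by blast
qed simp

lemma Ck_cong:
  assumes "\<And>x. x \<in> U \<Longrightarrow> f x = g x"
  shows "Ck E U F k f \<longleftrightarrow> Ck E U F k g"
proof (induction k)
  case 0
  show ?case
    using assms by (auto elim!: continuous_map_eq)
next
  case (Suc k)
  have "bmap E U F f k = bmap E U F g k"
    using assms by (rule bmap_cong)
  then show ?case using Suc by simp
qed


section \<open>Families of maps with brackets\<close>

text \<open>The level \<open>i\<close> of the domain is an argument, so that inductions on the number \<open>n\<close> of brackets stay
  within one type.\<close>

primrec Cn_family :: "'a topology \<Rightarrow> ('k :: topological_field, 'v) tvs \<Rightarrow> 'v set \<Rightarrow> ('k, 'w) tvs \<Rightarrow>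
    nat \<Rightarrow> nat \<Rightarrow> ('a \<Rightarrow> ('k, 'v) bpoint \<Rightarrow> 'w) \<Rightarrow> bool" where
  "Cn_family A E U F 0 i \<phi> \<longleftrightarrow>
    continuous_map (prod_topology A (btop E U i)) (topol F) (\<lambda>(a, p). \<phi> a p)"
| "Cn_family A E U F (Suc n) i \<phi> \<longleftrightarrow>
    continuous_map (prod_topology A (btop E U i)) (topol F) (\<lambda>(a, p). \<phi> a p) \<and>
    (\<exists>\<psi>. (\<forall>a\<in>topspace A. difference_factor E U F i (\<phi> a) (\<psi> a)) \<and> Cn_family A E U F n (Suc i) \<psi>)"

lemma Cn_family_continuous:
  "Cn_family A E U F n i \<phi> \<Longrightarrow>
    continuous_map (prod_topology A (btop E U i)) (topol F) (\<lambda>(a, p). \<phi> a p)"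
  by (cases n) auto

lemma Cn_family_SucI:
  assumes "continuous_map (prod_topology A (btop E U i)) (topol F) (\<lambda>(a, p). \<phi> a p)"
    and "\<And>a. a \<in> topspace A \<Longrightarrow> difference_factor E U F i (\<phi> a) (\<psi> a)"
    and "Cn_family A E U F n (Suc i) \<psi>"
  shows "Cn_family A E U F (Suc n) i \<phi>"
  using assms by auto

lemma Cn_family_SucE:
  assumes "Cn_family A E U F (Suc n) i \<phi>"
  obtains \<psi> where "\<And>a. a \<in> topspace A \<Longrightarrow> difference_factor E U F i (\<phi> a) (\<psi> a)"
    "Cn_family A E U F n (Suc i) \<psi>"
  using assms by auto

declare Cn_family.simps(2) [simp del]

lemma Cn_family_Suc_imp: "Cn_family A E U F (Suc n) i \<phi> \<Longrightarrow> Cn_family A E U F n i \<phi>"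
proof (induction n arbitrary: i \<phi>)
  case 0
  then show ?case using Cn_family_continuous by simp
next
  case (Suc n)
  from Suc.prems obtain \<psi> where "\<And>a. a \<in> topspace A \<Longrightarrow> difference_factor E U F i (\<phi> a) (\<psi> a)"
    "Cn_family A E U F (Suc n) (Suc i) \<psi>"
    by (rule Cn_family_SucE) blast
  then show ?case
    using Cn_family_continuous[OF Suc.prems] Suc.IH by (intro Cn_family_SucI)
qed

text \<open>No bracket is taken in the direction of the parameter, so a merely continuous change of
  parameter is harmless.\<close>

lemma Cn_family_reparametrize:
  assumes "continuous_map B A \<beta>" "Cn_family A E U F n i \<phi>"
  shows "Cn_family B E U F n i (\<lambda>b. \<phi> (\<beta> b))"
  using assms(2)
proof (induction n arbitrary: i \<phi>)
  \<comment> \<open>Proved for all orders before the cases are split, because both cases of the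
    induction use it. The closure properties below follow the same pattern.\<close>
  have c: "continuous_map (prod_topology B (btop E U i)) (topol F) (\<lambda>(b, p). \<phi> (\<beta> b) p)"
    if "Cn_family A E U F n i \<phi>" for n i \<phi>
  proof -
    have "continuous_map (prod_topology B (btop E U i)) (prod_topology A (btop E U i))
        (\<lambda>x. (\<beta> (fst x), snd x))"
      by (intro continuous_map_pairedI continuous_map_compose[OF _ assms(1), unfolded o_def]
          continuous_map_fst continuous_map_snd)
    from continuous_map_compose[OF this Cn_family_continuous[OF that]] show ?thesis
      by (simp add: o_def case_prod_beta')
  qed
  {
    case 0
    then show ?case using c[OF 0] by simp
  next
    case (Suc n)
    from Suc.prems obtain \<psi> where \<psi>: "\<And>a. a \<in> topspace A \<Longrightarrow> difference_factor E U F i (\<phi> a) (\<psi> a)"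
      "Cn_family A E U F n (Suc i) \<psi>"
      by (rule Cn_family_SucE) blast
    show ?case
    proof (rule Cn_family_SucI[OF c[OF Suc.prems] _ Suc.IH[OF \<psi>(2)]])
      show "difference_factor E U F i (\<phi> (\<beta> b)) (\<psi> (\<beta> b))" if "b \<in> topspace B" for b
        using \<psi>(1) that continuous_map_image_subset_topspace[OF assms(1)] by blast
    qed
  }
qed

lemma difference_factorD:
  assumes "difference_factor E U F j g h" "Step x y t \<in> bdom E U (Suc j)"
  shows "g (x \<oplus>\<^bsub>bspace E j\<^esub> t \<odot>\<^bsub>bspace E j\<^esub> y) = g x \<oplus>\<^bsub>F\<^esub> t \<odot>\<^bsub>F\<^esub> h (Step x y t)"
  using assms by (simp add: difference_factor_def)

lemma tvs_linearD:
  assumes "tvs_linear E F f"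
  shows "x \<in> carrier E \<Longrightarrow> f x \<in> carrier F"
    "x \<in> carrier E \<Longrightarrow> y \<in> carrier E \<Longrightarrow> f (x \<oplus>\<^bsub>E\<^esub> t \<odot>\<^bsub>E\<^esub> y) = f x \<oplus>\<^bsub>F\<^esub> t \<odot>\<^bsub>F\<^esub> f y"
  using assms by (auto simp: tvs_linear_def)

section \<open>Closure properties of families\<close>

context open_domain
begin

lemma Cn_family_carrier:
  assumes "topological_vector_space F" "Cn_family A E U F n i \<phi>" "a \<in> topspace A" "p \<in> bdom E U i"
  shows "\<phi> a p \<in> carrier F"
  using continuous_map_image_subset_topspace[OF Cn_family_continuous[OF assms(2)]] assms(3,4)
  by (force simp: topspace_btop topological_vector_space.topspace_topol[OF assms(1)])

lemma Cn_family_cong: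
  assumes "Cn_family A E U F n i \<phi>" "\<And>a p. a \<in> topspace A \<Longrightarrow> p \<in> bdom E U i \<Longrightarrow> \<phi> a p = \<phi>' a p"
  shows "Cn_family A E U F n i \<phi>'"
proof -
  have c: "continuous_map (prod_topology A (btop E U i)) (topol F) (\<lambda>(a, p). \<phi>' a p)"
    using Cn_family_continuous[OF assms(1)]
    by (rule continuous_map_eq) (auto simp: assms(2) topspace_btop)
  show ?thesis
  proof (cases n)
    case (Suc m)
    obtain \<psi> where \<psi>: "\<And>a. a \<in> topspace A \<Longrightarrow> difference_factor E U F i (\<phi> a) (\<psi> a)"
      "Cn_family A E U F m (Suc i) \<psi>"
      using assms(1) unfolding Suc by (rule Cn_family_SucE) blast
    have "difference_factor E U F i (\<phi>' a) (\<psi> a)" if "a \<in> topspace A" for a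
      using \<psi>(1)[OF that] assms(2)[OF that] by (auto simp: difference_factor_def Step_in_bdom)
    then show ?thesis
      unfolding Suc using c \<psi>(2) by (intro Cn_family_SucI)
  qed (use c in simp)
qed

lemma continuous_map_family_slice:
  assumes "Cn_family A E U F n i \<phi>" "a \<in> topspace A"
  shows "continuous_map (btop E U i) (topol F) (\<phi> a)"
proof -
  have "continuous_map (btop E U i) (prod_topology A (btop E U i)) (\<lambda>p. (a, p))"
    using assms by (intro continuous_map_pairedI) auto
  from continuous_map_compose[OF this Cn_family_continuous[OF assms(1)]] show ?thesis
    by (simp add: o_def)
qed

text \<open>If \<psi> is a bracket of \<phi>, then a bracket of \<phi> composed with \<beta> is
  \<psi> composed with \<beta>', where \<beta>'(x, y, t) = (\<beta> x, \<beta> y, t). This \<beta>'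
  is again linear and continuous, so the induction can go on. The levels i and i' are independent,
  which admits \<beta> = \<open>bfst\<close>.\<close>

lemma Cn_family_linear_pullback:
  assumes "tvs_linear (bspace E i) (bspace E i') \<beta>"
    "continuous_map (topol (bspace E i)) (topol (bspace E i')) \<beta>"
    "\<beta> ` bdom E U i \<subseteq> bdom E U i'"
    "Cn_family A E U F n i' \<phi>"
  shows "Cn_family A E U F n i (\<lambda>a p. \<phi> a (\<beta> p))"
  using assms
proof (induction n arbitrary: i i' \<beta> \<phi>)
  have c: "continuous_map (prod_topology A (btop E U i)) (topol F) (\<lambda>(a, p). \<phi> a (\<beta> p))"
    if "continuous_map (topol (bspace E i)) (topol (bspace E i')) \<beta>"
      "\<beta> ` bdom E U i \<subseteq> bdom E U i'" "Cn_family A E U F n i' \<phi>" for n i i' \<beta> \<phi>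
  proof -
    have "continuous_map (btop E U i) (btop E U i') \<beta>"
      unfolding continuous_map_into_btop topspace_btop
      using that by (auto simp: btop_def intro: continuous_map_from_subtopology)
    then have "continuous_map (prod_topology A (btop E U i)) (prod_topology A (btop E U i'))
        (\<lambda>x. (fst x, \<beta> (snd x)))"
      by (intro continuous_map_pairedI continuous_map_compose[OF continuous_map_snd, unfolded o_def]
          continuous_map_fst)
    from continuous_map_compose[OF this Cn_family_continuous[OF that(3)]] show ?thesis
      by (simp add: o_def case_prod_beta')
  qed
  {
    case 0
    then show ?case using c[OF 0(2-4)] by simp
  next
    case (Suc n)
    from Suc.prems(4) obtain \<psi>
      where \<psi>: "\<And>a. a \<in> topspace A \<Longrightarrow> difference_factor E U F i' (\<phi> a) (\<psi> a)"
        "Cn_family A E U F n (Suc i') \<psi>"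
      by (rule Cn_family_SucE) blast
    define \<beta>' where "\<beta>' = (\<lambda>p. Step (\<beta> (bfst p)) (\<beta> (bsnd p)) (bpar p))"
    have \<beta>'_Step: "\<beta>' (Step x y t) = Step (\<beta> x) (\<beta> y) t" for x y t
      by (simp add: \<beta>'_def)
    note lin = tvs_linearD[OF Suc.prems(1)]
    have "\<beta>' p \<in> carrier (bspace E (Suc i'))" if "p \<in> carrier (bspace E (Suc i))" for p
      using that lin by (auto elim!: carrier_bspace_SucE simp: \<beta>'_Step bspace_Suc)
    moreover have "\<beta>' (p \<oplus>\<^bsub>bspace E (Suc i)\<^esub> s \<odot>\<^bsub>bspace E (Suc i)\<^esub> q) =
        \<beta>' p \<oplus>\<^bsub>bspace E (Suc i')\<^esub> s \<odot>\<^bsub>bspace E (Suc i')\<^esub> \<beta>' q"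
      if "p \<in> carrier (bspace E (Suc i))" "q \<in> carrier (bspace E (Suc i))" for p q s
      using that lin by (auto elim!: carrier_bspace_SucE simp: \<beta>'_Step bspace_Suc)
    ultimately have 1: "tvs_linear (bspace E (Suc i)) (bspace E (Suc i')) \<beta>'"
      by (auto simp: tvs_linear_def)
    note pr = continuous_map_bspace_projections[OF tvs_E, of i]
    have 2: "continuous_map (topol (bspace E (Suc i))) (topol (bspace E (Suc i'))) \<beta>'"
      unfolding \<beta>'_def
      by (intro continuous_map_Step[OF tvs_E] pr(3)
          continuous_map_compose[OF pr(1) Suc.prems(2), unfolded o_def]
          continuous_map_compose[OF pr(2) Suc.prems(2), unfolded o_def])
    have 3: "\<beta>' (Step x y t) \<in> bdom E U (Suc i')" if "Step x y t \<in> bdom E U (Suc i)" for x y t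
    proof -
      have "x \<in> carrier (bspace E i)" "y \<in> carrier (bspace E i)"
        using that bdom_subset by (auto simp: Step_in_bdom)
      then show ?thesis
        using that lin Suc.prems(3) by (auto simp: \<beta>'_Step Step_in_bdom simp flip: lin(2))
    qed
    then have 4: "\<beta>' ` bdom E U (Suc i) \<subseteq> bdom E U (Suc i')"
      by (auto elim!: bdom_SucE simp: Step_in_bdom)
    show ?case
    proof (rule Cn_family_SucI[OF c[OF Suc.prems(2-4)] _ Suc.IH[OF 1 2 4 \<psi>(2)]])
      fix a assume "a \<in> topspace A"
      note d = \<psi>(1)[OF this]
      have "\<phi> a (\<beta> (x \<oplus>\<^bsub>bspace E i\<^esub> t \<odot>\<^bsub>bspace E i\<^esub> y)) = \<phi> a (\<beta> x) \<oplus>\<^bsub>F\<^esub> t \<odot>\<^bsub>F\<^esub> \<psi> a (\<beta>' (Step x y t))"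
        if S: "Step x y t \<in> bdom E U (Suc i)" for x y t
      proof -
        have "x \<in> carrier (bspace E i)" "y \<in> carrier (bspace E i)"
          using S bdom_subset by (auto simp: Step_in_bdom)
        then show ?thesis
          using difference_factorD[OF d 3[OF S, unfolded \<beta>'_Step]] lin by (simp add: \<beta>'_Step)
      qed
      then show "difference_factor E U F i (\<lambda>p. \<phi> a (\<beta> p)) (\<lambda>p. \<psi> a (\<beta>' p))"
        by (simp add: difference_factor_def)
    qed
  }
qed

text \<open>Lets a family be read at the base point of the next level, as the bracket of a
  composition in the chain rule requires.\<close>

lemma Cn_family_bfst:
  assumes "Cn_family A E U F n i \<phi>"
  shows "Cn_family A E U F n (Suc i) (\<lambda>a p. \<phi> a (bfst p))"
proof (rule Cn_family_linear_pullback[OF _ _ _ assms])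
  show "tvs_linear (bspace E (Suc i)) (bspace E i) bfst"
    by (auto simp: tvs_linear_def bspace_Suc elim!: carrier_bspace_SucE)
  show "bfst ` bdom E U (Suc i) \<subseteq> bdom E U i"
    by (auto elim!: bdom_SucE)
qed (rule continuous_map_bspace_projections[OF tvs_E])

lemma Cn_family_tuple:
  assumes F: "topological_vector_space F"
    and "Cn_family A E U (bspace F l) n i \<phi>" "Cn_family A E U (bspace F l) n i \<psi>"
    "Cn_family A E U field_tvs n i \<tau>"
  shows "Cn_family A E U (bspace F (Suc l)) n i (\<lambda>a p. Step (\<phi> a p) (\<psi> a p) (\<tau> a p))"
  using assms(2-)
proof (induction n arbitrary: i \<phi> \<psi> \<tau>)
  have c: "continuous_map (prod_topology A (btop E U i)) (topol (bspace F (Suc l)))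
      (\<lambda>(a, p). Step (\<phi> a p) (\<psi> a p) (\<tau> a p))"
    if "Cn_family A E U (bspace F l) n i \<phi>" "Cn_family A E U (bspace F l) n i \<psi>"
      "Cn_family A E U field_tvs n i \<tau>" for n i \<phi> \<psi> \<tau>
    using continuous_map_Step[OF F Cn_family_continuous[OF that(1)] Cn_family_continuous[OF that(2)]
      Cn_family_continuous[OF that(3), unfolded field_tvs_simps]]
    by (simp add: case_prod_beta')
  {
    case 0
    then show ?case using c[OF 0] by simp
  next
    case (Suc n)
    from Suc.prems(1) obtain \<phi>'
      where \<phi>': "\<And>a. a \<in> topspace A \<Longrightarrow> difference_factor E U (bspace F l) i (\<phi> a) (\<phi>' a)"
        "Cn_family A E U (bspace F l) n (Suc i) \<phi>'"
      by (rule Cn_family_SucE) blast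
    from Suc.prems(2) obtain \<psi>'
      where \<psi>': "\<And>a. a \<in> topspace A \<Longrightarrow> difference_factor E U (bspace F l) i (\<psi> a) (\<psi>' a)"
        "Cn_family A E U (bspace F l) n (Suc i) \<psi>'"
      by (rule Cn_family_SucE) blast
    from Suc.prems(3) obtain \<tau>'
      where \<tau>': "\<And>a. a \<in> topspace A \<Longrightarrow> difference_factor E U field_tvs i (\<tau> a) (\<tau>' a)"
        "Cn_family A E U field_tvs n (Suc i) \<tau>'"
      by (rule Cn_family_SucE) blast
    show ?case
      by (rule Cn_family_SucI[OF c[OF Suc.prems] _ Suc.IH[OF \<phi>'(2) \<psi>'(2) \<tau>'(2)]])
        (use \<phi>'(1) \<psi>'(1) \<tau>'(1) in \<open>simp add: difference_factor_def bspace_Suc\<close>)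
  }
qed

text \<open>A bracket of a linear map f is (x, y, t) mapped to f y, which is again linear and
  continuous, one level higher.\<close>

lemma Cn_family_linear:
  assumes "tvs_linear (bspace E i) F f" "continuous_map (topol (bspace E i)) (topol F) f"
  shows "Cn_family A E U F n i (\<lambda>_. f)"
  using assms
proof (induction n arbitrary: i f)
  have c: "continuous_map (prod_topology A (btop E U i)) (topol F) (\<lambda>(a, p). f p)"
    if "continuous_map (topol (bspace E i)) (topol F) f" for i f
    using continuous_map_compose[OF continuous_map_snd continuous_map_from_subtopology[OF that]]
    by (simp add: case_prod_beta' btop_def o_def)
  {
    case 0
    then show ?case using c by simp
  next
    case (Suc n)
    have 1: "tvs_linear (bspace E (Suc i)) F (\<lambda>p. f (bsnd p))"
      using tvs_linearD[OF Suc.prems(1)]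
      by (auto simp: tvs_linear_def bspace_Suc elim!: carrier_bspace_SucE)
    have 2: "continuous_map (topol (bspace E (Suc i))) (topol F) (\<lambda>p. f (bsnd p))"
      using continuous_map_compose[OF continuous_map_bspace_projections(2)[OF tvs_E] Suc.prems(2)]
      by (simp add: o_def)
    show ?case
      using tvs_linearD[OF Suc.prems(1)] bdom_subset
      by (intro Cn_family_SucI[OF c[OF Suc.prems(2)] _ Suc.IH[OF 1 2]])
        (auto simp: difference_factor_def Step_in_bdom subset_iff)
  }
qed

lemma Cn_family_bpar: "Cn_family A E U field_tvs n (Suc i) (\<lambda>_. bpar)"
proof (rule Cn_family_linear)
  show "tvs_linear (bspace E (Suc i)) field_tvs bpar"
    by (auto simp: tvs_linear_def bspace_Suc elim!: carrier_bspace_SucE)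
qed (simp add: continuous_map_bspace_projections[OF tvs_E])

text \<open>Constant in the variable of the brackets, but not in the parameter. The bracket is zero,
  which is a constant family once more.\<close>

lemma Cn_family_const:
  assumes F: "topological_vector_space F" and "continuous_map A (topol F) c"
  shows "Cn_family A E U F n i (\<lambda>a _. c a)"
  using assms(2)
proof (induction n arbitrary: i c)
  interpret F: topological_vector_space F by fact
  have c: "continuous_map (prod_topology A (btop E U i)) (topol F) (\<lambda>(a, p). c a)"
    if "continuous_map A (topol F) c" for i c
    using continuous_map_compose[OF continuous_map_fst that]
    by (simp add: case_prod_beta' o_def)
  {
    case 0
    then show ?case using c by simp
  next
    case (Suc n)
    have 1: "continuous_map A (topol F) (\<lambda>_. \<zero>\<^bsub>F\<^esub>)"
      by (simp add: F.topspace_topol)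
    have "c a \<in> carrier F" if "a \<in> topspace A" for a
      using continuous_map_image_subset_topspace[OF Suc.prems] that by (auto simp: F.topspace_topol)
    then show ?case
      by (intro Cn_family_SucI[OF c[OF Suc.prems] _ Suc.IH[OF 1]]) (auto simp: difference_factor_def)
  }
qed

text \<open>From \<alpha>(x + t y) = \<alpha>(x) + t \<alpha>'(x, y, t) and the bracket \<gamma>' of
  \<gamma>, the bracket of the composition is \<gamma>'(\<alpha>(x), \<alpha>'(x, y, t), t). Its
  inner map is a triple of families with one order less, so the induction hypothesis applies to it,
  with \<gamma>' at level l + 1. Both maps may depend on the same parameter.\<close>

lemma Cn_family_chain:
  assumes F: "topological_vector_space F" and V: "openin (topol F) V"
    and "Cn_family A F V H n l \<gamma>" "Cn_family A E U (bspace F l) n i \<alpha>"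
    and "\<And>a p. a \<in> topspace A \<Longrightarrow> p \<in> bdom E U i \<Longrightarrow> \<alpha> a p \<in> bdom F V l"
  shows "Cn_family A E U H n i (\<lambda>a p. \<gamma> a (\<alpha> a p))"
  using assms(3-)
proof (induction n arbitrary: i l \<gamma> \<alpha>)
  interpret F: open_domain F V
    using F V by (simp add: open_domain_def open_domain_axioms_def)
  have c: "continuous_map (prod_topology A (btop E U i)) (topol H) (\<lambda>(a, p). \<gamma> a (\<alpha> a p))"
    if "Cn_family A F V H n l \<gamma>" "Cn_family A E U (bspace F l) n i \<alpha>"
      "\<And>a p. a \<in> topspace A \<Longrightarrow> p \<in> bdom E U i \<Longrightarrow> \<alpha> a p \<in> bdom F V l" for n i l \<gamma> \<alpha>
  proof -
    have "continuous_map (prod_topology A (btop E U i)) (btop F V l) (\<lambda>(a, p). \<alpha> a p)"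
      using Cn_family_continuous[OF that(2)] that(3)
      by (auto simp: F.continuous_map_into_btop topspace_btop)
    from continuous_map_pairedI[OF continuous_map_fst this]
    have "continuous_map (prod_topology A (btop E U i)) (prod_topology A (btop F V l))
        (\<lambda>x. (fst x, (\<lambda>(a, p). \<alpha> a p) x))" .
    from continuous_map_compose[OF this Cn_family_continuous[OF that(1)]] show ?thesis
      by (simp add: o_def case_prod_beta')
  qed
  {
    case 0
    then show ?case using c[OF 0] by simp
  next
    case (Suc n)
    interpret Fl: topological_vector_space "bspace F l" by (rule F.tvs_bspace)
    from Suc.prems(1) obtain \<gamma>'
      where \<gamma>': "\<And>a. a \<in> topspace A \<Longrightarrow> difference_factor F V H l (\<gamma> a) (\<gamma>' a)"
        "Cn_family A F V H n (Suc l) \<gamma>'"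
      by (rule Cn_family_SucE) blast
    from Suc.prems(2) obtain \<alpha>'
      where \<alpha>': "\<And>a. a \<in> topspace A \<Longrightarrow> difference_factor E U (bspace F l) i (\<alpha> a) (\<alpha>' a)"
        "Cn_family A E U (bspace F l) n (Suc i) \<alpha>'"
      by (rule Cn_family_SucE) blast
    let ?\<beta> = "\<lambda>a p. Step (\<alpha> a (bfst p)) (\<alpha>' a p) (bpar p)"
    have 1: "Cn_family A E U (bspace F (Suc l)) n (Suc i) ?\<beta>"
      by (intro Cn_family_tuple[OF F] Cn_family_bfst Cn_family_bpar \<alpha>'(2)
          Cn_family_Suc_imp[OF Suc.prems(2)])
    \<comment> \<open>The new inner map stays in the domain since \<alpha>(x) + t \<alpha>'(x, y, t)
      is just \<alpha>(x + t y).\<close>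
    have 2: "?\<beta> a (Step x y t) \<in> bdom F V (Suc l)"
      if "a \<in> topspace A" "Step x y t \<in> bdom E U (Suc i)" for a x y t
      using that Suc.prems(3)[OF that(1)] Cn_family_carrier[OF F.tvs_bspace \<alpha>'(2) that]
      by (simp add: Step_in_bdom flip: difference_factorD[OF \<alpha>'(1)[OF that(1)] that(2)])
    have 3: "difference_factor E U H i (\<lambda>p. \<gamma> a (\<alpha> a p)) (\<lambda>p. \<gamma>' a (?\<beta> a p))"
      if "a \<in> topspace A" for a
      unfolding difference_factor_def
      using difference_factorD[OF \<gamma>'(1)[OF that]] 2[OF that] difference_factorD[OF \<alpha>'(1)[OF that]]
      by simp
    show ?case
      by (rule Cn_family_SucI[OF c[OF Suc.prems] 3 Suc.IH[OF \<gamma>'(2) 1]])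
        (use 2 in \<open>auto elim: bdom_SucE simp: Step_in_bdom\<close>)
  }
qed

lemma Cn_family_add:
  assumes F: "topological_vector_space F"
    and "Cn_family A E U F n i \<phi>" "Cn_family A E U F n i \<psi>"
  shows "Cn_family A E U F n i (\<lambda>a p. \<phi> a p \<oplus>\<^bsub>F\<^esub> \<psi> a p)"
  using assms(2-)
proof (induction n arbitrary: i \<phi> \<psi>)
  interpret F: topological_vector_space F by fact
  have c: "continuous_map (prod_topology A (btop E U i)) (topol F) (\<lambda>(a, p). \<phi> a p \<oplus>\<^bsub>F\<^esub> \<psi> a p)"
    if "Cn_family A E U F n i \<phi>" "Cn_family A E U F n i \<psi>" for n i \<phi> \<psi>
    using F.continuous_map_add[OF Cn_family_continuous[OF that(1)] Cn_family_continuous[OF that(2)]]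
    by (simp add: case_prod_beta')
  {
    case 0
    then show ?case using c[OF 0] by simp
  next
    case (Suc n)
    from Suc.prems(1) obtain \<phi>'
      where \<phi>': "\<And>a. a \<in> topspace A \<Longrightarrow> difference_factor E U F i (\<phi> a) (\<phi>' a)"
        "Cn_family A E U F n (Suc i) \<phi>'"
      by (rule Cn_family_SucE) blast
    from Suc.prems(2) obtain \<psi>'
      where \<psi>': "\<And>a. a \<in> topspace A \<Longrightarrow> difference_factor E U F i (\<psi> a) (\<psi>' a)"
        "Cn_family A E U F n (Suc i) \<psi>'"
      by (rule Cn_family_SucE) blast
    have "difference_factor E U F i (\<lambda>p. \<phi> a p \<oplus>\<^bsub>F\<^esub> \<psi> a p) (\<lambda>p. \<phi>' a p \<oplus>\<^bsub>F\<^esub> \<psi>' a p)"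
      if a: "a \<in> topspace A" for a
      unfolding difference_factor_def
    proof (intro allI impI)
      fix x y t assume S: "Step x y t \<in> bdom E U (Suc i)"
      then have x: "x \<in> bdom E U i" by (simp add: Step_in_bdom)
      note cl = Cn_family_carrier[OF F Suc.prems(1) a x] Cn_family_carrier[OF F Suc.prems(2) a x]
        Cn_family_carrier[OF F \<phi>'(2) a S] Cn_family_carrier[OF F \<psi>'(2) a S]
      show "\<phi> a (x \<oplus>\<^bsub>bspace E i\<^esub> t \<odot>\<^bsub>bspace E i\<^esub> y) \<oplus>\<^bsub>F\<^esub> \<psi> a (x \<oplus>\<^bsub>bspace E i\<^esub> t \<odot>\<^bsub>bspace E i\<^esub> y) =
          \<phi> a x \<oplus>\<^bsub>F\<^esub> \<psi> a x \<oplus>\<^bsub>F\<^esub> t \<odot>\<^bsub>F\<^esub> (\<phi>' a (Step x y t) \<oplus>\<^bsub>F\<^esub> \<psi>' a (Step x y t))"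
        unfolding difference_factorD[OF \<phi>'(1)[OF a] S] difference_factorD[OF \<psi>'(1)[OF a] S]
        using cl by (simp add: F.smult_add_right F.M.a_ac)
    qed
    then show ?case
      by (intro Cn_family_SucI[OF c[OF Suc.prems] _ Suc.IH[OF \<phi>'(2) \<psi>'(2)]])
  }
qed

text \<open>The scalar depends on the parameter alone, so it passes through brackets and no product
  rule arises.\<close>

lemma Cn_family_smult:
  assumes F: "topological_vector_space F" and s: "continuous_map A euclidean s"
    and "Cn_family A E U F n i \<phi>"
  shows "Cn_family A E U F n i (\<lambda>a p. s a \<odot>\<^bsub>F\<^esub> \<phi> a p)"
  using assms(3-)
proof (induction n arbitrary: i \<phi>)
  interpret F: topological_vector_space F by fact
  have c: "continuous_map (prod_topology A (btop E U i)) (topol F) (\<lambda>(a, p). s a \<odot>\<^bsub>F\<^esub> \<phi> a p)"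
    if "Cn_family A E U F n i \<phi>" for n i \<phi>
    using F.continuous_map_smult[OF continuous_map_compose[OF continuous_map_fst s]
        Cn_family_continuous[OF that]]
    by (simp add: case_prod_beta' o_def)
  {
    case 0
    then show ?case using c[OF 0] by simp
  next
    case (Suc n)
    from Suc.prems(1) obtain \<phi>'
      where \<phi>': "\<And>a. a \<in> topspace A \<Longrightarrow> difference_factor E U F i (\<phi> a) (\<phi>' a)"
        "Cn_family A E U F n (Suc i) \<phi>'"
      by (rule Cn_family_SucE) blast
    have "difference_factor E U F i (\<lambda>p. s a \<odot>\<^bsub>F\<^esub> \<phi> a p) (\<lambda>p. s a \<odot>\<^bsub>F\<^esub> \<phi>' a p)"
      if a: "a \<in> topspace A" for a
      unfolding difference_factor_def
    proof (intro allI impI)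
      fix x y t assume S: "Step x y t \<in> bdom E U (Suc i)"
      then have x: "x \<in> bdom E U i" by (simp add: Step_in_bdom)
      note cl = Cn_family_carrier[OF F Suc.prems(1) a x] Cn_family_carrier[OF F \<phi>'(2) a S]
      show "s a \<odot>\<^bsub>F\<^esub> \<phi> a (x \<oplus>\<^bsub>bspace E i\<^esub> t \<odot>\<^bsub>bspace E i\<^esub> y) =
          s a \<odot>\<^bsub>F\<^esub> \<phi> a x \<oplus>\<^bsub>F\<^esub> t \<odot>\<^bsub>F\<^esub> (s a \<odot>\<^bsub>F\<^esub> \<phi>' a (Step x y t))"
        unfolding difference_factorD[OF \<phi>'(1)[OF a] S]
        using cl by (simp add: F.smult_add_right F.smult_smult mult.commute)
    qed
    then show ?case
      by (intro Cn_family_SucI[OF c[OF Suc.prems] _ Suc.IH[OF \<phi>'(2)]])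
  }
qed

lemma Cn_family_linear_image:
  assumes F: "topological_vector_space F"
    and L: "tvs_linear F H L" "continuous_map (topol F) (topol H) L"
    and "Cn_family A E U F n i \<phi>"
  shows "Cn_family A E U H n i (\<lambda>a p. L (\<phi> a p))"
  using assms(4-)
proof (induction n arbitrary: i \<phi>)
  have c: "continuous_map (prod_topology A (btop E U i)) (topol H) (\<lambda>(a, p). L (\<phi> a p))"
    if "Cn_family A E U F n i \<phi>" for n i \<phi>
    using continuous_map_compose[OF Cn_family_continuous[OF that] L(2)]
    by (simp add: case_prod_beta' o_def)
  {
    case 0
    then show ?case using c[OF 0] by simp
  next
    case (Suc n)
    from Suc.prems(1) obtain \<phi>'
      where \<phi>': "\<And>a. a \<in> topspace A \<Longrightarrow> difference_factor E U F i (\<phi> a) (\<phi>' a)"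
        "Cn_family A E U F n (Suc i) \<phi>'"
      by (rule Cn_family_SucE) blast
    have "difference_factor E U H i (\<lambda>p. L (\<phi> a p)) (\<lambda>p. L (\<phi>' a p))"
      if a: "a \<in> topspace A" for a
      unfolding difference_factor_def
    proof (intro allI impI)
      fix x y t assume S: "Step x y t \<in> bdom E U (Suc i)"
      then have x: "x \<in> bdom E U i" by (simp add: Step_in_bdom)
      note cl = Cn_family_carrier[OF F Suc.prems(1) a x] Cn_family_carrier[OF F \<phi>'(2) a S]
      show "L (\<phi> a (x \<oplus>\<^bsub>bspace E i\<^esub> t \<odot>\<^bsub>bspace E i\<^esub> y)) = L (\<phi> a x) \<oplus>\<^bsub>H\<^esub> t \<odot>\<^bsub>H\<^esub> L (\<phi>' a (Step x y t))"
        unfolding difference_factorD[OF \<phi>'(1)[OF a] S]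
        using cl tvs_linearD(2)[OF L(1)] by simp
    qed
    then show ?case
      by (intro Cn_family_SucI[OF c[OF Suc.prems] _ Suc.IH[OF \<phi>'(2)]])
  }
qed

section \<open>Comparison of families with the brackets of their members\<close>

lemma Cn_family_bmapI:
  assumes F: "topological_vector_space F"
    and "\<And>a. a \<in> topspace A \<Longrightarrow> Ck E U F (i + n) (f a)"
    and "\<And>m. m \<le> n \<Longrightarrow>
      continuous_map (prod_topology A (btop E U (i + m))) (topol F) (\<lambda>(a, p). bmap E U F (f a) (i + m) p)"
  shows "Cn_family A E U F n i (\<lambda>a. bmap E U F (f a) i)"
  using assms(2-)
proof (induction n arbitrary: i)
  case 0
  then show ?case using 0(2)[of 0] by simp
next
  case (Suc n)
  show ?case
  proof (rule Cn_family_SucI)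
    show "Cn_family A E U F n (Suc i) (\<lambda>a. bmap E U F (f a) (Suc i))"
      using Suc.IH[of "Suc i"] Suc.prems(1) Suc.prems(2)[of "Suc _"] by simp
    show "difference_factor E U F i (bmap E U F (f a) i) (bmap E U F (f a) (Suc i))"
      if "a \<in> topspace A" for a
      using Ck_mono[OF Suc.prems(1)[OF that], of "Suc i"] by (intro difference_factor_bmap[OF F]) simp
  qed (use Suc.prems(2)[of 0] in simp)
qed

text \<open>At a fixed parameter, the bracket provided by the family is continuous and therefore
  equals \<open>bmap\<close>, by uniqueness. Agreement of \<phi> with \<open>bmap\<close> is
  demanded on the domain only, as the functions provided by \<open>Cn_family\<close> need not be
  extensional.\<close>

lemma Cn_family_bmapD:
  assumes F: "topological_vector_space F"
    and "Cn_family A E U F n i \<phi>"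
    and "\<And>a. a \<in> topspace A \<Longrightarrow> Ck E U F i (f a)"
    and "\<And>a p. a \<in> topspace A \<Longrightarrow> p \<in> bdom E U i \<Longrightarrow> \<phi> a p = bmap E U F (f a) i p"
  shows "(\<forall>a\<in>topspace A. Ck E U F (i + n) (f a)) \<and>
    (\<forall>m\<le>n. continuous_map (prod_topology A (btop E U (i + m))) (topol F)
      (\<lambda>(a, p). bmap E U F (f a) (i + m) p))"
  using assms(2-)
proof (induction n arbitrary: i \<phi>)
  have c: "continuous_map (prod_topology A (btop E U i)) (topol F) (\<lambda>(a, p). bmap E U F (f a) i p)"
    if "Cn_family A E U F n i \<phi>"
      "\<And>a p. a \<in> topspace A \<Longrightarrow> p \<in> bdom E U i \<Longrightarrow> \<phi> a p = bmap E U F (f a) i p" for n i \<phi>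
    using Cn_family_cong[OF that] by (rule Cn_family_continuous)
  {
    case 0
    then show ?case using c[OF 0(1,3)] by simp
  next
    case (Suc n)
    from Suc.prems(1) obtain \<psi>
      where \<psi>: "\<And>a. a \<in> topspace A \<Longrightarrow> difference_factor E U F i (\<phi> a) (\<psi> a)"
        "Cn_family A E U F n (Suc i) \<psi>"
      by (rule Cn_family_SucE) blast
    \<comment> \<open>Brackets are extensional by definition, hence the restriction of \<psi> to the
      domain.\<close>
    have *: "Ck E U F (Suc i) (f a) \<and> bmap E U F (f a) (Suc i) = restrict (\<psi> a) (bdom E U (Suc i))"
      if a: "a \<in> topspace A" for a
    proof -
      have "difference_factor E U F i (bmap E U F (f a) i) (restrict (\<psi> a) (bdom E U (Suc i)))"
        using \<psi>(1)[OF a] Suc.prems(3)[OF a] by (auto simp: difference_factor_def Step_in_bdom)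
      moreover have "continuous_map (btop E U (Suc i)) (topol F) (restrict (\<psi> a) (bdom E U (Suc i)))"
        using continuous_map_family_slice[OF \<psi>(2) a]
        by (rule continuous_map_eq) (simp add: topspace_btop)
      ultimately show ?thesis
        using Ck_Suc_iff[OF F] Suc.prems(2)[OF a] bmap_Suc_eq[OF F] by blast
    qed
    have IH: "(\<forall>a\<in>topspace A. Ck E U F (Suc i + n) (f a)) \<and>
      (\<forall>m\<le>n. continuous_map (prod_topology A (btop E U (Suc i + m))) (topol F)
        (\<lambda>(a, p). bmap E U F (f a) (Suc i + m) p))"
      by (rule Suc.IH[OF \<psi>(2)]) (use * in auto)
    have "continuous_map (prod_topology A (btop E U (i + m))) (topol F)
        (\<lambda>(a, p). bmap E U F (f a) (i + m) p)" if "m \<le> Suc n" for m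
      using IH that c[OF Suc.prems(1,3)] by (cases m) auto
    then show ?case
      using IH by simp
  }
qed

text \<open>The right-hand side is what the topology of C^r(U, F) sees; the left-hand side is what
  is stable under sums, scalars and compositions. The equivalence allows passing between the
  two.\<close>

lemma Cn_family_bmap_iff:
  assumes F: "topological_vector_space F"
  shows "Cn_family A E U F n 0 (\<lambda>a. bmap E U F (f a) 0) \<longleftrightarrow>
    (\<forall>a\<in>topspace A. Ck E U F n (f a)) \<and>
    (\<forall>m\<le>n. continuous_map (prod_topology A (btop E U m)) (topol F) (\<lambda>(a, p). bmap E U F (f a) m p))"
    (is "?L \<longleftrightarrow> ?R")
proof
  assume L: ?L
  have "Ck E U F 0 (f a)" if "a \<in> topspace A" for a
    using continuous_map_family_slice[OF L that] continuous_map_bmap_0_iff[of F "f a"]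
    unfolding Ck.simps by blast
  then show ?R
    using Cn_family_bmapD[OF F L, of f] by simp
next
  assume ?R
  then show ?L
    using Cn_family_bmapI[OF F, of A 0 n f] by simp
qed

text \<open>This is how orders are spent: of i + n brackets, n remain once the family is read at
  level i.\<close>

lemma Cn_family_bmap_shift:
  assumes F: "topological_vector_space F"
    and "Cn_family A E U F (i + n) 0 (\<lambda>a. bmap E U F (f a) 0)"
  shows "Cn_family A E U F n i (\<lambda>a. bmap E U F (f a) i)"
  using assms(2) unfolding Cn_family_bmap_iff[OF F] by (intro Cn_family_bmapI[OF F]) auto

end


section \<open>Function spaces on open sets\<close>

lemma topspace_compact_open_topology:
  "topspace (compact_open_topology L Y) = {f \<in> extensional (topspace L). continuous_map L Y f}"
  by (auto simp: compact_open_topology_def)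

lemma openin_subbasis_compact_open:
  assumes "compactin L C" "openin Y Q"
  shows "openin (compact_open_topology L Y)
    {f \<in> extensional (topspace L). continuous_map L Y f \<and> f ` C \<subseteq> Q}"
  unfolding compact_open_topology_def using assms by (intro topology_generated_by_Basis) blast

text \<open>By the tube lemma, an open set around {a} \<times> C contains a product neighbourhood.
  This serves both for subbasic sets of the compact-open topology and for the openness of
  \<open>CrK_into\<close>.\<close>

lemma openin_forall_compact:
  assumes P: "openin (prod_topology A L) P" and C: "compactin L C"
  shows "openin A {a \<in> topspace A. \<forall>x\<in>C. (a, x) \<in> P}"
proof (subst openin_subopen, intro ballI)
  fix a assume a: "a \<in> {a \<in> topspace A. \<forall>x\<in>C. (a, x) \<in> P}"
  then have "{a} \<times> C \<subseteq> P" by auto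
  then obtain S V where S: "openin A S" "a \<in> S" "C \<subseteq> V" "S \<times> V \<subseteq> P"
    using tube_lemma_right[OF P C, of a] a by auto
  then have "S \<subseteq> {a \<in> topspace A. \<forall>x\<in>C. (a, x) \<in> P}"
    using openin_subset[OF S(1)] by auto
  then show "\<exists>T. openin A T \<and> a \<in> T \<and> T \<subseteq> {a \<in> topspace A. \<forall>x\<in>C. (a, x) \<in> P}"
    using S(1,2) by blast
qed

text \<open>The exponential law. From right to left it is the tube lemma; from left to right it
  amounts to joint continuity of evaluation, for which local compactness is used.\<close>

lemma continuous_map_into_compact_open:
  assumes "locally_compact_space L" "Hausdorff_space L"
  shows "continuous_map A (compact_open_topology L Y) g \<longleftrightarrow>
    (\<forall>a\<in>topspace A. g a \<in> extensional (topspace L)) \<and>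
    continuous_map (prod_topology A L) Y (\<lambda>(a, x). g a x)" (is "?L \<longleftrightarrow> ?R1 \<and> ?R2")
proof (intro iffI conjI)
  assume L: ?L
  have g: "g a \<in> extensional (topspace L)" "continuous_map L Y (g a)" if "a \<in> topspace A" for a
    using continuous_map_image_subset_topspace[OF L] that
    by (auto simp: topspace_compact_open_topology)
  then show ?R1 by blast
  \<comment> \<open>Compact neighbourhoods C of x inside the preimage of Q turn the pointwise
    condition at (a, x) into a subbasic condition on g a, which persists for nearby parameters and
    for all points of C.\<close>
  have nb: "neighbourhood_base_of (compactin L) L"
    using assms locally_compact_space_neighbourhood_base by blast
  show ?R2
    unfolding continuous_map_def
  proof (intro conjI allI impI)
    show "(\<lambda>(a, x). g a x) \<in> topspace (prod_topology A L) \<rightarrow> topspace Y"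
      using g(2) by (auto simp: continuous_map_def)
    fix Q assume Q: "openin Y Q"
    show "openin (prod_topology A L) {p \<in> topspace (prod_topology A L). (case p of (a, x) \<Rightarrow> g a x) \<in> Q}"
      unfolding openin_prod_topology_alt
    proof (intro allI impI)
      fix a x assume "(a, x) \<in> {p \<in> topspace (prod_topology A L). (case p of (a, x) \<Rightarrow> g a x) \<in> Q}"
      then have a: "a \<in> topspace A" and x: "x \<in> topspace L" "g a x \<in> Q" by auto
      have ope: "openin L {y \<in> topspace L. g a y \<in> Q}"
        using openin_continuous_map_preimage[OF g(2)[OF a] Q] .
      then obtain W C where W: "openin L W" "compactin L C" "x \<in> W" "W \<subseteq> C"
        "C \<subseteq> {y \<in> topspace L. g a y \<in> Q}"
        using nb[unfolded neighbourhood_base_of, rule_format, OF conjI[OF ope], of x] x by auto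
      define N where "N = {f \<in> extensional (topspace L). continuous_map L Y f \<and> f ` C \<subseteq> Q}"
      have "openin A {b \<in> topspace A. g b \<in> N}"
        unfolding N_def by (intro openin_continuous_map_preimage[OF L] openin_subbasis_compact_open W Q)
      moreover have "a \<in> {b \<in> topspace A. g b \<in> N}"
        using a g[OF a] W(5) by (auto simp: N_def)
      moreover have "{b \<in> topspace A. g b \<in> N} \<times> W
          \<subseteq> {p \<in> topspace (prod_topology A L). (case p of (a, x) \<Rightarrow> g a x) \<in> Q}"
        using W(4,5) by (auto simp: N_def)
      ultimately show "\<exists>U V. openin A U \<and> openin L V \<and> a \<in> U \<and> x \<in> V \<and>
          U \<times> V \<subseteq> {p \<in> topspace (prod_topology A L). (case p of (a, x) \<Rightarrow> g a x) \<in> Q}"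
        using W(1,3) by blast
    qed
  qed
next
  assume R: "?R1 \<and> ?R2"
  then have R1: ?R1 and R2: ?R2 by auto
  have c: "continuous_map L Y (g a)" if "a \<in> topspace A" for a
  proof -
    have "continuous_map L (prod_topology A L) (\<lambda>x. (a, x))"
      using that by (intro continuous_map_pairedI) auto
    from continuous_map_compose[OF this R2] show ?thesis by (simp add: o_def)
  qed
  show ?L
    unfolding compact_open_topology_def
  proof (rule continuous_on_generated_topo)
    show "g ` topspace A \<subseteq> \<Union> {{f \<in> extensional (topspace L). continuous_map L Y f \<and> f ` C \<subseteq> Q} |C Q.
        compactin L C \<and> openin Y Q}"
    proof -
      \<comment> \<open>For C = {} the subbasic set consists of all extensional continuous maps, so
        the subbasis covers the image of g.\<close>
      have "compactin L {}" "openin Y {}" by auto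
      then show ?thesis using R1 c by blast
    qed
    fix W assume "W \<in> {{f \<in> extensional (topspace L). continuous_map L Y f \<and> f ` C \<subseteq> Q} |C Q.
        compactin L C \<and> openin Y Q}"
    then obtain C Q where W: "W = {f \<in> extensional (topspace L). continuous_map L Y f \<and> f ` C \<subseteq> Q}"
      and C: "compactin L C" and Q: "openin Y Q"
      by blast
    have pre: "g -` W \<inter> topspace A = {a \<in> topspace A. g a ` C \<subseteq> Q}"
      using R1 c by (auto simp: W)
    define P where "P = {p \<in> topspace (prod_topology A L). (case p of (a, x) \<Rightarrow> g a x) \<in> Q}"
    have P: "openin (prod_topology A L) P"
      unfolding P_def by (rule openin_continuous_map_preimage[OF R2 Q])
    have "{a \<in> topspace A. g a ` C \<subseteq> Q} = {a \<in> topspace A. \<forall>x\<in>C. (a, x) \<in> P}"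
      using compactin_subset_topspace[OF C] by (auto simp: P_def)
    then show "openin A (g -` W \<inter> topspace A)"
      unfolding pre using openin_forall_compact[OF P C] by simp
  qed
qed

lemma topspace_initial_topology [simp]: "topspace (initial_topology S I T \<phi>) = S"
  by (auto simp: initial_topology_def)

text \<open>The universal property. Openness of preimages alone would not make \<phi> i a continuous
  map; the hypothesis that its values lie in \<open>topspace (T i)\<close> supplies the
  rest.\<close>

lemma continuous_map_into_initial_topology:
  assumes "\<And>i x. i \<in> I \<Longrightarrow> x \<in> S \<Longrightarrow> \<phi> i x \<in> topspace (T i)"
  shows "continuous_map A (initial_topology S I T \<phi>) f \<longleftrightarrow>
    f ` topspace A \<subseteq> S \<and> (\<forall>i\<in>I. continuous_map A (T i) (\<lambda>a. \<phi> i (f a)))" (is "?L \<longleftrightarrow> ?R")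
proof
  assume L: ?L
  have f: "f ` topspace A \<subseteq> S"
    using continuous_map_image_subset_topspace[OF L] by simp
  moreover have "continuous_map A (T i) (\<lambda>a. \<phi> i (f a))" if i: "i \<in> I" for i
    unfolding continuous_map_def
  proof (intro conjI allI impI)
    fix Q assume "openin (T i) Q"
    then have "openin (initial_topology S I T \<phi>) {x \<in> S. \<phi> i x \<in> Q}"
      unfolding initial_topology_def using i by (intro topology_generated_by_Basis) blast
    from openin_continuous_map_preimage[OF L this]
    show "openin A {a \<in> topspace A. \<phi> i (f a) \<in> Q}"
      by (rule back_subst[of "openin A"]) (use f in auto)
  qed (use assms i f in auto)
  ultimately show ?R by blast
next
  assume R: ?R
  show ?L
    unfolding initial_topology_def
  proof (rule continuous_on_generated_topo)
    fix W assume "W \<in> insert S {{x \<in> S. \<phi> i x \<in> Q} |i Q. i \<in> I \<and> openin (T i) Q}"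
    then consider "W = S" | i Q where "W = {x \<in> S. \<phi> i x \<in> Q}" "i \<in> I" "openin (T i) Q" by blast
    then show "openin A (f -` W \<inter> topspace A)"
    proof cases
      case 1
      then have "f -` W \<inter> topspace A = topspace A" using R by blast
      then show ?thesis by simp
    next
      case 2
      then have "f -` W \<inter> topspace A = {a \<in> topspace A. \<phi> i (f a) \<in> Q}" using R by blast
      then show ?thesis
        using openin_continuous_map_preimage[of A "T i" "\<lambda>a. \<phi> i (f a)" Q] R 2 by simp
    qed
  qed (use R in auto)
qed

lemma function_tvs_simps [simp]:
  "carrier (function_tvs S E A T) = A"
  "zero (function_tvs S E A T) = (\<lambda>x\<in>S. \<zero>\<^bsub>E\<^esub>)"
  "add (function_tvs S E A T) = (\<lambda>f g. \<lambda>x\<in>S. f x \<oplus>\<^bsub>E\<^esub> g x)"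
  "smult (function_tvs S E A T) = (\<lambda>t f. \<lambda>x\<in>S. t \<odot>\<^bsub>E\<^esub> f x)"
  "topol (function_tvs S E A T) = T"
  by (auto simp: function_tvs_def)

text \<open>The algebraic laws hold pointwise. Closedness of A under the operations is read off from
  their continuity, since a continuous map has its values in the topspace. Continuous point
  evaluations into the Hausdorff space E separate functions, whence T is Hausdorff.\<close>

lemma topological_vector_space_function_tvs:
  assumes E: "topological_vector_space E"
    and A: "topspace T = A" "A \<subseteq> extensional S"
    and ev: "\<And>x. x \<in> S \<Longrightarrow> continuous_map T (topol E) (\<lambda>f. f x)"
    and zero: "(\<lambda>x\<in>S. \<zero>\<^bsub>E\<^esub>) \<in> A"
    and add: "continuous_map (prod_topology T T) T (\<lambda>(f, g). \<lambda>x\<in>S. f x \<oplus>\<^bsub>E\<^esub> g x)"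
    and smult: "continuous_map (prod_topology euclidean T) T (\<lambda>(t, f). \<lambda>x\<in>S. t \<odot>\<^bsub>E\<^esub> f x)"
  shows "topological_vector_space (function_tvs S E A T)"
proof -
  interpret E: topological_vector_space E by fact
  have ext: "f \<in> extensional S" if "f \<in> A" for f
    using that A by blast
  have val: "f x \<in> carrier E" if "f \<in> A" "x \<in> S" for f x
    using continuous_map_image_subset_topspace[OF ev[OF that(2)]] that(1) A(1)
    by (auto simp: E.topspace_topol)
  have addA: "(\<lambda>x\<in>S. f x \<oplus>\<^bsub>E\<^esub> g x) \<in> A" if "f \<in> A" "g \<in> A" for f g
    using continuous_map_image_subset_topspace[OF add] that A(1) by force
  have smultA: "(\<lambda>x\<in>S. t \<odot>\<^bsub>E\<^esub> f x) \<in> A" if "f \<in> A" for t f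
    using continuous_map_image_subset_topspace[OF smult] that A(1) by force
  have eqI: "f = g" if "f \<in> extensional S" "g \<in> extensional S" "\<And>x. x \<in> S \<Longrightarrow> f x = g x" for f g
    using that by (rule extensionalityI)
  have H: "Hausdorff_space T"
    unfolding Hausdorff_space_def
  proof (intro allI impI)
    fix f g assume fg: "f \<in> topspace T \<and> g \<in> topspace T \<and> f \<noteq> g"
    then obtain x where x: "x \<in> S" "f x \<noteq> g x"
      using eqI[of f g] ext A(1) by blast
    have "f x \<in> carrier E" "g x \<in> carrier E"
      using val x(1) fg A(1) by auto
    then obtain P Q where PQ: "openin (topol E) P" "openin (topol E) Q" "f x \<in> P" "g x \<in> Q" "disjnt P Q"
      using E.Hausdorff x(2) unfolding Hausdorff_space_def E.topspace_topol by blast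
    show "\<exists>U V. openin T U \<and> openin T V \<and> f \<in> U \<and> g \<in> V \<and> disjnt U V"
      using PQ fg openin_continuous_map_preimage[OF ev[OF x(1)] PQ(1)]
        openin_continuous_map_preimage[OF ev[OF x(1)] PQ(2)]
      by (intro exI[of _ "{h \<in> topspace T. h x \<in> P}"] exI[of _ "{h \<in> topspace T. h x \<in> Q}"])
        (auto simp: disjnt_def)
  qed
  show ?thesis
  proof (rule topological_vector_spaceI, unfold function_tvs_simps)
    show "(\<lambda>x\<in>S. (\<lambda>x\<in>S. f x \<oplus>\<^bsub>E\<^esub> g x) x \<oplus>\<^bsub>E\<^esub> h x) = (\<lambda>x\<in>S. f x \<oplus>\<^bsub>E\<^esub> (\<lambda>x\<in>S. g x \<oplus>\<^bsub>E\<^esub> h x) x)"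
      if "f \<in> A" "g \<in> A" "h \<in> A" for f g h
      using that val by (intro restrict_ext) (simp add: E.M.a_assoc)
    show "(\<lambda>x\<in>S. f x \<oplus>\<^bsub>E\<^esub> g x) = (\<lambda>x\<in>S. g x \<oplus>\<^bsub>E\<^esub> f x)" if "f \<in> A" "g \<in> A" for f g
      using that val by (intro restrict_ext) (simp add: E.M.a_comm)
    show "(\<lambda>x\<in>S. (\<lambda>x\<in>S. \<zero>\<^bsub>E\<^esub>) x \<oplus>\<^bsub>E\<^esub> f x) = f" if "f \<in> A" for f
      using that val ext by (intro eqI) auto
    show "(\<lambda>x\<in>S. 0 \<odot>\<^bsub>E\<^esub> f x) = (\<lambda>x\<in>S. \<zero>\<^bsub>E\<^esub>)" if "f \<in> A" for f
      using that val by (intro restrict_ext) simp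
    show "(\<lambda>x\<in>S. (s + t) \<odot>\<^bsub>E\<^esub> f x) = (\<lambda>x\<in>S. (\<lambda>x\<in>S. s \<odot>\<^bsub>E\<^esub> f x) x \<oplus>\<^bsub>E\<^esub> (\<lambda>x\<in>S. t \<odot>\<^bsub>E\<^esub> f x) x)"
      if "f \<in> A" for s t f
      using that val by (intro restrict_ext) (simp add: E.smult_add_left)
    show "(\<lambda>x\<in>S. t \<odot>\<^bsub>E\<^esub> (\<lambda>x\<in>S. f x \<oplus>\<^bsub>E\<^esub> g x) x) = (\<lambda>x\<in>S. (\<lambda>x\<in>S. t \<odot>\<^bsub>E\<^esub> f x) x \<oplus>\<^bsub>E\<^esub> (\<lambda>x\<in>S. t \<odot>\<^bsub>E\<^esub> g x) x)"
      if "f \<in> A" "g \<in> A" for t f g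
      using that val by (intro restrict_ext) (simp add: E.smult_add_right)
    show "(\<lambda>x\<in>S. s \<odot>\<^bsub>E\<^esub> (\<lambda>x\<in>S. t \<odot>\<^bsub>E\<^esub> f x) x) = (\<lambda>x\<in>S. (s * t) \<odot>\<^bsub>E\<^esub> f x)" if "f \<in> A" for s t f
      using that val by (intro restrict_ext) (simp add: E.smult_smult)
    show "(\<lambda>x\<in>S. 1 \<odot>\<^bsub>E\<^esub> f x) = f" if "f \<in> A" for f
      using that val ext by (intro eqI) auto
  qed (use addA smultA zero H A add smult in auto)
qed

section \<open>Local compactness of the levels U^[j]\<close>

lemma locally_compact_prod:
  "locally_compact_space A \<Longrightarrow> locally_compact_space B \<Longrightarrow> locally_compact_space (prod_topology A B)"
  by (simp add: locally_compact_space_prod_topology)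

lemma locally_compact_bspace:
  assumes "topological_vector_space E" "locally_compact_space (topol E)"
    and "locally_compact_space (euclidean :: 'k :: topological_field topology)"
  shows "locally_compact_space (topol (bspace (E :: ('k, 'v) tvs) j))"
proof (induction j)
  case 0
  interpret topological_vector_space E by fact
  have "topol E homeomorphic_space topol (bspace E 0)"
    using homeomorphic_map_transport[OF inj_Base topspace_topol] homeomorphic_map_imp_homeomorphic_space
    by (simp add: bspace.simps)
  then show ?case
    using assms(2) homeomorphic_locally_compact_space by blast
next
  case (Suc j)
  let ?B = "prod_tvs (bspace E j) (prod_tvs (bspace E j) field_tvs)"
  interpret B: topological_vector_space ?B
    by (intro topological_vector_space_prod topological_vector_space_bspace
        topological_vector_space_field_tvs assms)
  have "topol ?B homeomorphic_space topol (bspace E (Suc j))"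
    using homeomorphic_map_transport[OF inj_Step B.topspace_topol]
      homeomorphic_map_imp_homeomorphic_space
    by (simp add: bspace.simps(2))
  moreover have "locally_compact_space (topol ?B)"
    using Suc assms(3) by (simp add: locally_compact_prod)
  ultimately show ?case
    using homeomorphic_locally_compact_space by blast
qed

lemma locally_compact_finite_dimensional:
  assumes "finite_dimensional_tvs (F :: ('k :: topological_field, 'v) tvs)"
    and "locally_compact_space (euclidean :: 'k topology)"
  shows "locally_compact_space (topol F)"
proof -
  obtain d :: nat and b where
    "homeomorphic_map (product_topology (\<lambda>_. euclidean) {..<d}) (topol F)
      (\<lambda>x. \<Oplus>\<^bsub>F\<^esub>i\<in>{..<d}. x i \<odot>\<^bsub>F\<^esub> b i)"
    using assms(1) unfolding finite_dimensional_tvs_def by blast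
  then have "product_topology (\<lambda>_. euclidean :: 'k topology) {..<d} homeomorphic_space topol F"
    by (rule homeomorphic_map_imp_homeomorphic_space)
  moreover have "locally_compact_space (product_topology (\<lambda>_. euclidean :: 'k topology) {..<d})"
    using assms(2) by (simp add: locally_compact_space_product_topology)
  ultimately show ?thesis
    using homeomorphic_locally_compact_space by blast
qed

text \<open>The setting in which the exponential law is available for every U^[j] at once.\<close>

locale locally_compact_open_domain = open_domain E U
  for E :: "('k :: topological_field, 'v) tvs" (structure) and U +
  assumes locally_compact: "locally_compact_space (topol E)"
    and locally_compact_field: "locally_compact_space (euclidean :: 'k topology)"
begin

lemma locally_compact_btop: "locally_compact_space (btop E U j)"
  unfolding btop_def
  using locally_compact_bspace[OF tvs_E locally_compact locally_compact_field] openin_bdom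
    topological_vector_space.Hausdorff[OF tvs_bspace]
  by (intro locally_compact_space_open_subset) auto

lemma Hausdorff_btop: "Hausdorff_space (btop E U j)"
  unfolding btop_def
  using topological_vector_space.Hausdorff[OF tvs_bspace] by (intro Hausdorff_space_subtopology)

lemma carrier_Cr_space: "carrier (Cr_space E U F r) = {f \<in> extensional U. Cr E U F r f}"
  by (simp add: Cr_space_def Let_def)

lemma topspace_Cr_space: "topspace (topol (Cr_space E U F r)) = carrier (Cr_space E U F r)"
  by (simp add: Cr_space_def Let_def)

text \<open>The exponential law for C^r(U, F): the initial topology reduces continuity to the single
  maps f^[j], each of these to joint continuity, and \<open>Cn_family_bmap_iff\<close> collects the
  results.\<close>

lemma continuous_map_into_Cr_space_bmap:
  assumes F: "topological_vector_space F"
  shows "continuous_map A (topol (Cr_space E U F r)) f \<longleftrightarrow>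
    (\<forall>a\<in>topspace A. f a \<in> extensional U) \<and>
    (\<forall>n. enat n \<le> r \<longrightarrow> Cn_family A E U F n 0 (\<lambda>a. bmap E U F (f a) 0))"
proof -
  let ?C = "{f \<in> extensional U. Cr E U F r f}"
  have "continuous_map A (topol (Cr_space E U F r)) f \<longleftrightarrow>
    f ` topspace A \<subseteq> ?C \<and> (\<forall>j\<in>{j. enat j \<le> r}.
      continuous_map A (compact_open_topology (btop E U j) (topol F)) (\<lambda>a. bmap E U F (f a) j))"
    unfolding Cr_space_def Let_def function_tvs_simps
    by (rule continuous_map_into_initial_topology)
      (auto simp: topspace_compact_open_topology topspace_btop Cr_def
        intro: continuous_map_bmap[OF F] bmap_extensional[OF F])
  also have "\<dots> \<longleftrightarrow> f ` topspace A \<subseteq> ?C \<and> (\<forall>j. enat j \<le> r \<longrightarrow>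
      continuous_map (prod_topology A (btop E U j)) (topol F) (\<lambda>(a, p). bmap E U F (f a) j p))"
    unfolding continuous_map_into_compact_open[OF locally_compact_btop Hausdorff_btop]
    by (auto simp: topspace_btop Cr_def intro: bmap_extensional[OF F])
  also have "\<dots> \<longleftrightarrow> (\<forall>a\<in>topspace A. f a \<in> extensional U) \<and>
    (\<forall>n. enat n \<le> r \<longrightarrow> Cn_family A E U F n 0 (\<lambda>a. bmap E U F (f a) 0))"
  proof -
    have "enat m \<le> r" if "m \<le> n" "enat n \<le> r" for m n
      using that order_trans enat_ord_simps(1) by blast
    then show ?thesis
      unfolding Cn_family_bmap_iff[OF F] Cr_def image_subset_iff mem_Collect_eq by blast
  qed
  finally show ?thesis .
qed

end

lemma bmap_0: "p \<in> bdom E U 0 \<Longrightarrow> bmap E U F f 0 p = f (bval p)"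
  by (auto simp: inv_f_f[OF inj_Base])

declare bmap.simps(1) [simp del]

context open_domain
begin

text \<open>\<open>bmap\<close> at level 0 is f transported along \<open>Base\<close> and
  restricted. Families only see values on the domain, so the unrestricted form can be used
  instead.\<close>

lemma Cn_family_bmap_0_iff:
  assumes "\<And>a p. a \<in> topspace A \<Longrightarrow> p \<in> bdom E U 0 \<Longrightarrow> \<phi> a p = f a (bval p)"
  shows "Cn_family A E U F n 0 (\<lambda>a. bmap E U F (f a) 0) \<longleftrightarrow> Cn_family A E U F n 0 \<phi>"
proof
  assume "Cn_family A E U F n 0 (\<lambda>a. bmap E U F (f a) 0)"
  then show "Cn_family A E U F n 0 \<phi>"
    by (rule Cn_family_cong) (simp only: assms bmap_0)
next
  assume "Cn_family A E U F n 0 \<phi>"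
  then show "Cn_family A E U F n 0 (\<lambda>a. bmap E U F (f a) 0)"
    by (rule Cn_family_cong) (simp only: assms bmap_0)
qed

lemma Cn_family_0_continuous_iff:
  "Cn_family A E U F 0 0 (\<lambda>a p. f a (bval p)) \<longleftrightarrow>
    continuous_map (prod_topology A (subtopology (topol E) U)) (topol F) (\<lambda>(a, x). f a x)"
proof
  assume *: "Cn_family A E U F 0 0 (\<lambda>a p. f a (bval p))"
  have "continuous_map (subtopology (topol E) U) (btop E U 0) Base"
    unfolding continuous_map_into_btop
    by (auto intro: continuous_map_from_subtopology continuous_map_Base[OF tvs_E])
  then have "continuous_map (prod_topology A (subtopology (topol E) U)) (prod_topology A (btop E U 0))
      (\<lambda>x. (fst x, Base (snd x)))"
    by (intro continuous_map_pairedI continuous_map_fst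
        continuous_map_compose[OF continuous_map_snd, unfolded o_def])
  from continuous_map_compose[OF this Cn_family_continuous[OF *]]
  show "continuous_map (prod_topology A (subtopology (topol E) U)) (topol F) (\<lambda>(a, x). f a x)"
    by (simp add: o_def case_prod_beta')
next
  assume *: "continuous_map (prod_topology A (subtopology (topol E) U)) (topol F) (\<lambda>(a, x). f a x)"
  have "continuous_map (btop E U 0) (subtopology (topol E) U) bval"
    by (auto simp: continuous_map_in_subtopology btop_def
        intro: continuous_map_from_subtopology continuous_map_bval[OF tvs_E])
  then have "continuous_map (prod_topology A (btop E U 0)) (prod_topology A (subtopology (topol E) U))
      (\<lambda>x. (fst x, bval (snd x)))"
    by (intro continuous_map_pairedI continuous_map_fst
        continuous_map_compose[OF continuous_map_snd, unfolded o_def])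
  from continuous_map_compose[OF this *]
  show "Cn_family A E U F 0 0 (\<lambda>a p. f a (bval p))"
    by (simp add: o_def case_prod_beta')
qed

end

context locally_compact_open_domain
begin

lemma continuous_map_into_Cr_space:
  assumes F: "topological_vector_space F"
  shows "continuous_map A (topol (Cr_space E U F r)) f \<longleftrightarrow>
    (\<forall>a\<in>topspace A. f a \<in> extensional U) \<and>
    (\<forall>n. enat n \<le> r \<longrightarrow> Cn_family A E U F n 0 (\<lambda>a p. f a (bval p)))"
  unfolding continuous_map_into_Cr_space_bmap[OF F] by (simp add: Cn_family_bmap_0_iff)

lemma topological_vector_space_Cr_space:
  assumes F: "topological_vector_space F"
  shows "topological_vector_space (Cr_space E U F r)"
proof -
  interpret F: topological_vector_space F by fact
  let ?T = "topol (Cr_space E U F r)"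
  note iff = continuous_map_into_Cr_space[OF F]
  \<comment> \<open>The exponential law is applied to the identity: evaluation becomes a family
    whose parameter space is the function space itself. The vector space operations are then treated
    by applying the closure properties to this universal family.\<close>
  have id: "Cn_family ?T E U F n 0 (\<lambda>f p. f (bval p))" if "enat n \<le> r" for n
    using iff[of ?T r "\<lambda>f. f"] that by simp
  have id0: "Cn_family ?T E U F 0 0 (\<lambda>f p. f (bval p))"
    by (rule id) (simp add: enat_0)
  have C: "Cr_space E U F r = function_tvs U F (carrier (Cr_space E U F r)) ?T"
    by (simp add: Cr_space_def Let_def)
  show ?thesis
  proof (subst C, rule topological_vector_space_function_tvs[OF F topspace_Cr_space])
    show "carrier (Cr_space E U F r) \<subseteq> extensional U"
      by (auto simp: carrier_Cr_space)
    show "continuous_map ?T (topol F) (\<lambda>f. f x)" if "x \<in> U" for x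
    proof -
      have "x \<in> topspace (topol E)" using that openin_subset[OF open_U] by blast
      then have "continuous_map ?T (prod_topology ?T (subtopology (topol E) U)) (\<lambda>f. (f, x))"
        using that by (intro continuous_map_pairedI) auto
      from continuous_map_compose[OF this iffD1[OF Cn_family_0_continuous_iff[of ?T F "\<lambda>f. f"] id0]]
      show ?thesis by (simp add: o_def)
    qed
    \<comment> \<open>A one-point parameter space turns the continuity criterion into a membership
      test for the zero function.\<close>
    have "continuous_map (discrete_topology {()}) ?T (\<lambda>_. \<lambda>x\<in>U. \<zero>\<^bsub>F\<^esub>)"
      unfolding iff
    proof (intro conjI allI impI)
      fix n
      have "Cn_family (discrete_topology {()}) E U F n 0 (\<lambda>_ _. \<zero>\<^bsub>F\<^esub>)"
        by (rule Cn_family_const[OF F]) (simp add: F.topspace_topol)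
      then show "Cn_family (discrete_topology {()}) E U F n 0 (\<lambda>_ p. (\<lambda>x\<in>U. \<zero>\<^bsub>F\<^esub>) (bval p))"
        by (rule Cn_family_cong) auto
    qed auto
    then show "(\<lambda>x\<in>U. \<zero>\<^bsub>F\<^esub>) \<in> carrier (Cr_space E U F r)"
      unfolding topspace_Cr_space[symmetric] continuous_map_def by simp
    show "continuous_map (prod_topology ?T ?T) ?T (\<lambda>(f, g). \<lambda>x\<in>U. f x \<oplus>\<^bsub>F\<^esub> g x)"
      unfolding iff
    proof (intro conjI allI impI)
      fix n assume "enat n \<le> r"
      from Cn_family_add[OF F Cn_family_reparametrize[OF continuous_map_fst id[OF this]]
          Cn_family_reparametrize[OF continuous_map_snd id[OF this]]]
      show "Cn_family (prod_topology ?T ?T) E U F n 0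
          (\<lambda>a p. (case a of (f, g) \<Rightarrow> \<lambda>x\<in>U. f x \<oplus>\<^bsub>F\<^esub> g x) (bval p))"
        by (rule Cn_family_cong) auto
    qed auto
    show "continuous_map (prod_topology euclidean ?T) ?T (\<lambda>(t, f). \<lambda>x\<in>U. t \<odot>\<^bsub>F\<^esub> f x)"
      unfolding iff
    proof (intro conjI allI impI)
      fix n assume "enat n \<le> r"
      from Cn_family_smult[OF F continuous_map_fst Cn_family_reparametrize[OF continuous_map_snd id[OF this]]]
      show "Cn_family (prod_topology euclidean ?T) E U F n 0
          (\<lambda>a p. (case a of (t, f) \<Rightarrow> \<lambda>x\<in>U. t \<odot>\<^bsub>F\<^esub> f x) (bval p))"
        by (rule Cn_family_cong) auto
    qed auto
  qed
qed

end


section \<open>Function spaces on manifolds\<close>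

locale charted_space =
  fixes M :: "('k :: topological_field, 'm, 'z) manifold"
  assumes locally_compact_field: "locally_compact_space (euclidean :: 'k topology)"
    and model: "finite_dimensional_tvs (model M)"
    and charts: "c \<in> charts M \<Longrightarrow> is_chart (space_of M) (model M) c"
    and charts_cover: "(\<Union>(W, \<kappa>)\<in>charts M. W) = topspace (space_of M)"

text \<open>For extensional f a, this will turn out to be continuity of f as a map into C^r(M, F),
  see \<open>continuous_map_into_Cr_manifold_space\<close>.\<close>

definition Cr_family :: "'a topology \<Rightarrow> ('k :: topological_field, 'm, 'z) manifold \<Rightarrow> ('k, 'v) tvs \<Rightarrow> enat \<Rightarrow>
    ('a \<Rightarrow> 'm \<Rightarrow> 'v) \<Rightarrow> bool" where
  "Cr_family A M F r f \<longleftrightarrow> (\<forall>(W, \<kappa>)\<in>charts M. \<forall>n. enat n \<le> r \<longrightarrow>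
    Cn_family A (model M) (\<kappa> ` W) F n 0 (\<lambda>a p. f a (inv_into W \<kappa> (bval p))))"

lemma Cr_familyI:
  assumes "\<And>W \<kappa> n. (W, \<kappa>) \<in> charts M \<Longrightarrow> enat n \<le> r \<Longrightarrow>
    Cn_family A (model M) (\<kappa> ` W) F n 0 (\<lambda>a p. f a (inv_into W \<kappa> (bval p)))"
  shows "Cr_family A M F r f"
  using assms by (auto simp: Cr_family_def)

lemma Cr_familyD:
  assumes "Cr_family A M F r f" "(W, \<kappa>) \<in> charts M" "enat n \<le> r"
  shows "Cn_family A (model M) (\<kappa> ` W) F n 0 (\<lambda>a p. f a (inv_into W \<kappa> (bval p)))"
  using assms by (auto simp: Cr_family_def)

lemma Cr_family_reparametrize:
  assumes "continuous_map B A \<beta>" "Cr_family A M F r f"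
  shows "Cr_family B M F r (\<lambda>b. f (\<beta> b))"
  using Cn_family_reparametrize[OF assms(1) Cr_familyD[OF assms(2)]] by (intro Cr_familyI)

lemma (in topological_vector_space) open_domainI: "openin (topol E) U \<Longrightarrow> open_domain E U"
  by (intro open_domain.intro open_domain_axioms.intro topological_vector_space_axioms)

context charted_space
begin

abbreviation (input) "S \<equiv> topspace (space_of M)"

lemma model_tvs: "topological_vector_space (model M)"
  using model by (simp add: finite_dimensional_tvs_def)

context
  fixes W \<kappa>
  assumes c: "(W, \<kappa>) \<in> charts M"
begin

lemma openin_chart_domain: "openin (space_of M) W"
  using charts[OF c] by (simp add: is_chart_def)

lemma chart_domain_subset: "W \<subseteq> S"
  using openin_subset[OF openin_chart_domain] .

lemma homeomorphic_map_chart: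
  "homeomorphic_map (subtopology (space_of M) W) (subtopology (topol (model M)) (\<kappa> ` W)) \<kappa>"
  using charts[OF c] by (simp add: is_chart_def)

lemma inj_on_chart: "inj_on \<kappa> W"
  using homeomorphic_imp_injective_map[OF homeomorphic_map_chart] chart_domain_subset
  by (simp add: inf_absorb2)

lemma inv_chart: "x \<in> W \<Longrightarrow> inv_into W \<kappa> (\<kappa> x) = x"
  using inj_on_chart by (rule inv_into_f_f)

lemma locally_compact_open_domain_chart: "locally_compact_open_domain (model M) (\<kappa> ` W)"
proof -
  interpret topological_vector_space "model M" by (rule model_tvs)
  show ?thesis
    using charts[OF c] locally_compact_field locally_compact_finite_dimensional[OF model]
    by (intro locally_compact_open_domain.intro locally_compact_open_domain_axioms.intro open_domainI)
      (auto simp: is_chart_def)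
qed

lemma open_domain_chart: "open_domain (model M) (\<kappa> ` W)"
  using locally_compact_open_domain_chart by (rule locally_compact_open_domain.axioms)

end

section \<open>Families on M, chart by chart\<close>

lemma Cr_family_cong:
  assumes "Cr_family A M F r f" "\<And>a x. a \<in> topspace A \<Longrightarrow> x \<in> S \<Longrightarrow> f a x = f' a x"
  shows "Cr_family A M F r f'"
proof (rule Cr_familyI)
  fix W \<kappa> n assume c: "(W, \<kappa>) \<in> charts M" "enat n \<le> r"
  interpret open_domain "model M" "\<kappa> ` W" by (rule open_domain_chart[OF c(1)])
  show "Cn_family A (model M) (\<kappa> ` W) F n 0 (\<lambda>a p. f' a (inv_into W \<kappa> (bval p)))"
    using Cr_familyD[OF assms(1) c]
    by (rule Cn_family_cong)
      (use assms(2) inv_chart[OF c(1)] chart_domain_subset[OF c(1)] in auto)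
qed

lemma Cr_family_const:
  assumes "topological_vector_space F" "continuous_map A (topol F) f"
  shows "Cr_family A M F r (\<lambda>a _. f a)"
  using open_domain.Cn_family_const[OF open_domain_chart assms] by (intro Cr_familyI)

lemma Cr_family_add:
  assumes "topological_vector_space F" "Cr_family A M F r f" "Cr_family A M F r g"
  shows "Cr_family A M F r (\<lambda>a x. f a x \<oplus>\<^bsub>F\<^esub> g a x)"
  using open_domain.Cn_family_add[OF open_domain_chart assms(1) Cr_familyD[OF assms(2)] Cr_familyD[OF assms(3)]]
  by (intro Cr_familyI)

lemma Cr_family_smult:
  assumes "topological_vector_space F" "continuous_map A euclidean s" "Cr_family A M F r f"
  shows "Cr_family A M F r (\<lambda>a x. s a \<odot>\<^bsub>F\<^esub> f a x)"
  using open_domain.Cn_family_smult[OF open_domain_chart assms(1,2) Cr_familyD[OF assms(3)]]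
  by (intro Cr_familyI)

lemma Cr_family_linear_image:
  assumes "topological_vector_space F" "tvs_linear F H L" "continuous_map (topol F) (topol H) L"
    "Cr_family A M F r f"
  shows "Cr_family A M H r (\<lambda>a x. L (f a x))"
  using open_domain.Cn_family_linear_image[OF open_domain_chart assms(1-3) Cr_familyD[OF assms(4)]]
  by (intro Cr_familyI)

lemma Cr_family_tuple:
  assumes "topological_vector_space F" "Cr_family A M (bspace F l) r f" "Cr_family A M (bspace F l) r g"
    "Cr_family A M field_tvs r s"
  shows "Cr_family A M (bspace F (Suc l)) r (\<lambda>a x. Step (f a x) (g a x) (s a x))"
  using open_domain.Cn_family_tuple[OF open_domain_chart assms(1) Cr_familyD[OF assms(2)]
      Cr_familyD[OF assms(3)] Cr_familyD[OF assms(4)]]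
  by (intro Cr_familyI)

text \<open>The outer map may live at any level l over V, so that it can be a bracket g^[l] of a
  function on V, depending on the parameter through g.\<close>

lemma Cr_family_chain:
  assumes "topological_vector_space F" "openin (topol F) V"
    and "\<And>n. enat n \<le> r \<Longrightarrow> Cn_family A F V H n l \<gamma>" "Cr_family A M (bspace F l) r \<alpha>"
    and "\<And>a x. a \<in> topspace A \<Longrightarrow> x \<in> S \<Longrightarrow> \<alpha> a x \<in> bdom F V l"
  shows "Cr_family A M H r (\<lambda>a x. \<gamma> a (\<alpha> a x))"
proof (rule Cr_familyI)
  fix W \<kappa> n assume c: "(W, \<kappa>) \<in> charts M" "enat n \<le> r"
  interpret open_domain "model M" "\<kappa> ` W" by (rule open_domain_chart[OF c(1)])
  show "Cn_family A (model M) (\<kappa> ` W) H n 0 (\<lambda>a p. \<gamma> a (\<alpha> a (inv_into W \<kappa> (bval p))))"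
    by (rule Cn_family_chain[OF assms(1,2) assms(3)[OF c(2)] Cr_familyD[OF assms(4) c]])
      (use assms(5) inv_chart[OF c(1)] chart_domain_subset[OF c(1)] in auto)
qed

text \<open>Order zero in a chart with domain W gives continuity on \<open>topspace A\<close>
  \<times> W. These sets are open and cover the product; as the pieces are restrictions of one map,
  pasting needs no compatibility argument.\<close>

lemma Cr_family_continuous:
  assumes "Cr_family A M F r f"
  shows "continuous_map (prod_topology A (space_of M)) (topol F) (\<lambda>(a, x). f a x)"
proof (rule pasting_lemma[where I = "charts M" and T = "\<lambda>c. topspace A \<times> fst c" and f = "\<lambda>_ (a, x). f a x"])
  show "openin (prod_topology A (space_of M)) (topspace A \<times> fst c)" if "c \<in> charts M" for c
    using openin_chart_domain[of "fst c" "snd c"] that by (simp add: openin_prod_Times_iff)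
  show "\<exists>c. c \<in> charts M \<and> p \<in> topspace A \<times> fst c \<and> (case p of (a, x) \<Rightarrow> f a x) = (case p of (a, x) \<Rightarrow> f a x)"
    if "p \<in> topspace (prod_topology A (space_of M))" for p
    using that charts_cover by fastforce
  show "continuous_map (subtopology (prod_topology A (space_of M)) (topspace A \<times> fst c)) (topol F)
      (\<lambda>(a, x). f a x)" if c0: "c \<in> charts M" for c
  proof -
    obtain W \<kappa> where c: "c = (W, \<kappa>)" "(W, \<kappa>) \<in> charts M" using c0 by (cases c) auto
    interpret open_domain "model M" "\<kappa> ` W" by (rule open_domain_chart[OF c(2)])
    have "enat 0 \<le> r" by (simp add: enat_0)
    from iffD1[OF Cn_family_0_continuous_iff[where f = "\<lambda>a z. f a (inv_into W \<kappa> z)"] Cr_familyD[OF assms c(2) this]]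
    have 1: "continuous_map (prod_topology A (subtopology (topol (model M)) (\<kappa> ` W))) (topol F)
        (\<lambda>(a, z). f a (inv_into W \<kappa> z))" .
    have "continuous_map (prod_topology A (subtopology (space_of M) W))
        (prod_topology A (subtopology (topol (model M)) (\<kappa> ` W))) (\<lambda>x. (fst x, \<kappa> (snd x)))"
      by (intro continuous_map_pairedI continuous_map_fst
          continuous_map_compose[OF continuous_map_snd, unfolded o_def]
          homeomorphic_imp_continuous_map[OF homeomorphic_map_chart[OF c(2)]])
    from continuous_map_compose[OF this 1]
    have "continuous_map (prod_topology A (subtopology (space_of M) W)) (topol F) (\<lambda>(a, x). f a x)"
      by (rule continuous_map_eq) (auto simp: inv_chart[OF c(2)])
    then show ?thesis
      by (simp add: c(1) subtopology_Times)
  qed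
qed simp

lemma Cr_family_continuous_slice:
  assumes "Cr_family A M F r f" "a \<in> topspace A"
  shows "continuous_map (space_of M) (topol F) (f a)"
proof -
  have "continuous_map (space_of M) (prod_topology A (space_of M)) (\<lambda>x. (a, x))"
    using assms(2) by (intro continuous_map_pairedI) auto
  from continuous_map_compose[OF this Cr_family_continuous[OF assms(1)]] show ?thesis
    by (simp add: o_def)
qed

section \<open>The spaces C^r(M, F)\<close>

lemma carrier_Cr_manifold_space:
  "carrier (Cr_manifold_space M F r) = {f \<in> extensional S. Cr_on_manifold M F r f}"
  by (simp add: Cr_manifold_space_def Let_def)

lemma topspace_Cr_manifold_space:
  "topspace (topol (Cr_manifold_space M F r)) = carrier (Cr_manifold_space M F r)"
  by (simp add: Cr_manifold_space_def Let_def)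

text \<open>The exponential law for C^r(M, F), obtained from that in the charts. That each f a is of
  class C^r on M is part of the left-hand side only, and has to be recovered from the
  family.\<close>

lemma continuous_map_into_Cr_manifold_space:
  assumes F: "topological_vector_space F"
  shows "continuous_map A (topol (Cr_manifold_space M F r)) f \<longleftrightarrow>
    (\<forall>a\<in>topspace A. f a \<in> extensional S) \<and> Cr_family A M F r f"
proof -
  let ?C = "{f \<in> extensional S. Cr_on_manifold M F r f}"
  let ?\<phi> = "\<lambda>(W, \<kappa>) \<gamma>. compose (\<kappa> ` W) \<gamma> (inv_into W \<kappa>)"
  let ?T = "\<lambda>(W, \<kappa>). topol (Cr_space (model M) (\<kappa> ` W) F r)"
  have "continuous_map A (topol (Cr_manifold_space M F r)) f \<longleftrightarrow>
    f ` topspace A \<subseteq> ?C \<and> (\<forall>c\<in>charts M. continuous_map A (?T c) (\<lambda>a. ?\<phi> c (f a)))"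
    unfolding Cr_manifold_space_def Let_def function_tvs_simps
  proof (rule continuous_map_into_initial_topology)
    fix c g assume "c \<in> charts M" and g: "g \<in> ?C"
    then obtain W \<kappa> where c: "c = (W, \<kappa>)" "(W, \<kappa>) \<in> charts M" by (cases c) auto
    interpret locally_compact_open_domain "model M" "\<kappa> ` W"
      by (rule locally_compact_open_domain_chart[OF c(2)])
    have "Cr (model M) (\<kappa> ` W) F r (\<lambda>z. g (inv_into W \<kappa> z))"
      using g c(2) by (auto simp: Cr_on_manifold_def)
    moreover have "Ck (model M) (\<kappa> ` W) F k (compose (\<kappa> ` W) g (inv_into W \<kappa>)) \<longleftrightarrow>
        Ck (model M) (\<kappa> ` W) F k (\<lambda>z. g (inv_into W \<kappa> z))" for k
      by (rule Ck_cong) (simp add: compose_def)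
    ultimately have "Cr (model M) (\<kappa> ` W) F r (compose (\<kappa> ` W) g (inv_into W \<kappa>))"
      unfolding Cr_def by blast
    then show "?\<phi> c g \<in> topspace (?T c)"
      by (simp add: c(1) topspace_Cr_space carrier_Cr_space)
  qed
  also have "\<dots> \<longleftrightarrow> (\<forall>a\<in>topspace A. f a \<in> extensional S) \<and> Cr_family A M F r f"
  proof -
    have 1: "continuous_map A (?T (W, \<kappa>)) (\<lambda>a. ?\<phi> (W, \<kappa>) (f a)) \<longleftrightarrow>
        (\<forall>n. enat n \<le> r \<longrightarrow> Cn_family A (model M) (\<kappa> ` W) F n 0 (\<lambda>a p. f a (inv_into W \<kappa> (bval p))))"
      if c: "(W, \<kappa>) \<in> charts M" for W \<kappa>
    proof -
      interpret locally_compact_open_domain "model M" "\<kappa> ` W"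
        by (rule locally_compact_open_domain_chart[OF c])
      have "Cn_family A (model M) (\<kappa> ` W) F n 0 (\<lambda>a p. compose (\<kappa> ` W) (f a) (inv_into W \<kappa>) (bval p)) \<longleftrightarrow>
          Cn_family A (model M) (\<kappa> ` W) F n 0 (\<lambda>a p. f a (inv_into W \<kappa> (bval p)))" for n
        by (auto elim!: Cn_family_cong simp: compose_def)
      then show ?thesis
        by (simp add: continuous_map_into_Cr_space[OF F])
    qed
    have 2: "(\<forall>c\<in>charts M. continuous_map A (?T c) (\<lambda>a. ?\<phi> c (f a))) \<longleftrightarrow> Cr_family A M F r f"
      unfolding Cr_family_def using 1 by (auto split: prod.splits)
    \<comment> \<open>Slicing the family at a gives the C^n property in every chart; global
      continuity comes from pasting.\<close>
    have 3: "Cr_on_manifold M F r (f a)" if fam: "Cr_family A M F r f" and a: "a \<in> topspace A" for a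
      unfolding Cr_on_manifold_def
    proof (intro conjI ballI)
      show "continuous_map (space_of M) (topol F) (f a)"
        by (rule Cr_family_continuous_slice[OF fam a])
      fix c assume "c \<in> charts M"
      then obtain W \<kappa> where c: "c = (W, \<kappa>)" "(W, \<kappa>) \<in> charts M" by (cases c) auto
      interpret open_domain "model M" "\<kappa> ` W" by (rule open_domain_chart[OF c(2)])
      have "Ck (model M) (\<kappa> ` W) F n (\<lambda>z. f a (inv_into W \<kappa> z))" if "enat n \<le> r" for n
      proof -
        have "Cn_family A (model M) (\<kappa> ` W) F n 0 (\<lambda>a. bmap (model M) (\<kappa> ` W) F (\<lambda>z. f a (inv_into W \<kappa> z)) 0)"
          unfolding Cn_family_bmap_0_iff[OF refl] by (rule Cr_familyD[OF fam c(2) that])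
        then show ?thesis
          unfolding Cn_family_bmap_iff[OF F] using a by blast
      qed
      then show "case c of (W, \<kappa>) \<Rightarrow> Cr (model M) (\<kappa> ` W) F r (\<lambda>z. f a (inv_into W \<kappa> z))"
        by (simp add: c(1) Cr_def)
    qed
    show ?thesis
      unfolding 2 using 3 by blast
  qed
  finally show ?thesis .
qed

lemma topological_vector_space_Cr_manifold_space:
  assumes F: "topological_vector_space F"
  shows "topological_vector_space (Cr_manifold_space M F r)"
proof -
  interpret F: topological_vector_space F by fact
  let ?T = "topol (Cr_manifold_space M F r)"
  note iff = continuous_map_into_Cr_manifold_space[OF F]
  have id: "Cr_family ?T M F r (\<lambda>f. f)"
    using iff[of ?T r "\<lambda>f. f"] by simp
  have C: "Cr_manifold_space M F r = function_tvs S F (carrier (Cr_manifold_space M F r)) ?T"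
    by (simp add: Cr_manifold_space_def Let_def)
  show ?thesis
  proof (subst C, rule topological_vector_space_function_tvs[OF F topspace_Cr_manifold_space])
    show "carrier (Cr_manifold_space M F r) \<subseteq> extensional S"
      by (auto simp: carrier_Cr_manifold_space)
    show "continuous_map ?T (topol F) (\<lambda>f. f x)" if "x \<in> S" for x
    proof -
      have "continuous_map ?T (prod_topology ?T (space_of M)) (\<lambda>f. (f, x))"
        using that by (intro continuous_map_pairedI) auto
      from continuous_map_compose[OF this Cr_family_continuous[OF id]]
      show ?thesis by (simp add: o_def)
    qed
    have "Cr_family (discrete_topology {()}) M F r (\<lambda>_ _. \<zero>\<^bsub>F\<^esub>)"
      by (rule Cr_family_const[OF F]) (simp add: F.topspace_topol)
    then have "Cr_family (discrete_topology {()}) M F r (\<lambda>_. \<lambda>x\<in>S. \<zero>\<^bsub>F\<^esub>)"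
      by (rule Cr_family_cong) auto
    then have "continuous_map (discrete_topology {()}) ?T (\<lambda>_. \<lambda>x\<in>S. \<zero>\<^bsub>F\<^esub>)"
      unfolding iff by simp
    then show "(\<lambda>x\<in>S. \<zero>\<^bsub>F\<^esub>) \<in> carrier (Cr_manifold_space M F r)"
      unfolding topspace_Cr_manifold_space[symmetric] continuous_map_def by simp
    have "Cr_family (prod_topology ?T ?T) M F r (\<lambda>(f, g). \<lambda>x\<in>S. f x \<oplus>\<^bsub>F\<^esub> g x)"
      using Cr_family_add[OF F Cr_family_reparametrize[OF continuous_map_fst id]
          Cr_family_reparametrize[OF continuous_map_snd id]]
      by (rule Cr_family_cong) auto
    then show "continuous_map (prod_topology ?T ?T) ?T (\<lambda>(f, g). \<lambda>x\<in>S. f x \<oplus>\<^bsub>F\<^esub> g x)"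
      unfolding iff by auto
    have "Cr_family (prod_topology euclidean ?T) M F r (\<lambda>(t, f). \<lambda>x\<in>S. t \<odot>\<^bsub>F\<^esub> f x)"
      using Cr_family_smult[OF F continuous_map_fst Cr_family_reparametrize[OF continuous_map_snd id]]
      by (rule Cr_family_cong) auto
    then show "continuous_map (prod_topology euclidean ?T) ?T (\<lambda>(t, f). \<lambda>x\<in>S. t \<odot>\<^bsub>F\<^esub> f x)"
      unfolding iff by auto
  qed
qed

section \<open>The subspaces of maps supported in K and the open sets of U-valued maps\<close>

lemma Cr_manifold_space_simps:
  "zero (Cr_manifold_space M F r) = (\<lambda>x\<in>S. \<zero>\<^bsub>F\<^esub>)"
  "add (Cr_manifold_space M F r) = (\<lambda>f g. \<lambda>x\<in>S. f x \<oplus>\<^bsub>F\<^esub> g x)"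
  "smult (Cr_manifold_space M F r) = (\<lambda>t f. \<lambda>x\<in>S. t \<odot>\<^bsub>F\<^esub> f x)"
  by (simp_all add: Cr_manifold_space_def Let_def)

lemma CrK_space_simps:
  "carrier (CrK_space M K F r) = {\<eta> \<in> carrier (Cr_manifold_space M F r). support (space_of M) F \<eta> \<subseteq> K}"
  "zero (CrK_space M K F r) = (\<lambda>x\<in>S. \<zero>\<^bsub>F\<^esub>)"
  "add (CrK_space M K F r) = (\<lambda>f g. \<lambda>x\<in>S. f x \<oplus>\<^bsub>F\<^esub> g x)"
  "smult (CrK_space M K F r) = (\<lambda>t f. \<lambda>x\<in>S. t \<odot>\<^bsub>F\<^esub> f x)"
  "topol (CrK_space M K F r) =
    subtopology (topol (Cr_manifold_space M F r)) (carrier (CrK_space M K F r))"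
  by (simp_all add: CrK_space_def Let_def)

lemma topspace_CrK_space: "topspace (topol (CrK_space M K F r)) = carrier (CrK_space M K F r)"
  by (auto simp: CrK_space_simps topspace_Cr_manifold_space)

lemma Cr_family_CrK_space:
  assumes "topological_vector_space F"
  shows "Cr_family (topol (CrK_space M K F r)) M F r (\<lambda>\<eta>. \<eta>)"
proof -
  have "continuous_map (topol (CrK_space M K F r)) (topol (Cr_manifold_space M F r)) (\<lambda>\<eta>. \<eta>)"
    by (simp add: CrK_space_simps(5) continuous_map_from_subtopology)
  then show ?thesis
    using continuous_map_into_Cr_manifold_space[OF assms] by blast
qed

lemma topological_vector_space_CrK_space:
  assumes F: "topological_vector_space F"
  shows "topological_vector_space (CrK_space M K F r)"
proof -
  interpret F: topological_vector_space F by fact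
  let ?C = "topol (Cr_manifold_space M F r)"
  let ?T = "topol (CrK_space M K F r)"
  let ?A = "carrier (CrK_space M K F r)"
  interpret C: topological_vector_space "Cr_manifold_space M F r"
    by (rule topological_vector_space_Cr_manifold_space[OF F])
  have C: "CrK_space M K F r = function_tvs S F ?A ?T"
    by (simp add: CrK_space_def Let_def)
  have in_A: "f \<in> ?A" if "f \<in> carrier (Cr_manifold_space M F r)" "support (space_of M) F f \<subseteq> K" for f
    using that by (simp add: CrK_space_simps)
  \<comment> \<open>Closure commutes with finite unions, so a function vanishing wherever g and g'
    both vanish is again supported in K. This covers sums, and scalar multiples by taking g =
    g'.\<close>
  have sub: "support (space_of M) F h \<subseteq> K"
    if "g \<in> ?A" "g' \<in> ?A" "\<And>x. x \<in> S \<Longrightarrow> g x = \<zero>\<^bsub>F\<^esub> \<Longrightarrow> g' x = \<zero>\<^bsub>F\<^esub> \<Longrightarrow> h x = \<zero>\<^bsub>F\<^esub>" for g g' h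
  proof -
    have "support (space_of M) F h \<subseteq>
        space_of M closure_of ({x \<in> S. g x \<noteq> \<zero>\<^bsub>F\<^esub>} \<union> {x \<in> S. g' x \<noteq> \<zero>\<^bsub>F\<^esub>})"
      unfolding support_def using that(3) by (intro closure_of_mono) blast
    also have "\<dots> = support (space_of M) F g \<union> support (space_of M) F g'"
      by (simp add: support_def)
    also have "\<dots> \<subseteq> K"
      using that(1,2) by (simp add: CrK_space_simps)
    finally show ?thesis .
  qed
  have incl: "continuous_map ?T ?C (\<lambda>\<eta>. \<eta>)"
    by (simp add: CrK_space_simps(5) continuous_map_from_subtopology)
  have intoT: "continuous_map B ?T f" if "continuous_map B ?C f" "f ` topspace B \<subseteq> ?A" for B f
    unfolding CrK_space_simps(5) using that by (auto simp: continuous_map_in_subtopology)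
  show ?thesis
  proof (subst C, rule topological_vector_space_function_tvs[OF F topspace_CrK_space])
    show "?A \<subseteq> extensional S"
      by (auto simp: CrK_space_simps carrier_Cr_manifold_space)
    show "continuous_map ?T (topol F) (\<lambda>f. f x)" if "x \<in> S" for x
    proof -
      have "continuous_map ?T (prod_topology ?T (space_of M)) (\<lambda>f. (f, x))"
        using that by (intro continuous_map_pairedI) auto
      from continuous_map_compose[OF this Cr_family_continuous[OF Cr_family_CrK_space[OF F]]]
      show ?thesis by (simp add: o_def)
    qed
    have "{x \<in> S. (\<lambda>x\<in>S. \<zero>\<^bsub>F\<^esub>) x \<noteq> \<zero>\<^bsub>F\<^esub>} = {}"
      by auto
    then have "support (space_of M) F (\<lambda>x\<in>S. \<zero>\<^bsub>F\<^esub>) = {}"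
      unfolding support_def by (simp only: closure_of_empty)
    then show "(\<lambda>x\<in>S. \<zero>\<^bsub>F\<^esub>) \<in> ?A"
      using C.zero_closed by (intro in_A) (auto simp: Cr_manifold_space_simps)
    have "continuous_map (prod_topology ?T ?T) ?C (\<lambda>p. fst p \<oplus>\<^bsub>Cr_manifold_space M F r\<^esub> snd p)"
      by (intro C.continuous_map_add continuous_map_compose[OF continuous_map_fst incl, unfolded o_def]
          continuous_map_compose[OF continuous_map_snd incl, unfolded o_def])
    moreover have "f \<oplus>\<^bsub>Cr_manifold_space M F r\<^esub> g \<in> ?A" if "f \<in> ?A" "g \<in> ?A" for f g
      using that by (intro in_A C.add.m_closed sub[OF that])
        (auto simp: CrK_space_simps Cr_manifold_space_simps)
    ultimately have "continuous_map (prod_topology ?T ?T) ?T (\<lambda>p. fst p \<oplus>\<^bsub>Cr_manifold_space M F r\<^esub> snd p)"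
      by (intro intoT) (auto simp: topspace_CrK_space)
    then show "continuous_map (prod_topology ?T ?T) ?T (\<lambda>(f, g). \<lambda>x\<in>S. f x \<oplus>\<^bsub>F\<^esub> g x)"
      by (simp add: Cr_manifold_space_simps case_prod_beta')
    have "continuous_map (prod_topology euclidean ?T) ?C (\<lambda>p. fst p \<odot>\<^bsub>Cr_manifold_space M F r\<^esub> snd p)"
      by (intro C.continuous_map_smult continuous_map_fst
          continuous_map_compose[OF continuous_map_snd incl, unfolded o_def])
    moreover have "t \<odot>\<^bsub>Cr_manifold_space M F r\<^esub> f \<in> ?A" if "f \<in> ?A" for t f
      using that by (intro in_A C.smult_carrier sub[OF that that])
        (auto simp: CrK_space_simps Cr_manifold_space_simps)
    ultimately have "continuous_map (prod_topology euclidean ?T) ?T (\<lambda>p. fst p \<odot>\<^bsub>Cr_manifold_space M F r\<^esub> snd p)"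
      by (intro intoT) (auto simp: topspace_CrK_space)
    then show "continuous_map (prod_topology euclidean ?T) ?T (\<lambda>(t, f). \<lambda>x\<in>S. t \<odot>\<^bsub>F\<^esub> f x)"
      by (simp add: Cr_manifold_space_simps case_prod_beta')
  qed
qed

text \<open>All \<eta> vanish off K, so having values in U is a condition on the compact set K
  alone, and open by \<open>openin_forall_compact\<close>, unless 0 is a value that has to be taken
  but is not in U.\<close>

lemma openin_CrK_into:
  assumes F: "topological_vector_space F" and U: "openin (topol F) U"
    and K: "compactin (space_of M) K"
  shows "openin (topol (CrK_space M K F r)) (CrK_into M K F U r)"
proof -
  let ?T = "topol (CrK_space M K F r)"
  have zero: "\<eta> x = \<zero>\<^bsub>F\<^esub>" if "\<eta> \<in> carrier (CrK_space M K F r)" "x \<in> S - K" for \<eta> x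
  proof -
    have "{x \<in> S. \<eta> x \<noteq> \<zero>\<^bsub>F\<^esub>} \<subseteq> support (space_of M) F \<eta>"
      unfolding support_def by (intro closure_of_subset) auto
    then show ?thesis using that by (auto simp: CrK_space_simps)
  qed
  show ?thesis
  \<comment> \<open>In the second case some point off K carries the value 0, which is not in U, and
    the set is empty.\<close>
  proof (cases "S \<subseteq> K \<or> \<zero>\<^bsub>F\<^esub> \<in> U")
    case True
    define P where "P = {p \<in> topspace (prod_topology ?T (space_of M)). (case p of (\<eta>, x) \<Rightarrow> \<eta> x) \<in> U}"
    have P: "openin (prod_topology ?T (space_of M)) P"
      unfolding P_def
      by (rule openin_continuous_map_preimage[OF Cr_family_continuous[OF Cr_family_CrK_space[OF F]] U])
    have KS: "K \<subseteq> S"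
      by (rule compactin_subset_topspace[OF K])
    have "\<eta> x \<in> U" if "\<eta> \<in> carrier (CrK_space M K F r)" "\<forall>y\<in>K. \<eta> y \<in> U" "x \<in> S" for \<eta> x
      using that True zero[OF that(1), of x] by (cases "x \<in> K") auto
    then have "CrK_into M K F U r = {\<eta> \<in> carrier (CrK_space M K F r). \<forall>x\<in>K. \<eta> x \<in> U}"
      unfolding CrK_into_def using KS by blast
    also have "\<dots> = {\<eta> \<in> topspace ?T. \<forall>x\<in>K. (\<eta>, x) \<in> P}"
      using KS by (auto simp: P_def topspace_CrK_space)
    finally have "CrK_into M K F U r = {\<eta> \<in> topspace ?T. \<forall>x\<in>K. (\<eta>, x) \<in> P}" .
    then show ?thesis
      using openin_forall_compact[OF P K] by simp
  next
    case False
    then obtain x where x: "x \<in> S - K" "\<zero>\<^bsub>F\<^esub> \<notin> U" by blast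
    then have "CrK_into M K F U r = {}"
      using zero[OF _ x(1)] by (auto simp: CrK_into_def)
    then show ?thesis by simp
  qed
qed

end


section \<open>The composition map\<close>

context open_domain
begin

text \<open>Linearity of brackets in the function. The same combination of the brackets of f and g
  satisfies the equation for a bracket of h, so uniqueness applies.\<close>

lemma bmap_linear_combination:
  assumes F: "topological_vector_space F" and "Ck E U F n f" "Ck E U F n g" "Ck E U F n h"
    and h: "\<And>x. x \<in> U \<Longrightarrow> h x = f x \<oplus>\<^bsub>F\<^esub> s \<odot>\<^bsub>F\<^esub> g x"
  shows "i \<le> n \<Longrightarrow> p \<in> bdom E U i \<Longrightarrow>
    bmap E U F h i p = bmap E U F f i p \<oplus>\<^bsub>F\<^esub> s \<odot>\<^bsub>F\<^esub> bmap E U F g i p"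
proof (induction i arbitrary: p)
  case 0
  then show ?case using h by (auto simp: bmap_0)
next
  case (Suc i)
  interpret F: topological_vector_space F by fact
  have C: "Ck E U F (Suc i) f" "Ck E U F (Suc i) g" "Ck E U F (Suc i) h"
    using assms(2-4) Suc.prems(1) Ck_mono by blast+
  have C': "Ck E U F i f" "Ck E U F i g" "Ck E U F i h"
    using C by auto
  note d = difference_factorD[OF difference_factor_bmap[OF F C(1)]]
    difference_factorD[OF difference_factor_bmap[OF F C(2)]]
  show ?case
  proof (rule difference_factor_unique[OF F continuous_map_bmap[OF F C(3)] difference_factor_bmap[OF F C(3)] _ _ _ Suc.prems(2)])
    show "bmap E U F h i \<in> bdom E U i \<rightarrow> carrier F"
      using bmap_in_carrier[OF F C'(3)] by auto
    show "continuous_map (btop E U (Suc i)) (topol F)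
        (\<lambda>p. bmap E U F f (Suc i) p \<oplus>\<^bsub>F\<^esub> s \<odot>\<^bsub>F\<^esub> bmap E U F g (Suc i) p)"
      by (intro F.continuous_map_add F.continuous_map_smult continuous_map_bmap[OF F] C)
        (simp add: continuous_map_const)
    show "difference_factor E U F i (bmap E U F h i)
        (\<lambda>p. bmap E U F f (Suc i) p \<oplus>\<^bsub>F\<^esub> s \<odot>\<^bsub>F\<^esub> bmap E U F g (Suc i) p)"
      unfolding difference_factor_def
    proof (intro allI impI)
      fix x y t assume S: "Step x y t \<in> bdom E U (Suc i)"
      have x: "x \<in> bdom E U i" "x \<oplus>\<^bsub>bspace E i\<^esub> t \<odot>\<^bsub>bspace E i\<^esub> y \<in> bdom E U i"
        using S by (simp_all add: Step_in_bdom)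
      have i: "i \<le> n" using Suc.prems(1) by simp
      note cl = bmap_in_carrier[OF F C'(1) x(1)] bmap_in_carrier[OF F C'(2) x(1)]
        bmap_in_carrier[OF F C(1) S] bmap_in_carrier[OF F C(2) S]
      show "bmap E U F h i (x \<oplus>\<^bsub>bspace E i\<^esub> t \<odot>\<^bsub>bspace E i\<^esub> y) = bmap E U F h i x \<oplus>\<^bsub>F\<^esub>
          t \<odot>\<^bsub>F\<^esub> (bmap E U F f (Suc i) (Step x y t) \<oplus>\<^bsub>F\<^esub> s \<odot>\<^bsub>F\<^esub> bmap E U F g (Suc i) (Step x y t))"
        unfolding Suc.IH[OF i x(1)] Suc.IH[OF i x(2)] d[OF S]
        using cl by (simp add: F.smult_add_right F.smult_smult F.M.a_ac mult.commute del: bmap.simps)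
    qed
  qed
qed

end

locale composition = charted_space M
  for M :: "('k :: topological_field, 'm, 'z) manifold" +
  fixes E :: "('k, 'e) tvs" and F :: "('k, 'f) tvs" and U :: "'f set" and K :: "'m set"
    and r k :: enat
  assumes E: "topological_vector_space E"
    and F: "finite_dimensional_tvs F"
    and U: "openin (topol F) U"
    and K: "compactin (space_of M) K"
begin

abbreviation "CU \<equiv> Cr_space F U E (r + k)"
abbreviation "CK \<equiv> CrK_space M K F r"
abbreviation "P \<equiv> prod_tvs CU CK"
abbreviation "D \<equiv> carrier CU \<times> CrK_into M K F U r"
abbreviation "T \<equiv> Cr_manifold_space M E r"
abbreviation "\<Gamma> \<equiv> \<lambda>(\<gamma> :: 'f \<Rightarrow> 'e, \<eta> :: 'm \<Rightarrow> 'f). compose S \<gamma> \<eta>"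

lemma F_tvs: "topological_vector_space F"
  using F by (simp add: finite_dimensional_tvs_def)

sublocale E: topological_vector_space E by (rule E)
sublocale T: topological_vector_space T by (rule topological_vector_space_Cr_manifold_space[OF E])
sublocale CK: topological_vector_space CK by (rule topological_vector_space_CrK_space[OF F_tvs])
sublocale FU: locally_compact_open_domain F U
  by (intro locally_compact_open_domain.intro locally_compact_open_domain_axioms.intro
      topological_vector_space.open_domainI F_tvs U locally_compact_field
      locally_compact_finite_dimensional[OF F])
sublocale CU: topological_vector_space CU
  by (rule FU.topological_vector_space_Cr_space[OF E])
text \<open>Openness of D rests on that of \<open>CrK_into\<close>, hence on the compactness of K.
  It makes brackets of maps on D unique.\<close>

sublocale P: open_domain P D
proof -
  interpret topological_vector_space P
    by (intro topological_vector_space_prod CU.topological_vector_space_axioms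
        CK.topological_vector_space_axioms)
  have "openin (topol CU) (carrier CU)"
    by (simp flip: CU.topspace_topol)
  then show "open_domain P D"
    by (intro open_domainI) (simp add: openin_prod_Times_iff openin_CrK_into[OF F_tvs U K])
qed

lemma CU_Ck:
  assumes "\<gamma> \<in> carrier CU" "enat n \<le> r + k"
  shows "Ck F U E n \<gamma>"
  using assms by (simp add: FU.carrier_Cr_space Cr_def)

lemma CU_simps:
  "x \<in> U \<Longrightarrow> (\<gamma> \<oplus>\<^bsub>CU\<^esub> t \<odot>\<^bsub>CU\<^esub> \<gamma>') x = \<gamma> x \<oplus>\<^bsub>E\<^esub> t \<odot>\<^bsub>E\<^esub> \<gamma>' x"
  by (simp add: Cr_space_def Let_def)

lemma bmap_CU_linear:
  assumes "\<gamma> \<in> carrier CU" "\<gamma>' \<in> carrier CU" "enat i \<le> r + k" "p \<in> bdom F U i"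
  shows "bmap F U E (\<gamma> \<oplus>\<^bsub>CU\<^esub> t \<odot>\<^bsub>CU\<^esub> \<gamma>') i p = bmap F U E \<gamma> i p \<oplus>\<^bsub>E\<^esub> t \<odot>\<^bsub>E\<^esub> bmap F U E \<gamma>' i p"
  by (rule FU.bmap_linear_combination[OF E CU_Ck[OF _ assms(3)] CU_Ck[OF _ assms(3)]
        CU_Ck[OF _ assms(3)] CU_simps order_refl assms(4)])
    (use assms(1,2) in auto)

lemma enat_le_trans: "m \<le> n \<Longrightarrow> enat n \<le> b \<Longrightarrow> enat m \<le> b"
  by (rule order_trans[of _ "enat n"]) simp_all

text \<open>The balance of orders: having spent i \<le> k orders, a function of class r + k still
  has the n \<le> r brackets that the chain rule along M consumes.\<close>

lemma enat_order_le: "enat i \<le> k \<Longrightarrow> enat n \<le> r \<Longrightarrow> enat (i + n) \<le> r + k"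
  using add_mono[of "enat n" r "enat i" k] by (simp add: add.commute)

text \<open>The brackets of \<open>\<Gamma>\<close> are of this form. That \<open>a p x\<close> can be kept linear in \<open>p\<close> is due to expanding
  \<open>\<gamma>' \<circ> (\<eta> + t \<eta>')\<close> around \<open>\<eta>\<close>; the price is the scalar factor \<open>m\<close>.\<close>

inductive comp_term :: "nat \<Rightarrow> (('k, ('f \<Rightarrow> 'e) \<times> ('m \<Rightarrow> 'f)) bpoint \<Rightarrow> 'm \<Rightarrow> 'e) \<Rightarrow> bool" where
  bmap: "comp_term j (\<lambda>p x. bmap F U E (l p) i (a p x))"
  if "i \<le> j" "tvs_linear (bspace P j) CU l" "continuous_map (topol (bspace P j)) (topol CU) l"
    "\<And>x. x \<in> S \<Longrightarrow> tvs_linear (bspace P j) (bspace F i) (\<lambda>p. a p x)"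
    "Cr_family (topol (bspace P j)) M (bspace F i) r a"
    "\<And>p x. p \<in> bdom P D j \<Longrightarrow> x \<in> S \<Longrightarrow> a p x \<in> bdom F U i"
| add: "comp_term j (\<lambda>p x. \<phi> p x \<oplus>\<^bsub>E\<^esub> \<psi> p x)" if "comp_term j \<phi>" "comp_term j \<psi>"
| smult: "comp_term j (\<lambda>p x. m p \<odot>\<^bsub>E\<^esub> \<phi> p x)"
  if "tvs_linear (bspace P j) field_tvs m" "continuous_map (topol (bspace P j)) euclidean m"
    "comp_term j \<phi>"

section \<open>Calculus of terms: continuity along M and stability under brackets\<close>

lemma tvs_linear_bfst: "tvs_linear (bspace P j) H f \<Longrightarrow> tvs_linear (bspace P (Suc j)) H (\<lambda>p. f (bfst p))"
  and tvs_linear_bsnd: "tvs_linear (bspace P j) H f \<Longrightarrow> tvs_linear (bspace P (Suc j)) H (\<lambda>p. f (bsnd p))"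
  by (auto simp: tvs_linear_def bspace_Suc elim!: carrier_bspace_SucE)

lemma tvs_linear_bpar: "tvs_linear (bspace P (Suc j)) field_tvs bpar"
  by (auto simp: tvs_linear_def bspace_Suc elim!: carrier_bspace_SucE)

lemmas continuous_map_bproj = continuous_map_bspace_projections[OF P.tvs_E]

lemmas continuous_map_bfst_comp = continuous_map_compose[OF continuous_map_bproj(1), unfolded o_def]
  and continuous_map_bsnd_comp = continuous_map_compose[OF continuous_map_bproj(2), unfolded o_def]

text \<open>Needed for the product rule, where a term is kept at the base point. The bracket level i
  does not grow although j does, which is why terms require i \<le> j rather than equality.\<close>

lemma comp_term_bfst: "comp_term j \<phi> \<Longrightarrow> comp_term (Suc j) (\<lambda>p. \<phi> (bfst p))"
proof (induction rule: comp_term.induct)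
  case (bmap i j l a)
  show ?case
    by (rule comp_term.bmap)
      (use bmap in \<open>auto intro: tvs_linear_bfst continuous_map_bfst_comp
        Cr_family_reparametrize[OF continuous_map_bproj(1)] elim!: bdom_SucE\<close>)
next
  case (add j \<phi> \<psi>)
  then show ?case by (intro comp_term.add)
next
  case (smult j m \<phi>)
  then show ?case
    by (intro comp_term.smult tvs_linear_bfst continuous_map_bfst_comp)
qed

text \<open>In a \<open>bmap\<close> term, l is continuous into C^(r+k)(U, E), so the exponential
  law on U makes p mapped to l p a family. The chain rule along M then composes its i-th brackets
  with a.\<close>

lemma comp_term_family:
  assumes "comp_term j \<phi>" "enat j \<le> k"
  shows "Cr_family (btop P D j) M E r \<phi>"
  using assms
proof (induction rule: comp_term.induct)
  case (bmap i j l a)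
  have sub: "continuous_map (btop P D j) (topol H) f" if "continuous_map (topol (bspace P j)) (topol H) f" for H f
    using that by (simp add: btop_def continuous_map_from_subtopology)
  have ik: "enat i \<le> k"
    using bmap.hyps(1) bmap.prems by (rule enat_le_trans)
  show ?case
  proof (rule Cr_family_chain[OF F_tvs U])
    \<comment> \<open>Since i \<le> j \<le> k, the i + n brackets required here are
      available.\<close>
    fix n assume "enat n \<le> r"
    then have "Cn_family (btop P D j) F U E (i + n) 0 (\<lambda>p. bmap F U E (l p) 0)"
      using sub[OF bmap.hyps(3)] enat_order_le[OF ik]
      unfolding FU.continuous_map_into_Cr_space_bmap[OF E] by blast
    then show "Cn_family (btop P D j) F U E n i (\<lambda>p. bmap F U E (l p) i)"
      by (rule FU.Cn_family_bmap_shift[OF E])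
  next
    have "continuous_map (btop P D j) (topol (bspace P j)) (\<lambda>p. p)"
      by (simp add: btop_def continuous_map_from_subtopology)
    then show "Cr_family (btop P D j) M (bspace F i) r a"
      using bmap.hyps(5) by (rule Cr_family_reparametrize)
    show "a p x \<in> bdom F U i" if "p \<in> topspace (btop P D j)" "x \<in> S" for p x
      using bmap.hyps(6) that by (simp add: P.topspace_btop)
  qed
next
  case (add j \<phi> \<psi>)
  then show ?case by (intro Cr_family_add[OF E])
next
  case (smult j m \<phi>)
  then show ?case
    by (intro Cr_family_smult[OF E]) (simp_all add: btop_def continuous_map_from_subtopology)
qed

lemma comp_term_carrier:
  assumes "comp_term j \<phi>" "enat j \<le> k" "p \<in> bdom P D j" "x \<in> S"
  shows "\<phi> p x \<in> carrier E"
  using continuous_map_image_subset_topspace[OF Cr_family_continuous_slice[OF comp_term_family[OF assms(1,2)]]]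
    assms(3,4) by (auto simp: P.topspace_btop E.topspace_topol)

lemma comp_term_continuous:
  assumes "comp_term j \<phi>" "enat j \<le> k"
  shows "continuous_map (btop P D j) (topol T) (\<lambda>p. \<lambda>x\<in>S. \<phi> p x)"
proof -
  have "Cr_family (btop P D j) M E r (\<lambda>p. \<lambda>x\<in>S. \<phi> p x)"
    using comp_term_family[OF assms] by (rule Cr_family_cong) simp
  then show ?thesis
    by (simp add: continuous_map_into_Cr_manifold_space[OF E])
qed

text \<open>The operations of C^r(M, E) are pointwise, so the equation for a bracket of a map into
  it can be tested at each x separately.\<close>

definition comp_factor :: "nat \<Rightarrow> (('k, ('f \<Rightarrow> 'e) \<times> ('m \<Rightarrow> 'f)) bpoint \<Rightarrow> 'm \<Rightarrow> 'e) \<Rightarrow>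
    (('k, ('f \<Rightarrow> 'e) \<times> ('m \<Rightarrow> 'f)) bpoint \<Rightarrow> 'm \<Rightarrow> 'e) \<Rightarrow> bool" where
  "comp_factor j \<phi> \<psi> \<longleftrightarrow> (\<forall>x\<in>S. difference_factor P D E j (\<lambda>p. \<phi> p x) (\<lambda>p. \<psi> p x))"

text \<open>Put u = a p x and u' = a p' x. Linearity of l, and of brackets in the function, first
  splits the value at p + t p' into the i-th brackets of l p and of l p', the latter with factor t,
  both taken at u + t u'. Each is then expanded at u by its next bracket at (u, u', t), and \<psi>
  collects the coefficient of t. The second expansion leaves a further factor t, the scalar
  \<open>bpar q\<close>.\<close>

lemma comp_factor_bmap:
  assumes "i \<le> j" "enat (Suc j) \<le> k"
    and l: "tvs_linear (bspace P j) CU l" "continuous_map (topol (bspace P j)) (topol CU) l"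
    and a: "\<And>x. x \<in> S \<Longrightarrow> tvs_linear (bspace P j) (bspace F i) (\<lambda>p. a p x)"
      "Cr_family (topol (bspace P j)) M (bspace F i) r a"
      "\<And>p x. p \<in> bdom P D j \<Longrightarrow> x \<in> S \<Longrightarrow> a p x \<in> bdom F U i"
  defines "b \<equiv> \<lambda>q x. Step (a (bfst q) x) (a (bsnd q) x) (bpar q)"
  defines "\<psi> \<equiv> \<lambda>q x. (bmap F U E (l (bfst q)) (Suc i) (b q x) \<oplus>\<^bsub>E\<^esub> bmap F U E (l (bsnd q)) i (a (bfst q) x)) \<oplus>\<^bsub>E\<^esub>
      bpar q \<odot>\<^bsub>E\<^esub> bmap F U E (l (bsnd q)) (Suc i) (b q x)"
  shows "comp_term (Suc j) \<psi>" "comp_factor j (\<lambda>p x. bmap F U E (l p) i (a p x)) \<psi>"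
proof -
  \<comment> \<open>By linearity of a, the point u + t u' equals a (p + t p') x, which lies in the
    domain because p + t p' does.\<close>
  have bU: "b q x \<in> bdom F U (Suc i)" if q: "q \<in> bdom P D (Suc j)" and x: "x \<in> S" for q x
  proof -
    obtain p p' t where S: "q = Step p p' t" "p \<in> bdom P D j" "p' \<in> carrier (bspace P j)"
      "p \<oplus>\<^bsub>bspace P j\<^esub> t \<odot>\<^bsub>bspace P j\<^esub> p' \<in> bdom P D j"
      using q by (rule bdom_SucE)
    have "p \<in> carrier (bspace P j)" using S(2) P.bdom_subset by blast
    note lin = tvs_linearD[OF a(1)[OF x]]
    show ?thesis
      using a(3)[OF S(2) x] a(3)[OF S(4) x] lin(1)[OF S(3)] lin(2)[OF \<open>p \<in> carrier (bspace P j)\<close> S(3)]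
      by (simp add: S(1) b_def Step_in_bdom)
  qed
  \<comment> \<open>Addition and scalar multiplication of triples are componentwise. Note that
    \<open>bsnd q\<close> is an arbitrary vector, not a point of the domain; for this reason l and a
    are required to be linear and continuous on the whole space \<open>bspace P j\<close>.\<close>
  have b_lin: "tvs_linear (bspace P (Suc j)) (bspace F (Suc i)) (\<lambda>q. b q x)" if "x \<in> S" for x
    using tvs_linearD[OF a(1)[OF that]]
    by (auto simp: tvs_linear_def b_def bspace_Suc elim!: carrier_bspace_SucE)
  have b_fam: "Cr_family (topol (bspace P (Suc j))) M (bspace F (Suc i)) r b"
    unfolding b_def
    by (intro Cr_family_tuple[OF F_tvs] Cr_family_reparametrize[OF continuous_map_bproj(1) a(2)]
        Cr_family_reparametrize[OF continuous_map_bproj(2) a(2)]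
        Cr_family_const[OF topological_vector_space_field_tvs])
      (simp add: continuous_map_bproj)
  have a_fam: "Cr_family (topol (bspace P (Suc j))) M (bspace F i) r (\<lambda>q. a (bfst q))"
    by (rule Cr_family_reparametrize[OF continuous_map_bproj(1) a(2)])
  have aU: "a (bfst q) x \<in> bdom F U i" if "q \<in> bdom P D (Suc j)" "x \<in> S" for q x
    using that a(3) by (auto elim!: bdom_SucE)
  note l1 = tvs_linear_bfst[OF l(1)] continuous_map_bfst_comp[OF l(2)]
  note l2 = tvs_linear_bsnd[OF l(1)] continuous_map_bsnd_comp[OF l(2)]
  show "comp_term (Suc j) \<psi>"
    unfolding \<psi>_def
    by (intro comp_term.add comp_term.smult comp_term.bmap tvs_linear_bpar continuous_map_bproj(3)
        l1 l2 b_lin b_fam bU tvs_linear_bfst a(1) a_fam aU)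
      (use assms(1) in auto)
  show "comp_factor j (\<lambda>p x. bmap F U E (l p) i (a p x)) \<psi>"
    unfolding comp_factor_def difference_factor_def
  proof (intro ballI allI impI)
    fix x p p' t assume x: "x \<in> S" and S: "Step p p' t \<in> bdom P D (Suc j)"
    have p: "p \<in> bdom P D j" "p \<in> carrier (bspace P j)" "p' \<in> carrier (bspace P j)"
      "p \<oplus>\<^bsub>bspace P j\<^esub> t \<odot>\<^bsub>bspace P j\<^esub> p' \<in> bdom P D j"
      using S P.bdom_subset by (auto simp: Step_in_bdom)
    define u u' where "u = a p x" and "u' = a p' x"
    have u: "a (p \<oplus>\<^bsub>bspace P j\<^esub> t \<odot>\<^bsub>bspace P j\<^esub> p') x = u \<oplus>\<^bsub>bspace F i\<^esub> t \<odot>\<^bsub>bspace F i\<^esub> u'"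
      using tvs_linearD(2)[OF a(1)[OF x] p(2,3)] by (simp add: u_def u'_def)
    have Su: "Step u u' t \<in> bdom F U (Suc i)"
      using bU[OF S x] by (simp add: b_def u_def u'_def)
    then have uU: "u \<in> bdom F U i" "u \<oplus>\<^bsub>bspace F i\<^esub> t \<odot>\<^bsub>bspace F i\<^esub> u' \<in> bdom F U i"
      by (simp_all add: Step_in_bdom)
    have lp: "l p \<in> carrier CU" "l p' \<in> carrier CU"
      "l (p \<oplus>\<^bsub>bspace P j\<^esub> t \<odot>\<^bsub>bspace P j\<^esub> p') = l p \<oplus>\<^bsub>CU\<^esub> t \<odot>\<^bsub>CU\<^esub> l p'"
      using tvs_linearD[OF l(1)] p by auto
    \<comment> \<open>The brackets of order i + 1 of l p and l p' exist because i + 1 \<le> j + 1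
      \<le> k.\<close>
    have "Suc i \<le> Suc j" using assms(1) by simp
    then have "enat (Suc i) \<le> k"
      using assms(2) by (rule enat_le_trans)
    then have i1: "enat (Suc i) \<le> r + k"
      using enat_order_le[of "Suc i" 0] by (simp add: enat_0)
    then have i0: "enat i \<le> r + k"
      by (rule enat_le_trans[rotated]) simp
    note C = CU_Ck[OF lp(1) i1] CU_Ck[OF lp(2) i1]
    note C0 = CU_Ck[OF lp(1) i0] CU_Ck[OF lp(2) i0]
    note cl = FU.bmap_in_carrier[OF E C(1) Su] FU.bmap_in_carrier[OF E C(2) Su]
      FU.bmap_in_carrier[OF E C0(1) uU(1)] FU.bmap_in_carrier[OF E C0(2) uU(1)]
    show "bmap F U E (l (p \<oplus>\<^bsub>bspace P j\<^esub> t \<odot>\<^bsub>bspace P j\<^esub> p')) i (a (p \<oplus>\<^bsub>bspace P j\<^esub> t \<odot>\<^bsub>bspace P j\<^esub> p') x) =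
        bmap F U E (l p) i (a p x) \<oplus>\<^bsub>E\<^esub> t \<odot>\<^bsub>E\<^esub> \<psi> (Step p p' t) x"
      unfolding u lp(3) bmap_CU_linear[OF lp(1,2) i0 uU(2)]
        difference_factorD[OF FU.difference_factor_bmap[OF E C(1)] Su]
        difference_factorD[OF FU.difference_factor_bmap[OF E C(2)] Su]
      using cl
      by (simp add: \<psi>_def b_def E.smult_add_right E.M.a_ac del: bmap.simps flip: u_def u'_def)
  qed
qed

text \<open>Stability of terms under brackets: \<open>comp_factor_bmap\<close> for the basic terms,
  additivity for sums, a product rule for scalar factors.\<close>

lemma comp_factor_exists:
  assumes "comp_term j \<phi>" "enat (Suc j) \<le> k"
  shows "\<exists>\<psi>. comp_term (Suc j) \<psi> \<and> comp_factor j \<phi> \<psi>"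
  using assms
proof (induction rule: comp_term.induct)
  case (bmap i j l a)
  note s = comp_factor_bmap[where l = l and a = a, OF bmap.hyps(1) bmap.prems bmap.hyps(2-)]
  show ?case
    by (intro exI conjI) (rule s; assumption)+
next
  case (add j \<phi> \<psi>)
  then obtain \<phi>' \<psi>' where t: "comp_term (Suc j) \<phi>'" "comp_term (Suc j) \<psi>'"
    and f: "comp_factor j \<phi> \<phi>'" "comp_factor j \<psi> \<psi>'"
    by blast
  have jk: "enat j \<le> k"
    using add.prems by (rule enat_le_trans[rotated]) simp
  have "comp_factor j (\<lambda>p x. \<phi> p x \<oplus>\<^bsub>E\<^esub> \<psi> p x) (\<lambda>p x. \<phi>' p x \<oplus>\<^bsub>E\<^esub> \<psi>' p x)"
    unfolding comp_factor_def
  proof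
    fix x assume x: "x \<in> S"
    show "difference_factor P D E j (\<lambda>p. \<phi> p x \<oplus>\<^bsub>E\<^esub> \<psi> p x) (\<lambda>p. \<phi>' p x \<oplus>\<^bsub>E\<^esub> \<psi>' p x)"
      unfolding difference_factor_def
    proof (intro allI impI)
      fix p p' s assume S: "Step p p' s \<in> bdom P D (Suc j)"
      then have p: "p \<in> bdom P D j" by (simp add: Step_in_bdom)
      have d: "difference_factor P D E j (\<lambda>p. \<phi> p x) (\<lambda>p. \<phi>' p x)"
        "difference_factor P D E j (\<lambda>p. \<psi> p x) (\<lambda>p. \<psi>' p x)"
        using f x by (auto simp: comp_factor_def)
      note cl = comp_term_carrier[OF add.hyps(1) jk p x] comp_term_carrier[OF add.hyps(2) jk p x]
        comp_term_carrier[OF t(1) add.prems S x] comp_term_carrier[OF t(2) add.prems S x]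
      show "\<phi> (p \<oplus>\<^bsub>bspace P j\<^esub> s \<odot>\<^bsub>bspace P j\<^esub> p') x \<oplus>\<^bsub>E\<^esub> \<psi> (p \<oplus>\<^bsub>bspace P j\<^esub> s \<odot>\<^bsub>bspace P j\<^esub> p') x =
          \<phi> p x \<oplus>\<^bsub>E\<^esub> \<psi> p x \<oplus>\<^bsub>E\<^esub> s \<odot>\<^bsub>E\<^esub> (\<phi>' (Step p p' s) x \<oplus>\<^bsub>E\<^esub> \<psi>' (Step p p' s) x)"
        unfolding difference_factorD[OF d(1) S] difference_factorD[OF d(2) S]
        using cl by (simp add: E.smult_add_right E.M.a_ac)
    qed
  qed
  then show ?case
    using comp_term.add[OF t] by blast
next
  case (smult j m \<phi>)
  then obtain \<phi>' where t: "comp_term (Suc j) \<phi>'" and f: "comp_factor j \<phi> \<phi>'"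
    by blast
  have jk: "enat j \<le> k"
    using smult.prems by (rule enat_le_trans[rotated]) simp
  \<comment> \<open>The coefficient of s in (m p + s m p') (\<phi> p + s \<phi>'), the last summand
    being the part that still contains a factor s.\<close>
  let ?\<psi> = "\<lambda>q x. (m (bsnd q) \<odot>\<^bsub>E\<^esub> \<phi> (bfst q) x \<oplus>\<^bsub>E\<^esub> m (bfst q) \<odot>\<^bsub>E\<^esub> \<phi>' q x) \<oplus>\<^bsub>E\<^esub>
    bpar q \<odot>\<^bsub>E\<^esub> (m (bsnd q) \<odot>\<^bsub>E\<^esub> \<phi>' q x)"
  have "comp_term (Suc j) ?\<psi>"
    by (intro comp_term.add comp_term.smult t comp_term_bfst smult.hyps tvs_linear_bfst tvs_linear_bsnd
        continuous_map_bfst_comp continuous_map_bsnd_comp tvs_linear_bpar continuous_map_bproj(3))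
  moreover have "comp_factor j (\<lambda>p x. m p \<odot>\<^bsub>E\<^esub> \<phi> p x) ?\<psi>"
    unfolding comp_factor_def
  proof
    fix x assume x: "x \<in> S"
    show "difference_factor P D E j (\<lambda>p. m p \<odot>\<^bsub>E\<^esub> \<phi> p x) (\<lambda>p. ?\<psi> p x)"
      unfolding difference_factor_def
    proof (intro allI impI)
      fix p p' s assume S: "Step p p' s \<in> bdom P D (Suc j)"
      then have p: "p \<in> bdom P D j" "p \<in> carrier (bspace P j)" "p' \<in> carrier (bspace P j)"
        using P.bdom_subset by (auto simp: Step_in_bdom)
      have d: "difference_factor P D E j (\<lambda>p. \<phi> p x) (\<lambda>p. \<phi>' p x)"
        using f x by (auto simp: comp_factor_def)
      have m: "m (p \<oplus>\<^bsub>bspace P j\<^esub> s \<odot>\<^bsub>bspace P j\<^esub> p') = m p + s * m p'"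
        using tvs_linearD(2)[OF smult.hyps(1) p(2,3)] by simp
      note cl = comp_term_carrier[OF smult.hyps(3) jk p(1) x] comp_term_carrier[OF t smult.prems S x]
      show "m (p \<oplus>\<^bsub>bspace P j\<^esub> s \<odot>\<^bsub>bspace P j\<^esub> p') \<odot>\<^bsub>E\<^esub> \<phi> (p \<oplus>\<^bsub>bspace P j\<^esub> s \<odot>\<^bsub>bspace P j\<^esub> p') x =
          m p \<odot>\<^bsub>E\<^esub> \<phi> p x \<oplus>\<^bsub>E\<^esub> s \<odot>\<^bsub>E\<^esub> ?\<psi> (Step p p' s) x"
        unfolding difference_factorD[OF d S] m
        using cl by (simp add: E.smult_add_right E.smult_add_left E.smult_smult E.M.a_ac ac_simps distrib_left)
    qed
  qed
  ultimately show ?case by blast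
qed

text \<open>Passes from pointwise equations in E to a bracket with values in C^r(M, E): continuity
  of the candidate holds for every term, and the equation is checked at each x.\<close>

lemma Ck_bmap_step:
  assumes "enat (Suc n) \<le> k" "Ck P D T n \<Gamma>"
    and "bmap P D T \<Gamma> n = (\<lambda>p\<in>bdom P D n. \<lambda>x\<in>S. \<phi> p x)"
    and "comp_term (Suc n) \<psi>" "comp_factor n \<phi> \<psi>"
  shows "Ck P D T (Suc n) \<Gamma>" "bmap P D T \<Gamma> (Suc n) = (\<lambda>p\<in>bdom P D (Suc n). \<lambda>x\<in>S. \<psi> p x)"
proof -
  let ?h = "\<lambda>p\<in>bdom P D (Suc n). \<lambda>x\<in>S. \<psi> p x"
  have c: "continuous_map (btop P D (Suc n)) (topol T) ?h"
    using comp_term_continuous[OF assms(4,1)]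
    by (rule continuous_map_eq) (simp add: P.topspace_btop)
  have d: "difference_factor P D T n (bmap P D T \<Gamma> n) ?h"
    unfolding difference_factor_def
  proof (intro allI impI)
    fix p p' t assume S: "Step p p' t \<in> bdom P D (Suc n)"
    then have p: "p \<in> bdom P D n" "p \<oplus>\<^bsub>bspace P n\<^esub> t \<odot>\<^bsub>bspace P n\<^esub> p' \<in> bdom P D n"
      by (simp_all add: Step_in_bdom)
    have "\<phi> (p \<oplus>\<^bsub>bspace P n\<^esub> t \<odot>\<^bsub>bspace P n\<^esub> p') x = \<phi> p x \<oplus>\<^bsub>E\<^esub> t \<odot>\<^bsub>E\<^esub> \<psi> (Step p p' t) x" if "x \<in> S" for x
    proof -
      have "difference_factor P D E n (\<lambda>p. \<phi> p x) (\<lambda>p. \<psi> p x)"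
        using assms(5) that by (simp add: comp_factor_def)
      from difference_factorD[OF this S] show ?thesis .
    qed
    then show "bmap P D T \<Gamma> n (p \<oplus>\<^bsub>bspace P n\<^esub> t \<odot>\<^bsub>bspace P n\<^esub> p') =
        bmap P D T \<Gamma> n p \<oplus>\<^bsub>T\<^esub> t \<odot>\<^bsub>T\<^esub> ?h (Step p p' t)"
      using p S by (auto simp: assms(3) Cr_manifold_space_simps intro!: restrict_ext)
  qed
  show "Ck P D T (Suc n) \<Gamma>"
    using P.Ck_Suc_iff[OF T.topological_vector_space_axioms] assms(2) c d by (auto simp del: Ck.simps)
  show "bmap P D T \<Gamma> (Suc n) = ?h"
    by (rule P.bmap_Suc_eq[OF T.topological_vector_space_axioms assms(2) _ c d]) simp
qed

section \<open>\<Gamma> as a term of level zero, and its brackets of all orders\<close>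

lemma tvs_linear_bval: "tvs_linear (bspace P 0) CU (\<lambda>p. fst (bval p))"
  "x \<in> S \<Longrightarrow> tvs_linear (bspace P 0) (bspace F 0) (\<lambda>p. Base (snd (bval p) x))"
proof -
  show "tvs_linear (bspace P 0) CU (\<lambda>p. fst (bval p))"
    by (auto simp: tvs_linear_def bspace_0)
  assume x: "x \<in> S"
  have "\<eta> x \<in> carrier F" if "\<eta> \<in> carrier CK" for \<eta>
    using continuous_map_image_subset_topspace[OF Cr_family_continuous_slice[OF Cr_family_CrK_space[OF F_tvs], of \<eta>]]
      that x by (auto simp: topspace_CrK_space FU.topspace_topol)
  then show "tvs_linear (bspace P 0) (bspace F 0) (\<lambda>p. Base (snd (bval p) x))"
    using x by (auto simp: tvs_linear_def bspace_0 CrK_space_simps(3,4))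
qed

lemma continuous_map_bval_P:
  "continuous_map (topol (bspace P 0)) (topol CU) (\<lambda>p. fst (bval p))"
  "continuous_map (topol (bspace P 0)) (topol CK) (\<lambda>p. snd (bval p))"
  using continuous_map_bval[OF P.tvs_E] by (simp_all add: continuous_map_pairwise o_def)

lemma Cr_family_Base: "Cr_family (topol (bspace P 0)) M (bspace F 0) r (\<lambda>p x. Base (snd (bval p) x))"
proof (rule Cr_family_linear_image[OF F_tvs _ continuous_map_Base[OF F_tvs]])
  show "tvs_linear F (bspace F 0) Base"
    by (auto simp: tvs_linear_def bspace_0)
  show "Cr_family (topol (bspace P 0)) M F r (\<lambda>p. snd (bval p))"
    by (rule Cr_family_reparametrize[OF continuous_map_bval_P(2) Cr_family_CrK_space[OF F_tvs]])
qed

lemma Base_in_bdom: "p \<in> bdom P D 0 \<Longrightarrow> x \<in> S \<Longrightarrow> Base (snd (bval p) x) \<in> bdom F U 0"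
  by (auto simp: CrK_into_def)

text \<open>Starting point of the induction: \<gamma>(\<eta> x) is \<gamma>^[0] at
  \<open>Base (\<eta> x)\<close>, and both \<gamma> and \<eta> x depend linearly on the pair
  (\<gamma>, \<eta>).\<close>

lemma comp_term_0: "comp_term 0 (\<lambda>p x. bmap F U E (fst (bval p)) 0 (Base (snd (bval p) x)))"
  by (rule comp_term.bmap)
    (rule order_refl tvs_linear_bval continuous_map_bval_P Cr_family_Base Base_in_bdom | assumption)+

lemma bmap_\<Gamma>_0:
  "bmap P D T \<Gamma> 0 = (\<lambda>p\<in>bdom P D 0. \<lambda>x\<in>S. bmap F U E (fst (bval p)) 0 (Base (snd (bval p) x)))"
proof
  fix p
  show "bmap P D T \<Gamma> 0 p = (\<lambda>p\<in>bdom P D 0. \<lambda>x\<in>S. bmap F U E (fst (bval p)) 0 (Base (snd (bval p) x))) p"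
  proof (cases "p \<in> bdom P D 0")
    case True
    then have "bmap F U E (fst (bval p)) 0 (Base (snd (bval p) x)) = fst (bval p) (snd (bval p) x)"
      if "x \<in> S" for x
      using bmap_0[OF Base_in_bdom[OF True that]] by simp
    then show ?thesis
      using True by (auto simp: bmap_0 compose_def case_prod_beta' intro!: restrict_ext simp del: bdom.simps)
  next
    case False
    then show ?thesis by (simp add: bmap.simps(1))
  qed
qed

lemma Ck_\<Gamma>_0: "Ck P D T 0 \<Gamma>"
proof -
  have "continuous_map (btop P D 0) (topol T) (bmap P D T \<Gamma> 0)"
    unfolding bmap_\<Gamma>_0
    by (rule continuous_map_eq[OF comp_term_continuous[OF comp_term_0]])
      (simp_all add: P.topspace_btop enat_0)
  then show ?thesis
    using P.continuous_map_bmap_0_iff[of T \<Gamma>] unfolding Ck.simps by blast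
qed

text \<open>The representation by a term is carried along, because the next bracket is computed from
  it.\<close>

lemma Ck_\<Gamma>:
  "enat n \<le> k \<Longrightarrow> Ck P D T n \<Gamma> \<and>
    (\<exists>\<phi>. comp_term n \<phi> \<and> bmap P D T \<Gamma> n = (\<lambda>p\<in>bdom P D n. \<lambda>x\<in>S. \<phi> p x))"
proof (induction n)
  case 0
  show ?case
    using Ck_\<Gamma>_0 comp_term_0 bmap_\<Gamma>_0 by blast
next
  case (Suc n)
  have "enat n \<le> k"
    using Suc.prems by (rule enat_le_trans[rotated]) simp
  then obtain \<phi> where \<phi>: "Ck P D T n \<Gamma>" "comp_term n \<phi>"
    "bmap P D T \<Gamma> n = (\<lambda>p\<in>bdom P D n. \<lambda>x\<in>S. \<phi> p x)"
    using Suc.IH by blast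
  obtain \<psi> where \<psi>: "comp_term (Suc n) \<psi>" "comp_factor n \<phi> \<psi>"
    using comp_factor_exists[OF \<phi>(2) Suc.prems] by blast
  show ?case
    using Ck_bmap_step[OF Suc.prems \<phi>(1,3) \<psi>] \<psi>(1) by blast
qed

text \<open>The explicit first bracket is evaluated at t = 0, where its last summand
  vanishes.\<close>

lemma differential_\<Gamma>:
  assumes k: "1 \<le> k" and \<gamma>: "\<gamma> \<in> carrier CU" "\<gamma>\<^sub>1 \<in> carrier CU"
    and \<eta>: "\<eta> \<in> CrK_into M K F U r" "\<eta>\<^sub>1 \<in> carrier CK"
  shows "differential P D T \<Gamma> (\<gamma>, \<eta>) (\<gamma>\<^sub>1, \<eta>\<^sub>1) =
    (\<lambda>x\<in>S. differential F U E \<gamma> (\<eta> x) (\<eta>\<^sub>1 x)) \<oplus>\<^bsub>T\<^esub> compose S \<gamma>\<^sub>1 \<eta>"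
proof -
  have k1: "enat (Suc 0) \<le> k"
    using k by (simp add: one_enat_def)
  let ?l = "\<lambda>p :: ('k, ('f \<Rightarrow> 'e) \<times> ('m \<Rightarrow> 'f)) bpoint. fst (bval p)"
  let ?a = "\<lambda>(p :: ('k, ('f \<Rightarrow> 'e) \<times> ('m \<Rightarrow> 'f)) bpoint) x. Base (snd (bval p) x) :: ('k, 'f) bpoint"
  note step = comp_factor_bmap[where i = 0 and j = 0 and l = ?l and a = ?a]
  note facts = order_refl k1 tvs_linear_bval continuous_map_bval_P Cr_family_Base Base_in_bdom
  \<comment> \<open>The formula of \<open>comp_factor_bmap\<close> for i = j = 0. The mere existence
    given by \<open>comp_factor_exists\<close> would not determine the values.\<close>
  define \<psi> where "\<psi> = (\<lambda>q x. (bmap F U E (?l (bfst q)) (Suc 0) (Step (?a (bfst q) x) (?a (bsnd q) x) (bpar q)) \<oplus>\<^bsub>E\<^esub>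
        bmap F U E (?l (bsnd q)) 0 (?a (bfst q) x)) \<oplus>\<^bsub>E\<^esub>
      bpar q \<odot>\<^bsub>E\<^esub> bmap F U E (?l (bsnd q)) (Suc 0) (Step (?a (bfst q) x) (?a (bsnd q) x) (bpar q)))"
  have \<psi>1: "comp_term (Suc 0) \<psi>"
    unfolding \<psi>_def by (rule step(1)) (rule facts | assumption)+
  have \<psi>2: "comp_factor 0 (\<lambda>p x. bmap F U E (?l p) 0 (?a p x)) \<psi>"
    unfolding \<psi>_def by (rule step(2)) (rule facts | assumption)+
  note bm = Ck_bmap_step(2)[OF k1 Ck_\<Gamma>_0 bmap_\<Gamma>_0 \<psi>1 \<psi>2]
  let ?p = "Step (Base (\<gamma>, \<eta>)) (Base (\<gamma>\<^sub>1, \<eta>\<^sub>1)) 0"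
  have "Base (\<gamma>, \<eta>) \<in> bdom P D 0" "Base (\<gamma>\<^sub>1, \<eta>\<^sub>1) \<in> carrier (bspace P 0)"
    using \<gamma> \<eta> by (auto simp: bspace_0)
  note p = P.Step_0_in_bdom(1)[OF this]
  have U: "\<eta> x \<in> U" if "x \<in> S" for x
    using \<eta>(1) that by (auto simp: CrK_into_def)
  have F: "\<eta>\<^sub>1 x \<in> carrier F" if x: "x \<in> S" for x
    using tvs_linearD(1)[OF tvs_linear_bval(2)[OF x] \<open>Base (\<gamma>\<^sub>1, \<eta>\<^sub>1) \<in> carrier (bspace P 0)\<close>]
    by (auto simp: bspace_0)
  have C: "Ck F U E (Suc 0) \<gamma>\<^sub>1"
    using \<gamma>(2) enat_order_le[OF k1, of 0] by (intro CU_Ck) (simp_all add: enat_0)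
  have "Step (Base (\<eta> x)) (Base (\<eta>\<^sub>1 x)) 0 \<in> bdom F U (Suc 0)" if "x \<in> S" for x
    using U[OF that] F[OF that] by (intro FU.Step_0_in_bdom(1)) (auto simp: bspace_0)
  \<comment> \<open>The summand with factor 0 disappears only once its vector is known to lie in the
    carrier of E.\<close>
  note cl1 = FU.bmap_in_carrier[OF E C this]
  have C': "Ck F U E 0 \<gamma>\<^sub>1" "Ck F U E (Suc 0) \<gamma>"
    using C FU.Ck_mono[OF C] \<gamma>(1) enat_order_le[OF k1, of 0] by (auto simp: enat_0 intro: CU_Ck simp del: Ck.simps)
  have b0: "bmap F U E \<gamma>\<^sub>1 0 (Base (\<eta> x)) = \<gamma>\<^sub>1 (\<eta> x)" if "x \<in> S" for x
    using bmap_0[of "Base (\<eta> x)" F U E \<gamma>\<^sub>1] U[OF that] by simp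
  have cl0: "\<gamma>\<^sub>1 (\<eta> x) \<in> carrier E" if "x \<in> S" for x
    using FU.bmap_in_carrier[OF E C'(1), of "Base (\<eta> x)"] U[OF that] b0[OF that] by simp
  have cl2: "bmap F U E \<gamma> (Suc 0) (Step (Base (\<eta> x)) (Base (\<eta>\<^sub>1 x)) 0) \<in> carrier E" if "x \<in> S" for x
    using U[OF that] F[OF that]
    by (intro FU.bmap_in_carrier[OF E C'(2)] FU.Step_0_in_bdom(1)) (auto simp: bspace_0)
  have "differential P D T \<Gamma> (\<gamma>, \<eta>) (\<gamma>\<^sub>1, \<eta>\<^sub>1) = bmap P D T \<Gamma> (Suc 0) ?p"
    by (simp add: differential_def del: bmap.simps)
  also have "\<dots> = (\<lambda>x\<in>S. (bmap F U E \<gamma> (Suc 0) (Step (Base (\<eta> x)) (Base (\<eta>\<^sub>1 x)) 0) \<oplus>\<^bsub>E\<^esub>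
      bmap F U E \<gamma>\<^sub>1 0 (Base (\<eta> x))) \<oplus>\<^bsub>E\<^esub> 0 \<odot>\<^bsub>E\<^esub> bmap F U E \<gamma>\<^sub>1 (Suc 0) (Step (Base (\<eta> x)) (Base (\<eta>\<^sub>1 x)) 0))"
    unfolding bm using p by (simp add: \<psi>_def del: bmap.simps)
  also have "\<dots> = (\<lambda>x\<in>S. differential F U E \<gamma> (\<eta> x) (\<eta>\<^sub>1 x)) \<oplus>\<^bsub>T\<^esub> compose S \<gamma>\<^sub>1 \<eta>"
    unfolding Cr_manifold_space_simps
    using cl1 cl0 cl2 b0 by (intro restrict_ext) (simp add: compose_def differential_def del: bmap.simps)
  finally show ?thesis .
qed

end

theorem proposition11p2:
  fixes E :: "('k :: topological_field, 'e) tvs"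
    and F :: "('k, 'f) tvs"
    and M :: "('k, 'm, 'z) manifold"
    and U :: "'f set" and K :: "'m set" and r k :: enat
  defines "\<Gamma> \<equiv> \<lambda>(\<gamma> :: 'f \<Rightarrow> 'e, \<eta> :: 'm \<Rightarrow> 'f). compose (topspace (space_of M)) \<gamma> \<eta>"
    and "S \<equiv> prod_tvs (Cr_space F U E (r + k)) (CrK_space M K F r)"
    and "D \<equiv> carrier (Cr_space F U E (r + k)) \<times> CrK_into M K F U r"
    and "T \<equiv> Cr_manifold_space M E r"
  assumes "locally_compact_space (euclidean :: 'k topology)"
    and "topological_vector_space E"
    and "Cr_manifold r M" and "finite_dimensional_tvs (model M)"
    and "finite_dimensional_tvs F"
    and "openin (topol F) U"
    and "compactin (space_of M) K"
  shows "Cr S D T k \<Gamma> \<and>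
    (1 \<le> k \<longrightarrow>
      (\<forall>\<gamma> \<in> carrier (Cr_space F U E (r + k)). \<forall>\<gamma>\<^sub>1 \<in> carrier (Cr_space F U E (r + k)).
       \<forall>\<eta> \<in> CrK_into M K F U r. \<forall>\<eta>\<^sub>1 \<in> carrier (CrK_space M K F r).
        differential S D T \<Gamma> (\<gamma>, \<eta>) (\<gamma>\<^sub>1, \<eta>\<^sub>1) =
          (\<lambda>x\<in>topspace (space_of M). differential F U E \<gamma> (\<eta> x) (\<eta>\<^sub>1 x))
            \<oplus>\<^bsub>T\<^esub> compose (topspace (space_of M)) \<gamma>\<^sub>1 \<eta>))"
proof -
  have charts: "c \<in> charts M \<Longrightarrow> is_chart (space_of M) (model M) c" for c
    using assms(7) by (simp add: Cr_manifold_def)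
  interpret composition M E F U K r k
    using assms charts
    by (intro composition.intro composition_axioms.intro charted_space.intro)
      (simp_all add: Cr_manifold_def)
  show ?thesis
    unfolding assms(1-4)
    using Ck_\<Gamma> differential_\<Gamma> by (auto simp: Cr_def simp del: Ck.simps)
qed

end
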